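(* Let $E\to M$ be a holomorphic vector bundle of finite rank on a complex manifold $M$. If $H^0(M,Der^{(2)}(\Lambda E))=0$, then there is an admissible family $D'=(D'_{2q})_{q\ge 2}$ such that the map $$\sigma_D:\ H^1(M,G_E)\to H^1(M,Der^{(2)}(\Lambda E)),\qquad \sigma_D([\exp(u)])=\Big[u+\sum_{q\geq 2}D'_{2q}(u)\Big]\quad (u\in\tilde C^1(M,Der^{(2)}(\Lambda E)))$$ is well-defined and injective.
   Context: Sheaves. $\mathcal O_{\Lambda E}$ is the sheaf of holomorphic sections of the exterior algebra bundle $\Lambda E$, a $\mathbb Z$-graded (hence $\mathbb Z/2\mathbb Z$-graded) sheaf of algebras. $Der(\Lambda E)$ and $End(\Lambda E)$ are the sheaves of even $\mathbb C$-linear derivations, resp. endomorphisms, of $\mathcal O_{\Lambda E}$; $Der_{2k}(\Lambda E)$, $End_{2k}(\Lambda E)$ are the parts sending $\mathcal O_{\Lambda^jE}$ to $\mathcal O_{\Lambda^{j+2k}E}$ for all $j\ge 0$. Put $Der^{(2)}(\Lambda E)=\bigoplus_{k\ge1}Der_{2k}(\Lambda E)$ and $End^{(2)}(\Lambda E)=\bigoplus_{k\geq 1}End_{2k}(\Lambda E)$. $pr_{2k}$ denotes the projection onto the degree-$2k$ component, and $pr_{(2k)}$ the projection onto the sum of the components of degrees $2,4,\dots,2k$ (applied to an automorphism of the form $Id+\text{(element of }End^{(2)})$, these projections ignore the summand $Id$). $G_E$ is the sheaf of automorphisms $\varphi$ of the $\mathbb Z/2\mathbb Z$-graded sheaf of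 algebras $\mathcal O_{\Lambda E}$ with $(\varphi-Id)(\mathcal O_{\Lambda^jE})\subset\bigoplus_{k\ge1}\mathcal O_{\Lambda^{j+2k}E}$ for all $j\geq 0$. The (finite) exponential series gives a bijection $\exp:Der^{(2)}(\Lambda E)\to G_E$ (known fact), with inverse $\log$. Cochains. All cochains are Čech cochains on a fixed open cover of $M$ that is a Leray cover for coherent sheaves. 1-cochains $u=(u_{ij})$ of derivations are alternating ($u_{ji}=-u_{ij}$). $d$ is the usual additive Čech coboundary, so for $w\in C^1(M,End^{(2)}(\Lambda E))$ one has $(dw)_{ijk}=w_{jk}-w_{ik}+w_{ij}$. The multiplicative coboundary is $(\mathbf d\exp(u))_{ijk}=\exp(u_{ij})\exp(u_{jk})\exp(u_{ki})$. $Z^1(M,G_E)$ is the set of $\exp(u)$ with $\mathbf d\exp(u)=Id$. For $v\in C^0(M,Der^{(2)}(\Lambda E))$ put $(\exp(v).\exp(u))_{ij}=\exp(v_i)\exp(u_{ij})\exp(-v_j)$; $H^1(M,G_E)$ is the set of orbits of this action on $Z^1(M,G_E)$. Let $\tilde C^1(M,Der^{(2)}(\Lambda E))=\{u\in C^1(M,Der^{(2)}(\Lambda E)) : \exp(u)\in Z^1(M,G_E)\}$. The maps $R_{2q}$. For $q\ge2$ and $u\in C^1(M,Der^{(2)}(\Lambda E))$ put $R_{2q}(u)=pr_{2q}\big(\mathbf d\exp(pr_{(2q-2)}(u))\big)\in C^2(M,End_{2q}(\Lambda E))$. For $u\in\tilde C^1(M,Der^{(2)}(\Lambda E))$ one has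 $R_{2q}(u)=-d(pr_{2q}(u))$. Admissible family. This is a family of maps $D'_{2q}:\tilde C^1(M,Der^{(2)}(\Lambda E))\to C^1(M,Der_{2q}(\Lambda E))$, $q\ge2$, such that $D'_{2q}(u)$ depends only on $pr_{(2q-2)}(u)$ and $d\,D'_{2q}(u)=R_{2q}(u)$ for all $u\in \tilde C^1(M,Der^{(2)}(\Lambda E))$. *)

theory Defs
  imports
    "HOL-Analysis.Analysis"
    "HOL-Algebra.Module"
    "HOL-Library.Function_Algebras"
begin

section \<open>Complex manifolds and holomorphic vector bundles\<close>

text \<open>The space of \<open>n\<close>-tuples of complex numbers, with \<open>n\<close> a natural number (possibly 0): extensional
  functions on \<open>{..<n}\<close>.\<close>

definition cspace :: "nat \<Rightarrow> (nat \<Rightarrow> complex) topology"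
  where "cspace n = product_topology (\<lambda>_. euclidean) {..<n}"

definition unit_vec :: "nat \<Rightarrow> nat \<Rightarrow> nat \<Rightarrow> complex"
  where "unit_vec n j = restrict (\<lambda>i. if i = j then 1 else 0) {..<n}"

text \<open>Holomorphic functions of several variables on an open set: continuous, and holomorphic in
  each variable separately.\<close>

definition holo_fun :: "nat \<Rightarrow> (nat \<Rightarrow> complex) set \<Rightarrow> ((nat \<Rightarrow> complex) \<Rightarrow> complex) \<Rightarrow> bool"
  where "holo_fun n D f \<longleftrightarrow>
    continuous_map (subtopology (cspace n) D) euclidean f \<and>
    (\<forall>a\<in>D. \<forall>i<n. (\<lambda>z. f (a(i := z))) field_differentiable (at (a i)))"

record 'm cmanifold =
  mtop :: "'m topology"
  mdim :: nat
  charts :: "('m set \<times> ('m \<Rightarrow> nat \<Rightarrow> complex)) set"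

definition complex_manifold :: "'m cmanifold \<Rightarrow> bool"
  where "complex_manifold X \<longleftrightarrow>
    Hausdorff_space (mtop X) \<and> second_countable (mtop X) \<and>
    (\<Union>(fst ` charts X) = topspace (mtop X)) \<and>
    (\<forall>(U, \<phi>) \<in> charts X.
       openin (mtop X) U \<and> openin (cspace (mdim X)) (\<phi> ` U) \<and>
       homeomorphic_map (subtopology (mtop X) U) (subtopology (cspace (mdim X)) (\<phi> ` U)) \<phi>) \<and>
    (\<forall>(U, \<phi>) \<in> charts X. \<forall>(V, \<psi>) \<in> charts X. \<forall>i < mdim X.
       holo_fun (mdim X) (\<phi> ` (U \<inter> V)) (\<lambda>a. \<psi> (inv_into U \<phi> a) i))"

text \<open>Only the values of \<open>f\<close> on \<open>U\<close> matter.\<close>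

definition holo_on :: "'m cmanifold \<Rightarrow> 'm set \<Rightarrow> ('m \<Rightarrow> complex) \<Rightarrow> bool"
  where "holo_on X U f \<longleftrightarrow>
    (\<forall>(V, \<phi>) \<in> charts X. holo_fun (mdim X) (\<phi> ` (U \<inter> V)) (f \<circ> inv_into V \<phi>))"

text \<open>A vector bundle is given by its total space, its projection and an atlas of local
  trivialisations \<open>(U, h)\<close>, where \<open>h\<close> identifies every fibre over \<open>U\<close> with the coordinate space;
  the transition functions are linear on fibres and holomorphic.  The linear structure of the fibres
  and the complex structure of the total space are the ones transported by the trivialisations.\<close>

type_synonym ('m, 'e) triv = "'m set \<times> ('e \<Rightarrow> nat \<Rightarrow> complex)"

record ('m, 'e) vbundle =
  total :: "'e set"
  proj :: "'e \<Rightarrow> 'm"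
  rank :: nat
  trivs :: "('m, 'e) triv set"

definition fibre :: "('m, 'e) vbundle \<Rightarrow> 'm \<Rightarrow> 'e set"
  where "fibre B x = {e \<in> total B. proj B e = x}"

text \<open>The matrix of the coordinate change from \<open>t'\<close> to \<open>t\<close> in the fibre over \<open>x\<close>.\<close>

definition transition ::
    "('m, 'e) vbundle \<Rightarrow> ('m, 'e) triv \<Rightarrow> ('m, 'e) triv \<Rightarrow> 'm \<Rightarrow> nat \<Rightarrow> nat \<Rightarrow> complex"
  where "transition B t t' x i j = snd t (inv_into (fibre B x) (snd t') (unit_vec (rank B) j)) i"

definition holomorphic_vector_bundle :: "'m cmanifold \<Rightarrow> ('m, 'e) vbundle \<Rightarrow> bool"
  where "holomorphic_vector_bundle X B \<longleftrightarrow>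
    proj B ` total B \<subseteq> topspace (mtop X) \<and>
    (\<Union>(fst ` trivs B) = topspace (mtop X)) \<and>
    (\<forall>(U, h) \<in> trivs B. openin (mtop X) U \<and>
       (\<forall>x\<in>U. bij_betw h (fibre B x) (topspace (cspace (rank B))))) \<and>
    (\<forall>t \<in> trivs B. \<forall>t' \<in> trivs B.
       (\<forall>x \<in> fst t \<inter> fst t'. \<forall>e \<in> fibre B x. \<forall>i < rank B.
          snd t e i = (\<Sum>j<rank B. transition B t t' x i j * snd t' e j)) \<and>
       (\<forall>i < rank B. \<forall>j < rank B. holo_on X (fst t \<inter> fst t') (\<lambda>x. transition B t t' x i j)))"


section \<open>The exterior algebra bundle and its sheaf of sections\<close>

text \<open>An element of the exterior algebra of the coordinate space of dimension \<open>r\<close> is the family of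
  its coefficients with respect to the basis \<open>e\<^sub>I = e\<^bsub>i1\<^esub> \<and> \<dots> \<and> e\<^bsub>ip\<^esub>\<close>, where
  \<open>I = {i1 < \<dots> < ip}\<close> is a subset of \<open>{..<r}\<close>; the coefficients at all other sets are 0.  For
  disjoint \<open>I\<close>, \<open>J\<close> one has \<open>e\<^sub>I \<and> e\<^sub>J = wedge_sign I J e\<^bsub>I \<union> J\<^esub>\<close>.\<close>

type_synonym ext = "nat set \<Rightarrow> complex"

definition wedge_sign :: "nat set \<Rightarrow> nat set \<Rightarrow> complex"
  where "wedge_sign I J = (- 1) ^ card {(i, j). i \<in> I \<and> j \<in> J \<and> j < i}"

definition wedge :: "ext \<Rightarrow> ext \<Rightarrow> ext"
  where "wedge \<omega> \<eta> = (\<lambda>K. \<Sum>I\<in>Pow K. wedge_sign I (K - I) * \<omega> I * \<eta> (K - I))"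

definition ext_one :: ext
  where "ext_one = (\<lambda>K. if K = {} then 1 else 0)"

definition ext_column :: "nat \<Rightarrow> (nat \<Rightarrow> nat \<Rightarrow> complex) \<Rightarrow> nat \<Rightarrow> ext"
  where "ext_column r g j = (\<lambda>K. \<Sum>i<r. if K = {i} then g i j else 0)"

text \<open>The map induced on exterior algebras by the matrix \<open>g\<close>; it sends \<open>e\<^bsub>j1\<^esub> \<and> \<dots> \<and> e\<^bsub>jp\<^esub>\<close> to
  \<open>g e\<^bsub>j1\<^esub> \<and> \<dots> \<and> g e\<^bsub>jp\<^esub>\<close>.\<close>

definition ext_map :: "nat \<Rightarrow> (nat \<Rightarrow> nat \<Rightarrow> complex) \<Rightarrow> ext \<Rightarrow> ext"
  where "ext_map r g \<omega> = (\<lambda>K. \<Sum>J\<in>Pow {..<r}.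
    \<omega> J * foldr wedge (map (ext_column r g) (sorted_list_of_set J)) ext_one K)"

text \<open>The exterior algebra bundle has the transition functions induced by those of the bundle.  A
  section over \<open>U\<close> is given by its coefficients in every trivialisation, extended by 0 to the
  points outside \<open>U\<close> and outside the domain of the trivialisation.\<close>

type_synonym ('m, 'e) sect = "('m, 'e) triv \<Rightarrow> 'm \<Rightarrow> ext"

definition ext_sections :: "'m cmanifold \<Rightarrow> ('m, 'e) vbundle \<Rightarrow> 'm set \<Rightarrow> ('m, 'e) sect set"
  where "ext_sections X B U = {s.
    (\<forall>t \<in> trivs B. \<forall>I. holo_on X (U \<inter> fst t) (\<lambda>x. s t x I)) \<and>
    (\<forall>t \<in> trivs B. \<forall>x \<in> U \<inter> fst t. \<forall>I. s t x I \<noteq> 0 \<longrightarrow> I \<subseteq> {..<rank B}) \<and>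
    (\<forall>t \<in> trivs B. \<forall>t' \<in> trivs B. \<forall>x \<in> U \<inter> fst t \<inter> fst t'.
       s t x = ext_map (rank B) (transition B t t' x) (s t' x)) \<and>
    (\<forall>t x. \<not> (t \<in> trivs B \<and> x \<in> U \<inter> fst t) \<longrightarrow> s t x = 0)}"

text \<open>Sections all of whose homogeneous components have a degree satisfying \<open>P\<close>.  The homogeneous
  part of degree \<open>j\<close> is obtained for \<open>P = (\<lambda>d. d = j)\<close>, the even part for \<open>P = even\<close>.\<close>

definition graded_sections ::
    "'m cmanifold \<Rightarrow> ('m, 'e) vbundle \<Rightarrow> (nat \<Rightarrow> bool) \<Rightarrow> 'm set \<Rightarrow> ('m, 'e) sect set"
  where "graded_sections X B P U =
    {s \<in> ext_sections X B U. \<forall>t x I. s t x I \<noteq> 0 \<longrightarrow> P (card I)}"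

definition sect_mult :: "('m, 'e) sect \<Rightarrow> ('m, 'e) sect \<Rightarrow> ('m, 'e) sect"
  where "sect_mult s s' = (\<lambda>t x. wedge (s t x) (s' t x))"

definition sect_one :: "('m, 'e) vbundle \<Rightarrow> 'm set \<Rightarrow> ('m, 'e) sect"
  where "sect_one B U = (\<lambda>t x. if t \<in> trivs B \<and> x \<in> U \<inter> fst t then ext_one else 0)"

definition sect_scale :: "complex \<Rightarrow> ('m, 'e) sect \<Rightarrow> ('m, 'e) sect"
  where "sect_scale c s = (\<lambda>t x I. c * s t x I)"

definition sect_res :: "'m set \<Rightarrow> ('m, 'e) sect \<Rightarrow> ('m, 'e) sect"
  where "sect_res V s = (\<lambda>t x. if x \<in> V then s t x else 0)"

definition sect_comp :: "nat \<Rightarrow> ('m, 'e) sect \<Rightarrow> ('m, 'e) sect"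
  where "sect_comp j s = (\<lambda>t x I. if card I = j then s t x I else 0)"


section \<open>Sheaf endomorphisms, derivations and automorphisms\<close>

text \<open>An endomorphism \<open>F\<close> over \<open>U\<close> consists of maps \<open>F V\<close> on the sections over the open subsets
  \<open>V\<close> of \<open>U\<close>; it has the value 0 elsewhere, so that equality of sheaf endomorphisms is equality of
  functions.\<close>

type_synonym ('m, 'e) endo = "'m set \<Rightarrow> ('m, 'e) sect \<Rightarrow> ('m, 'e) sect"

definition End_sheaf :: "'m cmanifold \<Rightarrow> ('m, 'e) vbundle \<Rightarrow> 'm set \<Rightarrow> ('m, 'e) endo set"
  where "End_sheaf X B U = {F.
    (\<forall>V s. \<not> (openin (mtop X) V \<and> V \<subseteq> U \<and> s \<in> ext_sections X B V) \<longrightarrow> F V s = 0) \<and>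
    (\<forall>V. openin (mtop X) V \<and> V \<subseteq> U \<longrightarrow>
       (\<forall>s \<in> ext_sections X B V. F V s \<in> ext_sections X B V) \<and>
       (\<forall>s \<in> ext_sections X B V. \<forall>s' \<in> ext_sections X B V. F V (s + s') = F V s + F V s') \<and>
       (\<forall>s \<in> ext_sections X B V. \<forall>c. F V (sect_scale c s) = sect_scale c (F V s)) \<and>
       (\<forall>W. openin (mtop X) W \<and> W \<subseteq> V \<longrightarrow>
          (\<forall>s \<in> ext_sections X B V. F W (sect_res W s) = sect_res W (F V s))) \<and>
       F V ` graded_sections X B even V \<subseteq> graded_sections X B even V \<and>
       F V ` graded_sections X B odd V \<subseteq> graded_sections X B odd V)}"

definition End_deg :: "'m cmanifold \<Rightarrow> ('m, 'e) vbundle \<Rightarrow> nat \<Rightarrow> 'm set \<Rightarrow> ('m, 'e) endo set"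
  where "End_deg X B d U = {F \<in> End_sheaf X B U. \<forall>V j. openin (mtop X) V \<and> V \<subseteq> U \<longrightarrow>
    F V ` graded_sections X B (\<lambda>l. l = j) V \<subseteq> graded_sections X B (\<lambda>l. l = j + d) V}"

text \<open>Even derivations, so no sign occurs in the Leibniz rule.\<close>

definition Der_sheaf :: "'m cmanifold \<Rightarrow> ('m, 'e) vbundle \<Rightarrow> 'm set \<Rightarrow> ('m, 'e) endo set"
  where "Der_sheaf X B U = {D \<in> End_sheaf X B U. \<forall>V. openin (mtop X) V \<and> V \<subseteq> U \<longrightarrow>
    (\<forall>s \<in> ext_sections X B V. \<forall>s' \<in> ext_sections X B V.
       D V (sect_mult s s') = sect_mult (D V s) s' + sect_mult s (D V s'))}"

definition Der_deg :: "'m cmanifold \<Rightarrow> ('m, 'e) vbundle \<Rightarrow> nat \<Rightarrow> 'm set \<Rightarrow> ('m, 'e) endo set"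
  where "Der_deg X B d U = Der_sheaf X B U \<inter> End_deg X B d U"

text \<open>The direct sum of the components of degree \<open>2k\<close>, \<open>k \<ge> 1\<close>.\<close>

definition Der2 :: "'m cmanifold \<Rightarrow> ('m, 'e) vbundle \<Rightarrow> 'm set \<Rightarrow> ('m, 'e) endo set"
  where "Der2 X B U = {F. \<exists>K D. finite K \<and> K \<subseteq> {1..} \<and>
    (\<forall>k\<in>K. D k \<in> Der_deg X B (2 * k) U) \<and> F = (\<Sum>k\<in>K. D k)}"

definition endo_id :: "'m cmanifold \<Rightarrow> ('m, 'e) vbundle \<Rightarrow> 'm set \<Rightarrow> ('m, 'e) endo"
  where "endo_id X B U = (\<lambda>V s.
    if openin (mtop X) V \<and> V \<subseteq> U \<and> s \<in> ext_sections X B V then s else 0)"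

definition endo_comp :: "('m, 'e) endo \<Rightarrow> ('m, 'e) endo \<Rightarrow> ('m, 'e) endo"  (infixl "\<bullet>\<bullet>" 70)
  where "F \<bullet>\<bullet> G = (\<lambda>V s. F V (G V s))"

definition endo_res :: "'m set \<Rightarrow> ('m, 'e) endo \<Rightarrow> ('m, 'e) endo"
  where "endo_res W F = (\<lambda>V. if V \<subseteq> W then F V else 0)"

text \<open>The exponential of an element of \<open>Der2 X B U\<close>; the powers beyond \<open>rank B\<close> vanish for degree
  reasons.\<close>

definition endo_exp ::
    "'m cmanifold \<Rightarrow> ('m, 'e) vbundle \<Rightarrow> 'm set \<Rightarrow> ('m, 'e) endo \<Rightarrow> ('m, 'e) endo"
  where "endo_exp X B U u = (\<lambda>V s.
    if openin (mtop X) V \<and> V \<subseteq> U \<and> s \<in> ext_sections X B V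
    then \<Sum>n\<le>rank B. sect_scale (1 / fact n) ((u V ^^ n) s) else 0)"

text \<open>The component of degree \<open>d\<close> of an endomorphism.\<close>

definition pr :: "'m cmanifold \<Rightarrow> ('m, 'e) vbundle \<Rightarrow> nat \<Rightarrow> ('m, 'e) endo \<Rightarrow> ('m, 'e) endo"
  where "pr X B d F = (\<lambda>V s. if s \<in> ext_sections X B V
    then \<Sum>j\<le>rank B. sect_comp (j + d) (F V (sect_comp j s)) else 0)"

text \<open>The sheaf of groups of automorphisms that are the identity modulo terms of degree
  \<open>2, 4, \<dots>\<close>.\<close>

definition G_sheaf :: "'m cmanifold \<Rightarrow> ('m, 'e) vbundle \<Rightarrow> 'm set \<Rightarrow> ('m, 'e) endo set"
  where "G_sheaf X B U = {\<phi> \<in> End_sheaf X B U. \<forall>V. openin (mtop X) V \<and> V \<subseteq> U \<longrightarrow>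
    bij_betw (\<phi> V) (ext_sections X B V) (ext_sections X B V) \<and>
    \<phi> V (sect_one B V) = sect_one B V \<and>
    (\<forall>s \<in> ext_sections X B V. \<forall>s' \<in> ext_sections X B V.
       \<phi> V (sect_mult s s') = sect_mult (\<phi> V s) (\<phi> V s')) \<and>
    (\<forall>j. \<forall>s \<in> graded_sections X B (\<lambda>l. l = j) V.
       \<phi> V s - s \<in> graded_sections X B (\<lambda>l. \<exists>k\<ge>1. l = j + 2 * k) V)}"


section \<open>Coherent sheaves and Leray covers\<close>

definition holo_ring :: "'m cmanifold \<Rightarrow> 'm set \<Rightarrow> ('m \<Rightarrow> complex) ring"
  where "holo_ring X U =
    \<lparr>carrier = {f. holo_on X U f \<and> (\<forall>x. x \<notin> U \<longrightarrow> f x = 0)},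
     mult = (\<lambda>f g x. f x * g x), one = (\<lambda>x. if x \<in> U then 1 else 0),
     zero = (\<lambda>_. 0), add = (\<lambda>f g x. f x + g x)\<rparr>"

text \<open>\<open>F\<close> is a sheaf of modules over the structure sheaf of \<open>X\<close>, with restriction maps
  \<open>\<rho> V W\<close> from \<open>V\<close> to \<open>W\<close>.\<close>

definition module_sheaf ::
    "'m cmanifold \<Rightarrow> ('m set \<Rightarrow> ('m \<Rightarrow> complex, 'f) module) \<Rightarrow> ('m set \<Rightarrow> 'm set \<Rightarrow> 'f \<Rightarrow> 'f) \<Rightarrow> bool"
  where "module_sheaf X F \<rho> \<longleftrightarrow>
    (\<forall>V. openin (mtop X) V \<longrightarrow> Module.module (holo_ring X V) (F V)) \<and>
    (\<forall>V W. openin (mtop X) V \<and> openin (mtop X) W \<and> W \<subseteq> V \<longrightarrow>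
       (\<forall>s \<in> carrier (F V). \<rho> V W s \<in> carrier (F W)) \<and>
       (\<forall>s \<in> carrier (F V). \<forall>s' \<in> carrier (F V).
          \<rho> V W (s \<oplus>\<^bsub>F V\<^esub> s') = \<rho> V W s \<oplus>\<^bsub>F W\<^esub> \<rho> V W s') \<and>
       (\<forall>f \<in> carrier (holo_ring X V). \<forall>s \<in> carrier (F V).
          \<rho> V W (f \<odot>\<^bsub>F V\<^esub> s) = (\<lambda>x. if x \<in> W then f x else 0) \<odot>\<^bsub>F W\<^esub> \<rho> V W s) \<and>
       (\<forall>W'. openin (mtop X) W' \<and> W' \<subseteq> W \<longrightarrow>
          (\<forall>s \<in> carrier (F V). \<rho> W W' (\<rho> V W s) = \<rho> V W' s))) \<and>
    (\<forall>V. openin (mtop X) V \<longrightarrow> (\<forall>s \<in> carrier (F V). \<rho> V V s = s)) \<and>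
    (\<forall>\<V> s. (\<forall>V\<in>\<V>. openin (mtop X) V \<and> s V \<in> carrier (F V)) \<and>
       (\<forall>V\<in>\<V>. \<forall>W\<in>\<V>. \<rho> V (V \<inter> W) (s V) = \<rho> W (V \<inter> W) (s W)) \<longrightarrow>
       (\<exists>!s'. s' \<in> carrier (F (\<Union>\<V>)) \<and> (\<forall>V\<in>\<V>. \<rho> (\<Union>\<V>) V s' = s V)))"

definition finite_type ::
    "'m cmanifold \<Rightarrow> ('m set \<Rightarrow> ('m \<Rightarrow> complex, 'f) module) \<Rightarrow> ('m set \<Rightarrow> 'm set \<Rightarrow> 'f \<Rightarrow> 'f) \<Rightarrow> bool"
  where "finite_type X F \<rho> \<longleftrightarrow>
    (\<forall>x \<in> topspace (mtop X). \<exists>V (p::nat) s. openin (mtop X) V \<and> x \<in> V \<and>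
       (\<forall>i<p. s i \<in> carrier (F V)) \<and>
       (\<forall>W s' y. openin (mtop X) W \<and> W \<subseteq> V \<and> s' \<in> carrier (F W) \<and> y \<in> W \<longrightarrow>
          (\<exists>W' f. openin (mtop X) W' \<and> y \<in> W' \<and> W' \<subseteq> W \<and>
             (\<forall>i<p. f i \<in> carrier (holo_ring X W')) \<and>
             \<rho> W W' s' = (\<Oplus>\<^bsub>F W'\<^esub>i\<in>{..<p}. f i \<odot>\<^bsub>F W'\<^esub> \<rho> V W' (s i)))))"

definition relation_on ::
    "'m cmanifold \<Rightarrow> ('m set \<Rightarrow> ('m \<Rightarrow> complex, 'f) module) \<Rightarrow> ('m set \<Rightarrow> 'm set \<Rightarrow> 'f \<Rightarrow> 'f) \<Rightarrow>
     'm set \<Rightarrow> nat \<Rightarrow> (nat \<Rightarrow> 'f) \<Rightarrow> 'm set \<Rightarrow> (nat \<Rightarrow> 'm \<Rightarrow> complex) \<Rightarrow> bool"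
  where "relation_on X F \<rho> V p s W g \<longleftrightarrow>
    (\<forall>i<p. g i \<in> carrier (holo_ring X W)) \<and>
    (\<Oplus>\<^bsub>F W\<^esub>i\<in>{..<p}. g i \<odot>\<^bsub>F W\<^esub> \<rho> V W (s i)) = \<zero>\<^bsub>F W\<^esub>"

text \<open>A module sheaf is coherent if it is of finite type and the sheaf of relations between any
  finite family of sections over an open set is of finite type.\<close>

definition coherent_sheaf ::
    "'m cmanifold \<Rightarrow> ('m set \<Rightarrow> ('m \<Rightarrow> complex, 'f) module) \<Rightarrow> ('m set \<Rightarrow> 'm set \<Rightarrow> 'f \<Rightarrow> 'f) \<Rightarrow> bool"
  where "coherent_sheaf X F \<rho> \<longleftrightarrow> module_sheaf X F \<rho> \<and> finite_type X F \<rho> \<and>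
    (\<forall>V (p::nat) s x. openin (mtop X) V \<and> (\<forall>i<p. s i \<in> carrier (F V)) \<and> x \<in> V \<longrightarrow>
       (\<exists>W (m::nat) r. openin (mtop X) W \<and> x \<in> W \<and> W \<subseteq> V \<and>
          (\<forall>k<m. relation_on X F \<rho> V p s W (r k)) \<and>
          (\<forall>W' g y. openin (mtop X) W' \<and> W' \<subseteq> W \<and> relation_on X F \<rho> V p s W' g \<and> y \<in> W' \<longrightarrow>
             (\<exists>W'' h. openin (mtop X) W'' \<and> y \<in> W'' \<and> W'' \<subseteq> W' \<and>
                (\<forall>k<m. h k \<in> carrier (holo_ring X W'')) \<and>
                (\<forall>i<p. \<forall>z\<in>W''. g i z = (\<Sum>k<m. h k z * r k i z))))))"

text \<open>Cech cochains of degree \<open>q\<close> with respect to a set of open sets, indexed by lists of length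
  \<open>q + 1\<close> (not necessarily alternating).\<close>

definition cech_cochain ::
    "('m set \<Rightarrow> ('m \<Rightarrow> complex, 'f) module) \<Rightarrow> 'm set set \<Rightarrow> nat \<Rightarrow> ('m set list \<Rightarrow> 'f) \<Rightarrow> bool"
  where "cech_cochain F \<V> q c \<longleftrightarrow>
    (\<forall>Vs. set Vs \<subseteq> \<V> \<and> length Vs = Suc q \<longrightarrow> c Vs \<in> carrier (F (\<Inter>(set Vs))))"

definition omit_nth :: "nat \<Rightarrow> 'b list \<Rightarrow> 'b list"
  where "omit_nth k xs = take k xs @ drop (Suc k) xs"

definition cech_diff ::
    "('m set \<Rightarrow> ('m \<Rightarrow> complex, 'f) module) \<Rightarrow> ('m set \<Rightarrow> 'm set \<Rightarrow> 'f \<Rightarrow> 'f) \<Rightarrow>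
     ('m set list \<Rightarrow> 'f) \<Rightarrow> 'm set list \<Rightarrow> 'f"
  where "cech_diff F \<rho> c Vs = (let V = \<Inter>(set Vs);
      a = (\<lambda>k. \<rho> (\<Inter>(set (omit_nth k Vs))) V (c (omit_nth k Vs)))
    in \<Oplus>\<^bsub>F V\<^esub>k\<in>{..<length Vs}. if even k then a k else \<ominus>\<^bsub>F V\<^esub> a k)"

text \<open>The vanishing of the cohomology of \<open>F\<close> over the open set \<open>Y\<close> in all positive degrees, where
  cohomology is the direct limit of Cech cohomology over all open covers of \<open>Y\<close>.  Since open
  subsets of a manifold are paracompact Hausdorff spaces, this is sheaf cohomology.\<close>

definition acyclic_on ::
    "'m cmanifold \<Rightarrow> ('m set \<Rightarrow> ('m \<Rightarrow> complex, 'f) module) \<Rightarrow> ('m set \<Rightarrow> 'm set \<Rightarrow> 'f \<Rightarrow> 'f) \<Rightarrow>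
     'm set \<Rightarrow> bool"
  where "acyclic_on X F \<rho> Y \<longleftrightarrow>
    (\<forall>q \<V> c. (\<forall>V\<in>\<V>. openin (mtop X) V) \<and> \<Union>\<V> = Y \<and> cech_cochain F \<V> (Suc q) c \<and>
       (\<forall>Vs. set Vs \<subseteq> \<V> \<and> length Vs = q + 3 \<longrightarrow>
          cech_diff F \<rho> c Vs = \<zero>\<^bsub>F (\<Inter>(set Vs))\<^esub>) \<longrightarrow>
       (\<exists>\<W> \<tau> b. (\<forall>W\<in>\<W>. openin (mtop X) W \<and> \<tau> W \<in> \<V> \<and> W \<subseteq> \<tau> W) \<and> \<Union>\<W> = Y \<and>
          cech_cochain F \<W> q b \<and>
          (\<forall>Ws. set Ws \<subseteq> \<W> \<and> length Ws = q + 2 \<longrightarrow>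
             cech_diff F \<rho> b Ws = \<rho> (\<Inter>(set (map \<tau> Ws))) (\<Inter>(set Ws)) (c (map \<tau> Ws)))))"

text \<open>A cover that is a Leray cover for all coherent sheaves.  Sections of sheaves are taken in the
  type \<^typ>\<open>'m \<Rightarrow> complex\<close>.  This is no restriction: the stalks of a coherent sheaf have at most
  the cardinality of the continuum, and a section is determined by its germs, so every coherent
  sheaf is isomorphic to one of this form.\<close>

definition leray_cover :: "'m cmanifold \<Rightarrow> 'i set \<Rightarrow> ('i \<Rightarrow> 'm set) \<Rightarrow> bool"
  where "leray_cover X I U \<longleftrightarrow>
    (\<forall>i\<in>I. openin (mtop X) (U i)) \<and> (\<Union>i\<in>I. U i) = topspace (mtop X) \<and>
    (\<forall>(F :: 'm set \<Rightarrow> ('m \<Rightarrow> complex, 'm \<Rightarrow> complex) module) \<rho>. coherent_sheaf X F \<rho> \<longrightarrow>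
       (\<forall>J. finite J \<and> J \<noteq> {} \<and> J \<subseteq> I \<longrightarrow> acyclic_on X F \<rho> (\<Inter>i\<in>J. U i)))"


section \<open>Cech cochains of endomorphisms\<close>

text \<open>Cochains vanish at indices outside \<open>I\<close>.  In the definitions below \<open>S\<close> is one of the sheaves
  of derivations.\<close>

type_synonym ('i, 'm, 'e) cochain0 = "'i \<Rightarrow> ('m, 'e) endo"
type_synonym ('i, 'm, 'e) cochain1 = "'i \<Rightarrow> 'i \<Rightarrow> ('m, 'e) endo"
type_synonym ('i, 'm, 'e) cochain2 = "'i \<Rightarrow> 'i \<Rightarrow> 'i \<Rightarrow> ('m, 'e) endo"

definition C0 ::
    "'i set \<Rightarrow> ('i \<Rightarrow> 'm set) \<Rightarrow> ('m set \<Rightarrow> ('m, 'e) endo set) \<Rightarrow> ('i, 'm, 'e) cochain0 set"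
  where "C0 I U S = {v. (\<forall>i\<in>I. v i \<in> S (U i)) \<and> (\<forall>i. i \<notin> I \<longrightarrow> v i = 0)}"

definition C1 ::
    "'i set \<Rightarrow> ('i \<Rightarrow> 'm set) \<Rightarrow> ('m set \<Rightarrow> ('m, 'e) endo set) \<Rightarrow> ('i, 'm, 'e) cochain1 set"
  where "C1 I U S = {u. (\<forall>i\<in>I. \<forall>j\<in>I. u i j \<in> S (U i \<inter> U j) \<and> u j i = - u i j) \<and>
    (\<forall>i j. \<not> (i \<in> I \<and> j \<in> I) \<longrightarrow> u i j = 0)}"

definition d0 :: "'i set \<Rightarrow> ('i \<Rightarrow> 'm set) \<Rightarrow> ('i, 'm, 'e) cochain0 \<Rightarrow> ('i, 'm, 'e) cochain1"
  where "d0 I U v = (\<lambda>i j. if i \<in> I \<and> j \<in> I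
    then endo_res (U i \<inter> U j) (v j) - endo_res (U i \<inter> U j) (v i) else 0)"

definition d1 :: "'i set \<Rightarrow> ('i \<Rightarrow> 'm set) \<Rightarrow> ('i, 'm, 'e) cochain1 \<Rightarrow> ('i, 'm, 'e) cochain2"
  where "d1 I U w = (\<lambda>i j k. if i \<in> I \<and> j \<in> I \<and> k \<in> I
    then endo_res (U i \<inter> U j \<inter> U k) (w j k) - endo_res (U i \<inter> U j \<inter> U k) (w i k)
       + endo_res (U i \<inter> U j \<inter> U k) (w i j) else 0)"

definition mult_d1 :: "'i set \<Rightarrow> ('i \<Rightarrow> 'm set) \<Rightarrow> ('i, 'm, 'e) cochain1 \<Rightarrow> ('i, 'm, 'e) cochain2"
  where "mult_d1 I U g = (\<lambda>i j k. if i \<in> I \<and> j \<in> I \<and> k \<in> I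
    then endo_res (U i \<inter> U j \<inter> U k) (g i j) \<bullet>\<bullet> endo_res (U i \<inter> U j \<inter> U k) (g j k)
       \<bullet>\<bullet> endo_res (U i \<inter> U j \<inter> U k) (g k i) else 0)"

definition exp_cochain ::
    "'m cmanifold \<Rightarrow> ('m, 'e) vbundle \<Rightarrow> 'i set \<Rightarrow> ('i \<Rightarrow> 'm set) \<Rightarrow>
     ('i, 'm, 'e) cochain1 \<Rightarrow> ('i, 'm, 'e) cochain1"
  where "exp_cochain X B I U u = (\<lambda>i j. if i \<in> I \<and> j \<in> I
    then endo_exp X B (U i \<inter> U j) (u i j) else 0)"

definition pr_cochain ::
    "'m cmanifold \<Rightarrow> ('m, 'e) vbundle \<Rightarrow> nat \<Rightarrow> ('i, 'm, 'e) cochain1 \<Rightarrow> ('i, 'm, 'e) cochain1"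
  where "pr_cochain X B d u = (\<lambda>i j. pr X B d (u i j))"

text \<open>Projection onto the sum of the components of degrees \<open>2, 4, \<dots>, 2k\<close>.\<close>

definition pr_upto ::
    "'m cmanifold \<Rightarrow> ('m, 'e) vbundle \<Rightarrow> nat \<Rightarrow> ('i, 'm, 'e) cochain1 \<Rightarrow> ('i, 'm, 'e) cochain1"
  where "pr_upto X B k u = (\<Sum>l=1..k. pr_cochain X B (2 * l) u)"


section \<open>Cohomology sets\<close>

text \<open>The global sections of the sheaf \<open>Der2 X B\<close>.\<close>

definition H0_Der2 :: "'m cmanifold \<Rightarrow> ('m, 'e) vbundle \<Rightarrow> ('m, 'e) endo set"
  where "H0_Der2 X B = Der2 X B (topspace (mtop X))"

definition Z1_Der2 ::
    "'m cmanifold \<Rightarrow> ('m, 'e) vbundle \<Rightarrow> 'i set \<Rightarrow> ('i \<Rightarrow> 'm set) \<Rightarrow> ('i, 'm, 'e) cochain1 set"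
  where "Z1_Der2 X B I U = {w \<in> C1 I U (Der2 X B). d1 I U w = 0}"

definition Der2_class ::
    "'m cmanifold \<Rightarrow> ('m, 'e) vbundle \<Rightarrow> 'i set \<Rightarrow> ('i \<Rightarrow> 'm set) \<Rightarrow>
     ('i, 'm, 'e) cochain1 \<Rightarrow> ('i, 'm, 'e) cochain1 set"
  where "Der2_class X B I U w = {w + d0 I U v | v. v \<in> C0 I U (Der2 X B)}"

definition H1_Der2 ::
    "'m cmanifold \<Rightarrow> ('m, 'e) vbundle \<Rightarrow> 'i set \<Rightarrow> ('i \<Rightarrow> 'm set) \<Rightarrow> ('i, 'm, 'e) cochain1 set set"
  where "H1_Der2 X B I U = Der2_class X B I U ` Z1_Der2 X B I U"

definition Z1_G ::
    "'m cmanifold \<Rightarrow> ('m, 'e) vbundle \<Rightarrow> 'i set \<Rightarrow> ('i \<Rightarrow> 'm set) \<Rightarrow> ('i, 'm, 'e) cochain1 set"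
  where "Z1_G X B I U = {g.
    (\<exists>u \<in> C1 I U (Der2 X B). g = exp_cochain X B I U u) \<and>
    (\<forall>i\<in>I. \<forall>j\<in>I. g i j \<in> G_sheaf X B (U i \<inter> U j)) \<and>
    (\<forall>i\<in>I. \<forall>j\<in>I. \<forall>k\<in>I. mult_d1 I U g i j k = endo_id X B (U i \<inter> U j \<inter> U k))}"

text \<open>The action of \<open>exp v\<close>, for a 0-cochain \<open>v\<close> of derivations, on 1-cochains of automorphisms.\<close>

definition exp_act ::
    "'m cmanifold \<Rightarrow> ('m, 'e) vbundle \<Rightarrow> 'i set \<Rightarrow> ('i \<Rightarrow> 'm set) \<Rightarrow>
     ('i, 'm, 'e) cochain0 \<Rightarrow> ('i, 'm, 'e) cochain1 \<Rightarrow> ('i, 'm, 'e) cochain1"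
  where "exp_act X B I U v g = (\<lambda>i j. if i \<in> I \<and> j \<in> I
    then endo_res (U i \<inter> U j) (endo_exp X B (U i) (v i)) \<bullet>\<bullet> g i j
       \<bullet>\<bullet> endo_res (U i \<inter> U j) (endo_exp X B (U j) (- v j)) else 0)"

definition G_class ::
    "'m cmanifold \<Rightarrow> ('m, 'e) vbundle \<Rightarrow> 'i set \<Rightarrow> ('i \<Rightarrow> 'm set) \<Rightarrow>
     ('i, 'm, 'e) cochain1 \<Rightarrow> ('i, 'm, 'e) cochain1 set"
  where "G_class X B I U g = {exp_act X B I U v g | v. v \<in> C0 I U (Der2 X B)}"

definition H1_G ::
    "'m cmanifold \<Rightarrow> ('m, 'e) vbundle \<Rightarrow> 'i set \<Rightarrow> ('i \<Rightarrow> 'm set) \<Rightarrow> ('i, 'm, 'e) cochain1 set set"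
  where "H1_G X B I U = G_class X B I U ` Z1_G X B I U"

definition C1_tilde ::
    "'m cmanifold \<Rightarrow> ('m, 'e) vbundle \<Rightarrow> 'i set \<Rightarrow> ('i \<Rightarrow> 'm set) \<Rightarrow> ('i, 'm, 'e) cochain1 set"
  where "C1_tilde X B I U =
    {u \<in> C1 I U (Der2 X B). exp_cochain X B I U u \<in> Z1_G X B I U}"

definition R_map ::
    "'m cmanifold \<Rightarrow> ('m, 'e) vbundle \<Rightarrow> 'i set \<Rightarrow> ('i \<Rightarrow> 'm set) \<Rightarrow> nat \<Rightarrow>
     ('i, 'm, 'e) cochain1 \<Rightarrow> ('i, 'm, 'e) cochain2"
  where "R_map X B I U q u = (\<lambda>i j k.
    pr X B (2 * q) (mult_d1 I U (exp_cochain X B I U (pr_upto X B (q - 1) u)) i j k))"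

text \<open>The family consists of the maps \<open>D' q\<close> for \<open>q \<ge> 2\<close>, considered on \<open>C1_tilde X B I U\<close> only.\<close>

definition admissible_family ::
    "'m cmanifold \<Rightarrow> ('m, 'e) vbundle \<Rightarrow> 'i set \<Rightarrow> ('i \<Rightarrow> 'm set) \<Rightarrow>
     (nat \<Rightarrow> ('i, 'm, 'e) cochain1 \<Rightarrow> ('i, 'm, 'e) cochain1) \<Rightarrow> bool"
  where "admissible_family X B I U D' \<longleftrightarrow> (\<forall>q\<ge>2.
    (\<forall>u \<in> C1_tilde X B I U. D' q u \<in> C1 I U (Der_deg X B (2 * q))) \<and>
    (\<forall>u \<in> C1_tilde X B I U. \<forall>u' \<in> C1_tilde X B I U.
       pr_upto X B (q - 1) u = pr_upto X B (q - 1) u' \<longrightarrow> D' q u = D' q u') \<and>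
    (\<forall>u \<in> C1_tilde X B I U. d1 I U (D' q u) = R_map X B I U q u))"

text \<open>\<open>u + (\<Sum>q\<ge>2. D' q u)\<close>; the terms with \<open>q > rank B\<close> vanish, since there are no nonzero
  derivations of degree \<open>2q > rank B\<close>.\<close>

definition corrected ::
    "('m, 'e) vbundle \<Rightarrow> (nat \<Rightarrow> ('i, 'm, 'e) cochain1 \<Rightarrow> ('i, 'm, 'e) cochain1) \<Rightarrow>
     ('i, 'm, 'e) cochain1 \<Rightarrow> ('i, 'm, 'e) cochain1"
  where "corrected B D' u = u + (\<Sum>q=2..rank B. D' q u)"

end

theory Submission
  imports Defs
begin

text \<open>Everything rests on the filtration of the endomorphisms by the degree they raise, modulo which
  \<open>exp\<close> is additive.  Let \<open>u'\<close>, \<open>x'\<close> be the images of cocycles \<open>u\<close>, \<open>x\<close> under 0-cochains \<open>g\<close>, \<open>h\<close>,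
  and let both pairs \<open>(u, x)\<close> and \<open>(u', x')\<close> agree in degrees below \<open>2q\<close>.  The leading term of \<open>g - h\<close>
  in a degree below \<open>2q\<close> would be a global derivation, so \<open>g\<close> and \<open>h\<close> agree in these degrees, and the
  terms of degree \<open>2q\<close> satisfy: \<open>(u' - x') - (u - x)\<close> is a coboundary.  Hence, if \<open>D' q u\<close> is minus the
  term of degree \<open>2q\<close> of a cocycle which has the truncation of \<open>u\<close> and is obtained by the group
  action from a cocycle chosen once for the orbit of that truncation, then the class of the term of
  degree \<open>2q\<close> of \<open>u + D' q u\<close> depends only on the orbit of \<open>u\<close>.  Conversely, if these classes agree
  for two cocycles, the cocycles can be moved into each other degree by degree.\<close>

section \<open>The exterior algebra\<close>

text \<open>The value \<open>D' q u\<close> may depend only on the terms of \<open>u\<close> below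
  degree \<open>2q\<close>, whereas the group acts on whole cocycles and the truncation of a cocycle
  is in general no cocycle. So the orbit of a truncation \<open>t\<close> is encoded by the cocycles
  that can be moved to one with truncation \<open>t\<close>. This set is the same for the
  truncations of any two cocycles in one orbit, because the action respects agreement below degree
  \<open>2q\<close>. That the correction solves d D' = R comes from \<open>R_map\<close> seeing only
  the truncation: a cocycle \<open>w\<close> with the truncation of \<open>u\<close> has R(w) =
  R(u), and R(w) is minus the coboundary of the component of \<open>w\<close> of degree
  \<open>2q\<close>. No product of exponentials is ever expanded by a Baker-Campbell-Hausdorff
  formula. Two products with equally many factors are compared; if their exponents agree below
  degree \<open>d\<close>, then modulo degree \<open>d + 2\<close> the difference of the products is
  the sum of the differences of the exponents. Logarithms enter only through existence and
  uniqueness. Since endomorphisms preserve parity, removing a leading term of even degree gains two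
  degrees, so only even degrees have to be treated.\<close>

lemma wedge_sign_eq: "wedge_sign I J = (- 1) ^ card (Sigma I (\<lambda>i. J \<inter> {..<i}))"
proof -
  have "{(i, j). i \<in> I \<and> j \<in> J \<and> j < i} = Sigma I (\<lambda>i. J \<inter> {..<i})" by auto
  then show ?thesis by (simp add: wedge_sign_def)
qed

text \<open>The sign counts inversions between two index sets, and this count is additive over
  disjoint unions in either argument. All sign identities below reduce to this.\<close>

lemma wedge_sign_Un_left:
  assumes "finite I" "finite J" "finite L" "I \<inter> J = {}"
  shows "wedge_sign (I \<union> J) L = wedge_sign I L * wedge_sign J L"
proof -
  have "Sigma (I \<union> J) (\<lambda>i. L \<inter> {..<i}) = Sigma I (\<lambda>i. L \<inter> {..<i}) \<union> Sigma J (\<lambda>i. L \<inter> {..<i})" by auto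
  moreover have "card (Sigma I (\<lambda>i. L \<inter> {..<i}) \<union> Sigma J (\<lambda>i. L \<inter> {..<i}))
      = card (Sigma I (\<lambda>i. L \<inter> {..<i})) + card (Sigma J (\<lambda>i. L \<inter> {..<i}))"
    using assms by (intro card_Un_disjoint) auto
  ultimately show ?thesis by (simp add: wedge_sign_eq power_add)
qed

lemma wedge_sign_Un_right:
  assumes "finite I" "finite J" "finite L" "I \<inter> J = {}"
  shows "wedge_sign L (I \<union> J) = wedge_sign L I * wedge_sign L J"
proof -
  have "Sigma L (\<lambda>i. (I \<union> J) \<inter> {..<i}) = Sigma L (\<lambda>i. I \<inter> {..<i}) \<union> Sigma L (\<lambda>i. J \<inter> {..<i})" by auto
  moreover have "card (Sigma L (\<lambda>i. I \<inter> {..<i}) \<union> Sigma L (\<lambda>i. J \<inter> {..<i}))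
      = card (Sigma L (\<lambda>i. I \<inter> {..<i})) + card (Sigma L (\<lambda>i. J \<inter> {..<i}))"
    using assms by (intro card_Un_disjoint) auto
  ultimately show ?thesis by (simp add: wedge_sign_eq power_add)
qed

lemma wedge_sign_empty [simp]: "wedge_sign {} J = 1" "wedge_sign I {} = 1"
  by (simp_all add: wedge_sign_eq)

lemma wedge_sign_below:
  assumes "\<forall>i\<in>I. \<forall>j\<in>J. i < j" shows "wedge_sign I J = 1"
proof -
  have "Sigma I (\<lambda>i. J \<inter> {..<i}) = {}" using assms by fastforce
  then show ?thesis by (simp add: wedge_sign_eq)
qed

lemma wedge_sign_singleton:
  "wedge_sign {a} {b} = (if b < a then - 1 else 1)"
proof -
  have "Sigma {a} (\<lambda>i. {b} \<inter> {..<i}) = (if b < a then {(a, b)} else {})" by auto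
  then show ?thesis by (simp add: wedge_sign_eq)
qed

lemma wedge_infinite: "infinite K \<Longrightarrow> wedge \<omega> \<eta> K = 0"
  by (simp add: wedge_def)

lemma wedge_add_left: "wedge (a + b) c = wedge a c + wedge b c"
  and wedge_add_right: "wedge a (b + c) = wedge a b + wedge a c"
  by (auto simp: wedge_def fun_eq_iff algebra_simps sum.distrib)

lemma wedge_zero [simp]: "wedge 0 a = 0" "wedge a 0 = 0"
  by (auto simp: wedge_def fun_eq_iff)

lemma wedge_scale_left: "wedge (\<lambda>K. c * a K) b = (\<lambda>K. c * wedge a b K)"
  and wedge_scale_right: "wedge a (\<lambda>K. c * b K) = (\<lambda>K. c * wedge a b K)"
  by (auto simp: wedge_def fun_eq_iff sum_distrib_left algebra_simps)

lemma wedge_sum_left: "wedge (\<Sum>i\<in>S. f i) b = (\<Sum>i\<in>S. wedge (f i) b)"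
  using sum_comp_morphism[of "\<lambda>x. wedge x b" f S] by (simp add: wedge_add_left comp_def)

lemma wedge_sum_right: "wedge a (\<Sum>i\<in>S. f i) = (\<Sum>i\<in>S. wedge a (f i))"
  using sum_comp_morphism[of "wedge a" f S] by (simp add: wedge_add_right comp_def)

text \<open>Both sides run over the ordered partitions of \<open>K\<close> into three sets
  \<open>I\<close>, \<open>J\<close>, \<open>L\<close>. The two sign products agree because each
  counts the inversions between all three pairs of sets once.\<close>

lemma wedge_assoc: "wedge (wedge a b) c = wedge a (wedge b c)"
proof
  fix K
  show "wedge (wedge a b) c K = wedge a (wedge b c) K"
  proof (cases "finite K")
    case False
    then show ?thesis by (simp add: wedge_infinite)
  next
    case True
    have fin: "finite M" if "M \<subseteq> K" for M using True that by (rule rev_finite_subset)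
    have "wedge (wedge a b) c K = (\<Sum>(M, I)\<in>Sigma (Pow K) Pow.
        wedge_sign M (K - M) * (wedge_sign I (M - I) * a I * b (M - I)) * c (K - M))"
      using True fin
      by (subst sum.Sigma [symmetric]) (auto simp: wedge_def sum_distrib_left sum_distrib_right)
    \<comment> \<open>The left side chooses \<open>M\<close>, the union of the first two sets, and
      then \<open>I\<close> inside it; the right side chooses \<open>I\<close> and then
      \<open>J\<close> in the complement. The bijection is \<open>J = M - I\<close>.\<close>
    also have "\<dots> = (\<Sum>(I, J)\<in>Sigma (Pow K) (\<lambda>I. Pow (K - I)).
        wedge_sign I (K - I) * a I * (wedge_sign J (K - I - J) * b J * c (K - I - J)))"
    proof (rule sum.reindex_bij_witness
        [where j = "\<lambda>(M, I). (I, M - I)" and i = "\<lambda>(I, J). (I \<union> J, I)"])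
      fix p assume p: "p \<in> Sigma (Pow K) Pow"
      obtain M I where MI: "p = (M, I)" "I \<subseteq> M" "M \<subseteq> K" using p by auto
      define J L where "J = M - I" and "L = K - M"
      have *: "M = I \<union> J" "K - I = J \<union> L" "K - I - J = L" "I \<inter> J = {}" "J \<inter> L = {}" "I \<inter> L = {}"
        "finite I" "finite J" "finite L"
        using MI fin unfolding J_def L_def by blast+
      have "wedge_sign M L * wedge_sign I J = wedge_sign I (J \<union> L) * wedge_sign J L"
        unfolding \<open>M = I \<union> J\<close>
        using * by (simp add: wedge_sign_Un_left wedge_sign_Un_right)
      then show "(case (case p of (M, I) \<Rightarrow> (I, M - I)) of (I, J) \<Rightarrow>
          wedge_sign I (K - I) * a I * (wedge_sign J (K - I - J) * b J * c (K - I - J)))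
        = (case p of (M, I) \<Rightarrow>
        wedge_sign M (K - M) * (wedge_sign I (M - I) * a I * b (M - I)) * c (K - M))"
        using *(2,3) MI(1) by (simp add: J_def[symmetric] L_def[symmetric])
    qed auto
    also have "\<dots> = wedge a (wedge b c) K"
      using True fin
      by (subst sum.Sigma [symmetric]) (auto simp: wedge_def sum_distrib_left sum_distrib_right)
    finally show ?thesis .
  qed
qed

text \<open>Finiteness is demanded separately: an infinite set has \<open>card\<close> 0 and would
  pass for degree 0, while \<open>wedge\<close> vanishes there, so that \<open>ext_one\<close> would
  fail to be a unit.\<close>

definition ext_homog :: "(nat \<Rightarrow> bool) \<Rightarrow> ext set"
  where "ext_homog P = {\<omega>. \<forall>K. \<omega> K \<noteq> 0 \<longrightarrow> finite K \<and> P (card K)}"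

lemma wedge_nonzeroE:
  assumes "wedge a b K \<noteq> 0"
  obtains I where "finite K" "I \<subseteq> K" "a I \<noteq> 0" "b (K - I) \<noteq> 0"
    "card K = card I + card (K - I)"
proof -
  have fin: "finite K" using assms wedge_infinite by blast
  obtain I where "I \<in> Pow K" "wedge_sign I (K - I) * a I * b (K - I) \<noteq> 0"
    using assms unfolding wedge_def by (meson sum.neutral)
  then show ?thesis using fin by (intro that) (auto simp: card_Diff_subset card_mono finite_subset)
qed

lemma wedge_homog:
  assumes "a \<in> ext_homog P" "b \<in> ext_homog Q" "\<And>m n. P m \<Longrightarrow> Q n \<Longrightarrow> R (m + n)"
  shows "wedge a b \<in> ext_homog R"
  using assms unfolding ext_homog_def by (auto elim!: wedge_nonzeroE)

lemma wedge_ext_one_right: "a \<in> ext_homog P \<Longrightarrow> wedge a ext_one = a"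
proof
  fix K assume a: "a \<in> ext_homog P"
  show "wedge a ext_one K = a K"
  proof (cases "finite K")
    case True
    have "wedge a ext_one K = (\<Sum>I\<in>{K}. wedge_sign I (K - I) * a I * ext_one (K - I))"
      unfolding wedge_def using True by (intro sum.mono_neutral_right) (auto simp: ext_one_def)
    then show ?thesis by (simp add: ext_one_def)
  qed (use a in \<open>auto simp: wedge_infinite ext_homog_def\<close>)
qed

lemma wedge_ext_one_left: "a \<in> ext_homog P \<Longrightarrow> wedge ext_one a = a"
proof
  fix K assume a: "a \<in> ext_homog P"
  show "wedge ext_one a K = a K"
  proof (cases "finite K")
    case True
    have "wedge ext_one a K = (\<Sum>I\<in>{{}}. wedge_sign I (K - I) * ext_one I * a (K - I))"
      unfolding wedge_def using True by (intro sum.mono_neutral_right) (auto simp: ext_one_def)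
    then show ?thesis by (simp add: ext_one_def)
  qed (use a in \<open>auto simp: wedge_infinite ext_homog_def\<close>)
qed

lemma ext_one_homog: "ext_one \<in> ext_homog (\<lambda>d. d = 0)"
  by (auto simp: ext_one_def ext_homog_def split: if_splits)

lemma ext_column_homog: "ext_column r g j \<in> ext_homog (\<lambda>d. d = 1)"
proof -
  have "\<exists>i. K = {i}" if "ext_column r g j K \<noteq> 0" for K
  proof (rule ccontr)
    assume "\<nexists>i. K = {i}"
    then have "ext_column r g j K = 0" unfolding ext_column_def by (intro sum.neutral) simp
    with that show False by simp
  qed
  then have "finite K \<and> card K = 1" if "ext_column r g j K \<noteq> 0" for K
    using that by (metis card_1_singleton_iff card.infinite finite.simps One_nat_def)
  then show ?thesis by (simp add: ext_homog_def)
qed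

text \<open>Passing to the complement exchanges the factors. Only splittings of \<open>K\<close>
  into two distinct singletons contribute, and of the pairs (x, y) and (y, x) exactly one is an
  inversion.\<close>

lemma wedge_anticommute:
  assumes "a \<in> ext_homog (\<lambda>d. d = 1)" "b \<in> ext_homog (\<lambda>d. d = 1)"
  shows "wedge b a = - wedge a b"
proof
  fix K
  have "wedge b a K = (\<Sum>I\<in>Pow K. wedge_sign (K - I) I * b (K - I) * a I)"
    unfolding wedge_def
    by (rule sum.reindex_bij_witness [where i = "\<lambda>I. K - I" and j = "\<lambda>I. K - I"])
      (auto simp: double_diff)
  also have "\<dots> = (\<Sum>I\<in>Pow K. - (wedge_sign I (K - I) * a I * b (K - I)))"
  proof (rule sum.cong[OF refl])
    fix I
    show "wedge_sign (K - I) I * b (K - I) * a I = - (wedge_sign I (K - I) * a I * b (K - I))"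
    proof (cases "a I \<noteq> 0 \<and> b (K - I) \<noteq> 0")
      case True
      then obtain x y where "I = {x}" "K - I = {y}"
        using assms unfolding ext_homog_def by (metis (mono_tags, lifting) card_1_singletonE mem_Collect_eq)
      moreover from this have "x \<noteq> y" by auto
      ultimately show ?thesis by (auto simp: wedge_sign_singleton)
    qed auto
  qed
  finally show "wedge b a K = (- wedge a b) K" by (simp add: wedge_def sum_negf)
qed

lemma wedge_self:
  assumes "a \<in> ext_homog (\<lambda>d. d = 1)" shows "wedge a a = 0"
proof
  fix K
  have "wedge a a K = - wedge a a K"
    using fun_cong[OF wedge_anticommute[OF assms assms], of K] by simp
  then show "wedge a a K = 0 K" by (simp add: eq_neg_iff_add_eq_0 flip: mult_2)
qed

section \<open>Maps of exterior algebras induced by matrices\<close>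

definition ext_basis :: "nat \<Rightarrow> (nat \<Rightarrow> nat \<Rightarrow> complex) \<Rightarrow> nat set \<Rightarrow> ext"
  where "ext_basis r g J = foldr wedge (map (ext_column r g) (sorted_list_of_set J)) ext_one"

lemma sum_fun_apply: "(\<Sum>i\<in>S. f i) x = (\<Sum>i\<in>S. f i x)"
  by (induction S rule: infinite_finite_induct) auto

lemma ext_map_eq: "ext_map r g \<omega> = (\<Sum>J\<in>Pow {..<r}. (\<lambda>K. \<omega> J * ext_basis r g J K))"
  by (auto simp: ext_map_def ext_basis_def fun_eq_iff sum_fun_apply)

lemma ext_basis_empty [simp]: "ext_basis r g {} = ext_one"
  by (simp add: ext_basis_def)

text \<open>Insertion sort: the new column moves right past the smaller ones, each exchange costing
  a factor -1, until it reaches its place or meets its own copy and the product vanishes.\<close>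

lemma column_foldr:
  assumes "sorted xs" "distinct xs"
  shows "wedge (ext_column r g j) (foldr wedge (map (ext_column r g) xs) ext_one) =
    (if j \<in> set xs then 0
     else (\<lambda>K. wedge_sign {j} (set xs) * foldr wedge (map (ext_column r g) (insort j xs)) ext_one K))"
  using assms
proof (induction xs)
  case Nil
  then show ?case by auto
next
  case (Cons x xs)
  let ?c = "ext_column r g" and ?F = "\<lambda>xs. foldr wedge (map (ext_column r g) xs) ext_one"
  note hc = ext_column_homog[of r g]
  consider "j < x" | "j = x" | "x < j" by linarith
  then show ?case
  proof cases
    case 1
    have "wedge_sign {j} (set (x # xs)) = 1"
      using 1 Cons.prems by (intro wedge_sign_below) auto
    then show ?thesis using 1 Cons.prems by auto
  next
    case 2
    then show ?thesis by (simp add: wedge_assoc[symmetric] wedge_self[OF hc])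
  next
    case 3
    have s: "wedge_sign {j} (set (x # xs)) = - wedge_sign {j} (set xs)"
      using wedge_sign_Un_right[of "{x}" "set xs" "{j}"] 3 Cons.prems
      by (simp add: wedge_sign_singleton)
    have "wedge (?c j) (?F (x # xs)) = wedge (wedge (?c j) (?c x)) (?F xs)"
      by (simp add: wedge_assoc)
    also have "\<dots> = wedge (\<lambda>K. (-1) * wedge (?c x) (?c j) K) (?F xs)"
      by (simp add: wedge_anticommute[OF hc hc, of j x] fun_Compl_def)
    also have "\<dots> = (\<lambda>K. (-1) * wedge (?c x) (wedge (?c j) (?F xs)) K)"
      by (simp only: wedge_scale_left wedge_assoc)
    also have "\<dots> = (if j \<in> set (x # xs) then 0
     else (\<lambda>K. wedge_sign {j} (set (x # xs)) * ?F (insort j (x # xs)) K))"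
      using 3 Cons.prems s by (auto simp: Cons.IH wedge_scale_right fun_eq_iff)
    finally show ?thesis .
  qed
qed

lemma column_ext_basis:
  assumes "finite J"
  shows "wedge (ext_column r g j) (ext_basis r g J) =
    (if j \<in> J then 0 else (\<lambda>K. wedge_sign {j} J * ext_basis r g (insert j J) K))"
  using column_foldr[of "sorted_list_of_set J" r g j] assms
  by (auto simp: ext_basis_def sorted_list_of_set_insert_remove)

lemma ext_basis_insert:
  assumes "finite J" "\<forall>a\<in>J. j < a"
  shows "ext_basis r g (insert j J) = wedge (ext_column r g j) (ext_basis r g J)"
proof -
  have "j \<notin> J" "wedge_sign {j} J = 1" using assms by (auto intro: wedge_sign_below)
  then show ?thesis using column_ext_basis[OF assms(1), of r g j] by simp
qed

lemma ext_basis_homog: "finite J \<Longrightarrow> ext_basis r g J \<in> ext_homog (\<lambda>d. d = card J)"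
proof (induction J rule: finite_linorder_min_induct)
  case empty
  then show ?case using ext_one_homog by simp
next
  case (insert b A)
  then have "b \<notin> A" by blast
  then show ?case using insert
    by (subst ext_basis_insert) (auto intro: wedge_homog[OF ext_column_homog insert.IH])
qed

text \<open>The induction adds a new smallest index, which is the leftmost factor; associativity
  moves it outside, and only the rule for a single column is needed.\<close>

lemma wedge_ext_basis:
  assumes "finite J" "finite L"
  shows "wedge (ext_basis r g J) (ext_basis r g L) =
    (if J \<inter> L = {} then (\<lambda>K. wedge_sign J L * ext_basis r g (J \<union> L) K) else 0)"
  using assms(1)
proof (induction J rule: finite_linorder_min_induct)
  case empty
  then show ?case by (simp add: wedge_ext_one_left[OF ext_basis_homog] assms)
next
  case (insert b A)
  have bA: "b \<notin> A" using insert by blast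
  have "wedge (ext_basis r g (insert b A)) (ext_basis r g L) =
      wedge (ext_column r g b) (wedge (ext_basis r g A) (ext_basis r g L))"
    using insert by (simp add: ext_basis_insert wedge_assoc)
  also have "\<dots> = (if A \<inter> L = {} \<and> b \<notin> L then
      (\<lambda>K. wedge_sign A L * (wedge_sign {b} (A \<union> L) * ext_basis r g (insert b A \<union> L) K)) else 0)"
    using bA assms insert.hyps
    by (auto simp: insert.IH wedge_scale_right column_ext_basis fun_eq_iff)
  also have "\<dots> = (if insert b A \<inter> L = {} then
      (\<lambda>K. wedge_sign (insert b A) L * ext_basis r g (insert b A \<union> L) K) else 0)"
  proof (cases "insert b A \<inter> L = {}")
    case True
    have "wedge_sign {b} (A \<union> L) = wedge_sign {b} A * wedge_sign {b} L"
      using insert assms True by (intro wedge_sign_Un_right) auto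
    moreover have "wedge_sign {b} A = 1" using insert by (auto intro: wedge_sign_below)
    moreover have "wedge_sign ({b} \<union> A) L = wedge_sign {b} L * wedge_sign A L"
      using insert assms bA by (intro wedge_sign_Un_left) auto
    ultimately show ?thesis using True by (auto simp: algebra_simps)
  qed auto
  finally show ?case .
qed

lemma ext_map_add: "ext_map r g (a + b) = ext_map r g a + ext_map r g b"
  by (auto simp: ext_map_def fun_eq_iff algebra_simps sum.distrib)

lemma ext_map_scale: "ext_map r g (\<lambda>K. c * a K) = (\<lambda>K. c * ext_map r g a K)"
  by (auto simp: ext_map_def fun_eq_iff algebra_simps sum_distrib_left)

lemma ext_map_zero [simp]: "ext_map r g 0 = 0"
  by (auto simp: ext_map_def fun_eq_iff)

lemma ext_map_one: "ext_map r g ext_one = ext_one"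
proof
  fix K
  have "ext_map r g ext_one K = (\<Sum>J\<in>{{}}. ext_one J * ext_basis r g J K)"
    unfolding ext_map_eq sum_fun_apply by (intro sum.mono_neutral_right) (auto simp: ext_one_def)
  then show "ext_map r g ext_one K = ext_one K" by (simp add: ext_one_def)
qed

text \<open>Each basis vector goes to an element of the same degree. Hence the homogeneous
  components of a section transform like the section itself.\<close>

lemma ext_map_degree:
  "ext_map r g (\<lambda>K. if card K = j then \<omega> K else 0) = (\<lambda>K. if card K = j then ext_map r g \<omega> K else 0)"
proof
  fix K
  have *: "card K = card J" if "J \<subseteq> {..<r}" "ext_basis r g J K \<noteq> 0" for J
    using ext_basis_homog[of J r g] that finite_subset by (auto simp: ext_homog_def)
  show "ext_map r g (\<lambda>K. if card K = j then \<omega> K else 0) K = (if card K = j then ext_map r g \<omega> K else 0)"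
  proof (cases "card K = j")
    case True
    then have "(if card J = j then \<omega> J else 0) * ext_basis r g J K = \<omega> J * ext_basis r g J K"
      if "J \<subseteq> {..<r}" for J using *[OF that] by (cases "ext_basis r g J K = 0") auto
    then have "(\<Sum>J\<in>Pow {..<r}. (if card J = j then \<omega> J else 0) * ext_basis r g J K)
        = (\<Sum>J\<in>Pow {..<r}. \<omega> J * ext_basis r g J K)" by (intro sum.cong) auto
    then show ?thesis using True unfolding ext_map_eq sum_fun_apply by simp
  next
    case False
    then have "(if card J = j then \<omega> J else 0) * ext_basis r g J K = 0"
      if "J \<subseteq> {..<r}" for J using *[OF that] by (cases "ext_basis r g J K = 0") auto
    then have "(\<Sum>J\<in>Pow {..<r}. (if card J = j then \<omega> J else 0) * ext_basis r g J K) = 0"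
      by (intro sum.neutral) auto
    then show ?thesis using False unfolding ext_map_eq sum_fun_apply by simp
  qed
qed

text \<open>This makes the product of two sections a section again. By bilinearity it reduces to
  products of basis images, where overlapping index sets contribute nothing.\<close>

lemma ext_map_wedge:
  "ext_map r g (wedge \<omega> \<eta>) = wedge (ext_map r g \<omega>) (ext_map r g \<eta>)"
proof
  fix K
  let ?P = "Pow {..<r}" and ?C = "ext_basis r g"
  have fin: "finite J" if "J \<subseteq> {..<r}" for J using that finite_subset by blast
  have "wedge (ext_map r g \<omega>) (ext_map r g \<eta>) K =
      (\<Sum>J\<in>?P. wedge (\<lambda>K. \<omega> J * ?C J K) (\<Sum>L\<in>?P. (\<lambda>K. \<eta> L * ?C L K)) K)"
    by (simp only: ext_map_eq wedge_sum_left sum_fun_apply)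
  also have "\<dots> = (\<Sum>J\<in>?P. \<Sum>L\<in>?P. \<omega> J * (\<eta> L * wedge (?C J) (?C L) K))"
    by (simp only: wedge_sum_right wedge_scale_left wedge_scale_right sum_fun_apply sum_distrib_left)
  also have "\<dots> = (\<Sum>J\<in>?P. \<Sum>L\<in>?P. if J \<inter> L = {} then
      wedge_sign J L * \<omega> J * \<eta> L * ?C (J \<union> L) K else 0)"
    by (intro sum.cong refl) (auto simp: wedge_ext_basis fin)
  also have "\<dots> = (\<Sum>(J, L)\<in>?P \<times> ?P. if J \<inter> L = {} then
      wedge_sign J L * \<omega> J * \<eta> L * ?C (J \<union> L) K else 0)"
    by (simp add: sum.cartesian_product)
  also have "\<dots> = (\<Sum>(J, L)\<in>{(J, L)\<in>?P \<times> ?P. J \<inter> L = {}}.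
      wedge_sign J L * \<omega> J * \<eta> L * ?C (J \<union> L) K)"
    by (intro sum.mono_neutral_cong_right) (auto split: if_splits)
  \<comment> \<open>A pair of disjoint sets is the same as a set \<open>M\<close>, their union, with
    a chosen subset \<open>J\<close>; collecting by \<open>M\<close> produces the coefficients of
    the product.\<close>
  also have "\<dots> = (\<Sum>(M, J)\<in>Sigma ?P Pow.
      wedge_sign J (M - J) * \<omega> J * \<eta> (M - J) * ?C M K)"
  proof (rule sum.reindex_bij_witness
        [where i = "\<lambda>(M, J). (J, M - J)" and j = "\<lambda>(J, L). (J \<union> L, J)"])
    fix p assume "p \<in> {(J, L)\<in>?P \<times> ?P. J \<inter> L = {}}"
    then obtain J L where p: "p = (J, L)" "J \<subseteq> {..<r}" "L \<subseteq> {..<r}" "J \<inter> L = {}" by blast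
    then have "(J \<union> L) - J = L" by blast
    then show "(case case p of (J, L) \<Rightarrow> (J \<union> L, J) of (M, J) \<Rightarrow> (J, M - J)) = p"
      "(case p of (J, L) \<Rightarrow> (J \<union> L, J)) \<in> Sigma ?P Pow"
      "(case case p of (J, L) \<Rightarrow> (J \<union> L, J) of
          (M, J) \<Rightarrow> wedge_sign J (M - J) * \<omega> J * \<eta> (M - J) * ?C M K)
        = (case p of (J, L) \<Rightarrow> wedge_sign J L * \<omega> J * \<eta> L * ?C (J \<union> L) K)"
      using p by simp_all
  qed auto
  also have "\<dots> = ext_map r g (wedge \<omega> \<eta>) K"
    unfolding ext_map_eq sum_fun_apply
    by (subst sum.Sigma [symmetric]) (auto simp: fin wedge_def sum_distrib_right)
  finally show "ext_map r g (wedge \<omega> \<eta>) K = wedge (ext_map r g \<omega>) (ext_map r g \<eta>) K" ..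
qed

section \<open>Holomorphic functions and sections\<close>

lemma holo_fun_const: "holo_fun n D (\<lambda>_. c)"
  by (simp add: holo_fun_def)

lemma holo_fun_add: "holo_fun n D f \<Longrightarrow> holo_fun n D g \<Longrightarrow> holo_fun n D (\<lambda>a. f a + g a)"
  by (auto simp: holo_fun_def intro!: continuous_map_add field_differentiable_add)

lemma holo_fun_mult:
  assumes "holo_fun n D f" "holo_fun n D g" shows "holo_fun n D (\<lambda>a. f a * g a)"
proof -
  have "continuous_map (subtopology (cspace n) D) euclidean (\<lambda>a. f a * g a)"
    using assms by (auto simp: holo_fun_def continuous_map_atin intro: tendsto_mult)
  then show ?thesis using assms by (auto simp: holo_fun_def intro!: field_differentiable_mult)
qed

text \<open>Differentiability in one variable at a point sees a function only on a small disc in the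
  coordinate line, and an open set contains such a disc.\<close>

lemma cspace_line_neighbourhood:
  assumes D: "openin (cspace n) D" and "a \<in> D" "i < n"
  shows "\<exists>d>0. \<forall>z. dist z (a i) < d \<longrightarrow> a(i := z) \<in> D"
proof -
  have a: "a \<in> topspace (cspace n)" using D \<open>a \<in> D\<close> openin_subset by blast
  have "continuous_map euclidean (cspace n) (\<lambda>z. a(i := z))"
    unfolding cspace_def continuous_map_componentwise
  proof (intro conjI ballI)
    show "(\<lambda>z. a(i := z)) ` topspace euclidean \<subseteq> extensional {..<n}"
      using a \<open>i < n\<close> by (auto simp: cspace_def PiE_def extensional_def)
    fix k assume "k \<in> {..<n}"
    show "continuous_map euclidean euclidean (\<lambda>z. (a(i := z)) k)"
      by (cases "k = i") auto
  qed
  then have "open {z. a(i := z) \<in> D}"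
    using D openin_continuous_map_preimage by force
  then show ?thesis using \<open>a \<in> D\<close> unfolding open_dist by auto
qed

text \<open>The local witness \<open>f\<close> is holomorphic on a set \<open>F\<close> that need
  not lie in \<open>D\<close>; so one criterion serves both the restriction of sections and their
  gluing.\<close>

lemma holo_fun_local:
  assumes "\<And>a. a \<in> D \<Longrightarrow> \<exists>E F f. openin (cspace n) E \<and> a \<in> E \<and> E \<subseteq> D \<and>
    holo_fun n F f \<and> E \<subseteq> F \<and> (\<forall>b\<in>E. f b = g b)"
  shows "holo_fun n D g"
  unfolding holo_fun_def
proof (intro conjI ballI allI impI)
  fix a i assume "a \<in> D" "i < n"
  then obtain E F f where E: "openin (cspace n) E" "a \<in> E" "holo_fun n F f" "E \<subseteq> F" "\<forall>b\<in>E. f b = g b"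
    using assms[OF \<open>a \<in> D\<close>] by (elim exE conjE)
  obtain d where d: "d > 0" "\<forall>z. dist z (a i) < d \<longrightarrow> a(i := z) \<in> E"
    using cspace_line_neighbourhood[OF E(1,2) \<open>i < n\<close>] by blast
  have "(\<lambda>z. f (a(i := z))) field_differentiable (at (a i))"
    using E \<open>i < n\<close> by (auto simp: holo_fun_def)
  moreover have "f (a(i := z)) = g (a(i := z))" if "dist z (a i) < d" for z
    using d E that by blast
  ultimately show "(\<lambda>z. g (a(i := z))) field_differentiable (at (a i))"
    using field_differentiable_transform_within[OF d(1), of "a i" UNIV "\<lambda>z. f (a(i := z))"] by simp
next
  obtain E F f where E: "\<And>a. a \<in> D \<Longrightarrow> openin (cspace n) (E a) \<and> a \<in> E a \<and> E a \<subseteq> D \<and>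
    holo_fun n (F a) (f a) \<and> E a \<subseteq> F a \<and> (\<forall>b\<in>E a. f a b = g b)"
    using assms by metis
  show "continuous_map (subtopology (cspace n) D) euclidean g"
  proof (rule pasting_lemma[where I = D and T = E and f = f])
    fix a assume a: "a \<in> D"
    show "openin (subtopology (cspace n) D) (E a)"
      using E[OF a] unfolding openin_subtopology by (intro exI[of _ "E a"]) auto
    have "continuous_map (subtopology (cspace n) (E a)) euclidean (f a)"
      using E[OF a] continuous_map_from_subtopology_mono unfolding holo_fun_def by blast
    then show "continuous_map (subtopology (subtopology (cspace n) D) (E a)) euclidean (f a)"
      using E[OF a] by (simp add: subtopology_subtopology inf.absorb2)
  qed (use E in auto)
qed

lemma holo_on_const: "holo_on X U (\<lambda>_. c)"
  by (auto simp: holo_on_def comp_def holo_fun_const)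

lemma holo_on_add: "holo_on X U f \<Longrightarrow> holo_on X U g \<Longrightarrow> holo_on X U (\<lambda>x. f x + g x)"
  using holo_fun_add by (fastforce simp: holo_on_def comp_def)

lemma holo_on_mult: "holo_on X U f \<Longrightarrow> holo_on X U g \<Longrightarrow> holo_on X U (\<lambda>x. f x * g x)"
  using holo_fun_mult by (fastforce simp: holo_on_def comp_def)

lemma holo_on_sum: "(\<And>i. i \<in> S \<Longrightarrow> holo_on X U (f i)) \<Longrightarrow> holo_on X U (\<lambda>x. \<Sum>i\<in>S. f i x)"
  by (induction S rule: infinite_finite_induct) (auto intro: holo_on_const holo_on_add)

lemma chart_open_image:
  assumes "complex_manifold X" "(V, \<phi>) \<in> charts X" "openin (mtop X) W"
  shows "openin (cspace (mdim X)) (\<phi> ` (W \<inter> V))" "inj_on \<phi> V"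
proof -
  have *: "openin (mtop X) V" "openin (cspace (mdim X)) (\<phi> ` V)"
    "homeomorphic_map (subtopology (mtop X) V) (subtopology (cspace (mdim X)) (\<phi> ` V)) \<phi>"
    using assms unfolding complex_manifold_def by blast+
  have "openin (subtopology (mtop X) V) (W \<inter> V)"
    using assms(3) by (simp add: openin_subtopology_Int)
  then have "openin (subtopology (cspace (mdim X)) (\<phi> ` V)) (\<phi> ` (W \<inter> V))"
    using homeomorphic_imp_open_map[OF *(3)] by (auto simp: open_map_def)
  then show "openin (cspace (mdim X)) (\<phi> ` (W \<inter> V))"
    using *(2) openin_trans_full by blast
  have "topspace (subtopology (mtop X) V) = V"
    using openin_subset[OF *(1)] by auto
  then show "inj_on \<phi> V" using homeomorphic_imp_injective_map[OF *(3)] by simp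
qed

lemma holo_on_local:
  assumes X: "complex_manifold X"
    and loc: "\<And>x. x \<in> U \<Longrightarrow> \<exists>W W' f. openin (mtop X) W \<and> x \<in> W \<and> W \<subseteq> U \<and>
      holo_on X W' f \<and> W \<subseteq> W' \<and> (\<forall>y\<in>W. f y = g y)"
  shows "holo_on X U g"
  unfolding holo_on_def
proof (clarify)
  fix V \<phi> assume V: "(V, \<phi>) \<in> charts X"
  show "holo_fun (mdim X) (\<phi> ` (U \<inter> V)) (g \<circ> inv_into V \<phi>)"
  proof (rule holo_fun_local)
    fix a assume "a \<in> \<phi> ` (U \<inter> V)"
    then obtain x where x: "x \<in> U" "x \<in> V" "a = \<phi> x" by blast
    then obtain W W' f where W: "openin (mtop X) W" "x \<in> W" "W \<subseteq> U"
      "holo_on X W' f" "W \<subseteq> W'" "\<forall>y\<in>W. f y = g y"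
      using loc[OF x(1)] by (elim exE conjE)
    note co = chart_open_image[OF X V W(1)]
    have "holo_fun (mdim X) (\<phi> ` (W' \<inter> V)) (f \<circ> inv_into V \<phi>)"
      using W(4) V by (auto simp: holo_on_def)
    moreover have "\<forall>b\<in>\<phi> ` (W \<inter> V). (f \<circ> inv_into V \<phi>) b = (g \<circ> inv_into V \<phi>) b"
      using co(2) W(6) by auto
    ultimately show "\<exists>E F f. openin (cspace (mdim X)) E \<and> a \<in> E \<and> E \<subseteq> \<phi> ` (U \<inter> V) \<and>
        holo_fun (mdim X) F f \<and> E \<subseteq> F \<and> (\<forall>b\<in>E. f b = (g \<circ> inv_into V \<phi>) b)"
      using co(1) W(2,3,5) x
      by (intro exI[of _ "\<phi> ` (W \<inter> V)"] exI[of _ "\<phi> ` (W' \<inter> V)"] exI[of _ "f \<circ> inv_into V \<phi>"] conjI)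
        (assumption | blast)+
  qed
qed

lemma sum_induct_closed:
  assumes "\<And>i. i \<in> S \<Longrightarrow> P (f i)" "P 0" "\<And>x y. P x \<Longrightarrow> P y \<Longrightarrow> P (x + y)"
  shows "P (sum f S)"
  using assms by (induction S rule: infinite_finite_induct) simp_all

section \<open>Sections of the exterior algebra bundle\<close>

locale ext_bundle =
  fixes X :: "'m cmanifold" and B :: "('m, 'e) vbundle"
  assumes manifold: "complex_manifold X"
    and vec_bundle: "holomorphic_vector_bundle X B"
begin

abbreviation "opn V \<equiv> openin (mtop X) V"
abbreviation "sect V \<equiv> ext_sections X B V"
abbreviation "gr P V \<equiv> graded_sections X B P V"

lemma triv_open: "t \<in> trivs B \<Longrightarrow> opn (fst t)"
  using vec_bundle unfolding holomorphic_vector_bundle_def by (cases t) auto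

lemma sectI:
  assumes "\<And>t I. t \<in> trivs B \<Longrightarrow> holo_on X (V \<inter> fst t) (\<lambda>x. s t x I)"
    and "\<And>t x I. t \<in> trivs B \<Longrightarrow> x \<in> V \<Longrightarrow> x \<in> fst t \<Longrightarrow> s t x I \<noteq> 0 \<Longrightarrow> I \<subseteq> {..<rank B}"
    and "\<And>t t' x. t \<in> trivs B \<Longrightarrow> t' \<in> trivs B \<Longrightarrow> x \<in> V \<Longrightarrow> x \<in> fst t \<Longrightarrow> x \<in> fst t' \<Longrightarrow>
      s t x = ext_map (rank B) (transition B t t' x) (s t' x)"
    and "\<And>t x. \<not> (t \<in> trivs B \<and> x \<in> V \<and> x \<in> fst t) \<Longrightarrow> s t x = 0"
  shows "s \<in> sect V"
  unfolding ext_sections_def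
proof (intro CollectI conjI ballI allI impI)
  fix t t' x assume "t \<in> trivs B" "t' \<in> trivs B" "x \<in> V \<inter> fst t \<inter> fst t'"
  then show "s t x = ext_map (rank B) (transition B t t' x) (s t' x)" by (intro assms(3)) auto
next
  fix t x I assume "t \<in> trivs B" "x \<in> V \<inter> fst t" "s t x I \<noteq> 0"
  then show "I \<subseteq> {..<rank B}" by (intro assms(2)[of t x I]) auto
next
  fix t x assume "\<not> (t \<in> trivs B \<and> x \<in> V \<inter> fst t)"
  then show "s t x = 0" by (intro assms(4)) auto
qed (rule assms(1))

lemma sectD:
  assumes "s \<in> sect V"
  shows "t \<in> trivs B \<Longrightarrow> holo_on X (V \<inter> fst t) (\<lambda>x. s t x I)"
    and "s t x I \<noteq> 0 \<Longrightarrow> I \<subseteq> {..<rank B}"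
    and "t \<in> trivs B \<Longrightarrow> t' \<in> trivs B \<Longrightarrow> x \<in> V \<Longrightarrow> x \<in> fst t \<Longrightarrow> x \<in> fst t' \<Longrightarrow>
      s t x = ext_map (rank B) (transition B t t' x) (s t' x)"
    and "\<not> (t \<in> trivs B \<and> x \<in> V \<and> x \<in> fst t) \<Longrightarrow> s t x = 0"
proof -
  note * = assms[unfolded ext_sections_def, simplified mem_Collect_eq]
  show z: "s t x = 0" if "\<not> (t \<in> trivs B \<and> x \<in> V \<and> x \<in> fst t)" for t x
    using * that by blast
  show "I \<subseteq> {..<rank B}" if "s t x I \<noteq> 0"
  proof -
    have "t \<in> trivs B \<and> x \<in> V \<and> x \<in> fst t" using z that by (metis zero_fun_apply)
    then show ?thesis using assms that unfolding ext_sections_def by blast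
  qed
  show "holo_on X (V \<inter> fst t) (\<lambda>x. s t x I)" if "t \<in> trivs B"
    using * that by blast
  show "s t x = ext_map (rank B) (transition B t t' x) (s t' x)"
    if "t \<in> trivs B" "t' \<in> trivs B" "x \<in> V" "x \<in> fst t" "x \<in> fst t'"
    using * that by blast
qed

lemma zero_sect [simp]: "0 \<in> sect V"
  by (rule sectI) (simp_all add: holo_on_const)

lemma sect_addI [intro]:
  assumes "s \<in> sect V" "s' \<in> sect V" shows "s + s' \<in> sect V"
proof (rule sectI)
  fix t x I assume "(s + s') t x I \<noteq> 0"
  then show "I \<subseteq> {..<rank B}" using sectD(2)[OF assms(1)] sectD(2)[OF assms(2)]
    by (metis add.right_neutral plus_fun_apply)
next
  fix t t' x assume "t \<in> trivs B" "t' \<in> trivs B" "x \<in> V" "x \<in> fst t" "x \<in> fst t'"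
  then show "(s + s') t x = ext_map (rank B) (transition B t t' x) ((s + s') t' x)"
    using sectD(3)[OF assms(1), of t t' x] sectD(3)[OF assms(2), of t t' x] by (simp add: ext_map_add)
next
  fix t x assume "\<not> (t \<in> trivs B \<and> x \<in> V \<and> x \<in> fst t)"
  then have "s t x = 0" "s' t x = 0" using sectD(4) assms by blast+
  then show "(s + s') t x = 0" by (simp add: fun_eq_iff)
qed (use assms in \<open>simp add: sectD(1) holo_on_add\<close>)

lemma sect_scaleI [intro]:
  assumes "s \<in> sect V" shows "sect_scale c s \<in> sect V"
proof (rule sectI)
  fix t t' x assume "t \<in> trivs B" "t' \<in> trivs B" "x \<in> V" "x \<in> fst t" "x \<in> fst t'"
  then show "sect_scale c s t x = ext_map (rank B) (transition B t t' x) (sect_scale c s t' x)"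
    using sectD(3)[OF assms(1), of t t' x] unfolding sect_scale_def by (simp add: ext_map_scale)
next
  fix t x I assume "sect_scale c s t x I \<noteq> 0"
  then show "I \<subseteq> {..<rank B}" using sectD(2)[OF assms(1), of t x I] by (simp add: sect_scale_def)
next
  fix t x assume "\<not> (t \<in> trivs B \<and> x \<in> V \<and> x \<in> fst t)"
  then show "sect_scale c s t x = 0" using sectD(4)[OF assms(1), of t x] by (auto simp: sect_scale_def)
qed (use assms in \<open>simp_all add: sectD(1) sect_scale_def holo_on_mult holo_on_const\<close>)

lemma sect_uminus_eq: "- s = sect_scale (- 1) s"
  by (auto simp: sect_scale_def fun_eq_iff)

lemma sect_uminusI [intro]: "s \<in> sect V \<Longrightarrow> - s \<in> sect V"
  unfolding sect_uminus_eq by (rule sect_scaleI)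

lemma sect_sumI: "(\<And>i. i \<in> S \<Longrightarrow> f i \<in> sect V) \<Longrightarrow> sum f S \<in> sect V"
  by (rule sum_induct_closed[where P = "\<lambda>s. s \<in> sect V"]) auto

lemma sect_compI: assumes "s \<in> sect V" shows "sect_comp j s \<in> sect V"
proof (rule sectI)
  fix t I assume "t \<in> trivs B"
  then show "holo_on X (V \<inter> fst t) (\<lambda>x. sect_comp j s t x I)"
    using sectD(1)[OF assms] by (cases "card I = j") (simp_all add: sect_comp_def holo_on_const)
next
  fix t t' x assume "t \<in> trivs B" "t' \<in> trivs B" "x \<in> V" "x \<in> fst t" "x \<in> fst t'"
  then show "sect_comp j s t x = ext_map (rank B) (transition B t t' x) (sect_comp j s t' x)"
    using sectD(3)[OF assms, of t t' x] unfolding sect_comp_def ext_map_degree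
    by (intro ext) presburger
next
  fix t x I assume "sect_comp j s t x I \<noteq> 0"
  then show "I \<subseteq> {..<rank B}" using sectD(2)[OF assms, of t x I] by (simp add: sect_comp_def split: if_splits)
next
  fix t x assume "\<not> (t \<in> trivs B \<and> x \<in> V \<and> x \<in> fst t)"
  then show "sect_comp j s t x = 0" using sectD(4)[OF assms, of t x] by (auto simp: sect_comp_def)
qed

lemma sect_finite_support:
  assumes "s \<in> sect V" "s t x I \<noteq> 0" shows "finite I" "card I \<le> rank B"
proof -
  have "I \<subseteq> {..<rank B}" using sectD(2)[OF assms] .
  then show "finite I" "card I \<le> rank B"
    using finite_subset by (blast, metis card_lessThan card_mono finite_lessThan)
qed

lemma sect_multI:
  assumes "s \<in> sect V" "s' \<in> sect V" shows "sect_mult s s' \<in> sect V"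
proof (rule sectI)
  fix t I assume "t \<in> trivs B"
  then show "holo_on X (V \<inter> fst t) (\<lambda>x. sect_mult s s' t x I)"
    unfolding sect_mult_def wedge_def
    by (intro holo_on_sum holo_on_mult holo_on_const sectD(1)[OF assms(1)] sectD(1)[OF assms(2)])
next
  fix t t' x assume "t \<in> trivs B" "t' \<in> trivs B" "x \<in> V" "x \<in> fst t" "x \<in> fst t'"
  then show "sect_mult s s' t x = ext_map (rank B) (transition B t t' x) (sect_mult s s' t' x)"
    using sectD(3)[OF assms(1), of t t' x] sectD(3)[OF assms(2), of t t' x]
    unfolding sect_mult_def by (simp add: ext_map_wedge)
next
  fix t x K assume "sect_mult s s' t x K \<noteq> 0"
  then obtain I where I: "I \<subseteq> K" "s t x I \<noteq> 0" "s' t x (K - I) \<noteq> 0"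
    unfolding sect_mult_def by (rule wedge_nonzeroE)
  then show "K \<subseteq> {..<rank B}"
    using sectD(2)[OF assms(1) I(2)] sectD(2)[OF assms(2) I(3)] by blast
next
  fix t x assume "\<not> (t \<in> trivs B \<and> x \<in> V \<and> x \<in> fst t)"
  then show "sect_mult s s' t x = 0" using sectD(4)[OF assms(1), of t x] by (simp add: sect_mult_def)
qed

text \<open>The gluing property of the sheaf of sections. The local conditions say nothing about
  points outside \<open>V\<close>, where \<open>supp\<close> prescribes the value 0.\<close>

lemma sect_local:
  assumes supp: "\<And>t x. x \<notin> V \<Longrightarrow> s t x = 0"
    and loc: "\<And>x. x \<in> V \<Longrightarrow> \<exists>W. opn W \<and> x \<in> W \<and> W \<subseteq> V \<and> sect_res W s \<in> sect W"
  shows "s \<in> sect V"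
proof -
  obtain W where W: "\<And>x. x \<in> V \<Longrightarrow> opn (W x)" "\<And>x. x \<in> V \<Longrightarrow> x \<in> W x" "\<And>x. x \<in> V \<Longrightarrow> W x \<subseteq> V"
     "\<And>x. x \<in> V \<Longrightarrow> sect_res (W x) s \<in> sect (W x)"
    using loc by metis
  have eq: "sect_res (W x) s t x = s t x" if "x \<in> V" for t x
    using W(2)[OF that] by (simp add: sect_res_def)
  show ?thesis
  proof (rule sectI)
    fix t I assume t: "t \<in> trivs B"
    show "holo_on X (V \<inter> fst t) (\<lambda>x. s t x I)"
    proof (rule holo_on_local[OF manifold])
      fix x assume x: "x \<in> V \<inter> fst t"
      then have "x \<in> V" by simp
      note Wx = W[OF this]
      have "\<forall>y\<in>W x \<inter> fst t. sect_res (W x) s t y I = s t y I" by (simp add: sect_res_def)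
      then show "\<exists>T T' f. opn T \<and> x \<in> T \<and> T \<subseteq> V \<inter> fst t \<and> holo_on X T' f \<and> T \<subseteq> T' \<and> (\<forall>y\<in>T. f y = s t y I)"
        using Wx(2,3) x openin_Int[OF Wx(1) triv_open[OF t]] sectD(1)[OF Wx(4) t, of I]
        by (intro exI[of _ "W x \<inter> fst t"] exI[of _ "\<lambda>y. sect_res (W x) s t y I"] conjI) (assumption | blast)+
    qed
  next
    fix t x I assume "x \<in> V" "s t x I \<noteq> 0"
    then show "I \<subseteq> {..<rank B}" using sectD(2)[OF W(4), of x t x I] eq by simp
  next
    fix t t' x assume *: "t \<in> trivs B" "t' \<in> trivs B" "x \<in> V" "x \<in> fst t" "x \<in> fst t'"
    then show "s t x = ext_map (rank B) (transition B t t' x) (s t' x)"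
      using sectD(3)[OF W(4), of x t t' x] eq W(2) by simp
  next
    fix t x assume "\<not> (t \<in> trivs B \<and> x \<in> V \<and> x \<in> fst t)"
    then show "s t x = 0"
      using sectD(4)[OF W(4), of x t x] eq supp by (cases "x \<in> V") auto
  qed
qed

lemma sect_resI:
  assumes "s \<in> sect V" "opn W" "W \<subseteq> V" shows "sect_res W s \<in> sect W"
proof (rule sectI)
  fix t I assume t: "t \<in> trivs B"
  show "holo_on X (W \<inter> fst t) (\<lambda>x. sect_res W s t x I)"
  proof (rule holo_on_local[OF manifold])
    fix x assume x: "x \<in> W \<inter> fst t"
    have "\<forall>y\<in>W \<inter> fst t. s t y I = sect_res W s t y I" by (simp add: sect_res_def)
    then show "\<exists>T T' f. opn T \<and> x \<in> T \<and> T \<subseteq> W \<inter> fst t \<and> holo_on X T' f \<and> T \<subseteq> T' \<and>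
        (\<forall>y\<in>T. f y = sect_res W s t y I)"
      using x assms(3) openin_Int[OF assms(2) triv_open[OF t]] sectD(1)[OF assms(1) t, of I]
      by (intro exI[of _ "W \<inter> fst t"] exI[of _ "V \<inter> fst t"] exI[of _ "\<lambda>y. s t y I"] conjI)
        (assumption | blast)+
  qed
next
  fix t x I assume "sect_res W s t x I \<noteq> 0"
  then show "I \<subseteq> {..<rank B}" using sectD(2)[OF assms(1), of t x I] by (simp add: sect_res_def split: if_splits)
next
  fix t t' x assume *: "t \<in> trivs B" "t' \<in> trivs B" "x \<in> W" "x \<in> fst t" "x \<in> fst t'"
  then show "sect_res W s t x = ext_map (rank B) (transition B t t' x) (sect_res W s t' x)"
    using sectD(3)[OF assms(1), of t t' x] assms(3) by (auto simp: sect_res_def)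
next
  fix t x assume "\<not> (t \<in> trivs B \<and> x \<in> W \<and> x \<in> fst t)"
  then show "sect_res W s t x = 0"
    using sectD(4)[OF assms(1), of t x] by (auto simp: sect_res_def)
qed

lemma sect_res_self: "s \<in> sect V \<Longrightarrow> sect_res V s = s"
  using sectD(4) by (fastforce simp: sect_res_def fun_eq_iff)

lemma one_sect: assumes V: "opn V" shows "sect_one B V \<in> sect V"
proof (rule sectI)
  fix t I assume t: "t \<in> trivs B"
  show "holo_on X (V \<inter> fst t) (\<lambda>x. sect_one B V t x I)"
  proof (rule holo_on_local[OF manifold])
    fix x assume x: "x \<in> V \<inter> fst t"
    have "\<forall>y\<in>V \<inter> fst t. ext_one I = sect_one B V t y I" using t by (simp add: sect_one_def)
    then show "\<exists>T T' f. opn T \<and> x \<in> T \<and> T \<subseteq> V \<inter> fst t \<and> holo_on X T' f \<and> T \<subseteq> T' \<and>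
        (\<forall>y\<in>T. f y = sect_one B V t y I)"
      using x openin_Int[OF V triv_open[OF t]] holo_on_const
      by (intro exI[of _ "V \<inter> fst t"] exI[of _ "\<lambda>_. ext_one I"] conjI) (assumption | blast)+
  qed
next
  fix t x I assume "sect_one B V t x I \<noteq> 0"
  then show "I \<subseteq> {..<rank B}" by (auto simp: sect_one_def ext_one_def split: if_splits)
qed (auto simp: sect_one_def ext_map_one)

end

section \<open>Linear structure, products, restrictions and components of sections\<close>

lemma sect_res_res: "sect_res W (sect_res V s) = sect_res (W \<inter> V) s"
  by (auto simp: sect_res_def fun_eq_iff)

lemma sect_res_add: "sect_res W (s + s') = sect_res W s + sect_res W s'"
  and sect_res_zero [simp]: "sect_res W 0 = 0"
  and sect_res_scale: "sect_res W (sect_scale c s) = sect_scale c (sect_res W s)"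
  and sect_res_mult: "sect_res W (sect_mult s s') = sect_mult (sect_res W s) (sect_res W s')"
  and sect_res_comp: "sect_res W (sect_comp j s) = sect_comp j (sect_res W s)"
  by (auto simp: sect_res_def sect_scale_def sect_mult_def sect_comp_def fun_eq_iff)

lemma sect_res_sum: "sect_res W (sum f S) = (\<Sum>i\<in>S. sect_res W (f i))"
  using sum_comp_morphism[of "sect_res W" f S] by (simp add: sect_res_add comp_def)

lemma sect_comp_add: "sect_comp j (s + s') = sect_comp j s + sect_comp j s'"
  and sect_comp_zero [simp]: "sect_comp j 0 = 0"
  and sect_comp_scale: "sect_comp j (sect_scale c s) = sect_scale c (sect_comp j s)"
  and sect_comp_diff: "sect_comp j (s - s') = sect_comp j s - sect_comp j s'"
  and sect_comp_comp: "sect_comp i (sect_comp j s) = (if i = j then sect_comp j s else 0)"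
  by (auto simp: sect_scale_def sect_comp_def fun_eq_iff)

lemma sect_scale_add: "sect_scale c (s + s') = sect_scale c s + sect_scale c s'"
  and sect_scale_zero [simp]: "sect_scale c 0 = 0"
  and sect_scale_diff: "sect_scale c (s - s') = sect_scale c s - sect_scale c s'"
  and sect_scale_one [simp]: "sect_scale 1 s = s"
  and sect_scale_scale: "sect_scale c (sect_scale c' s) = sect_scale (c * c') s"
  and sect_scale_add_left: "sect_scale (c + c') s = sect_scale c s + sect_scale c' s"
  and sect_scale_zero_left [simp]: "sect_scale 0 s = 0"
  by (auto simp: sect_scale_def fun_eq_iff algebra_simps)

lemma sect_scale_sum: "sect_scale c (sum f S) = (\<Sum>i\<in>S. sect_scale c (f i))"
  using sum_comp_morphism[of "sect_scale c" f S] by (simp add: sect_scale_add comp_def)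

lemma sect_scale_sum_left: "sect_scale (sum c S) s = (\<Sum>i\<in>S. sect_scale (c i) s)"
  using sum_comp_morphism[of "\<lambda>c. sect_scale c s" c S] by (simp add: sect_scale_add_left comp_def)

lemma sect_mult_add_left: "sect_mult (s + s') x = sect_mult s x + sect_mult s' x"
  and sect_mult_add_right: "sect_mult x (s + s') = sect_mult x s + sect_mult x s'"
  and sect_mult_zero [simp]: "sect_mult 0 x = 0" "sect_mult x 0 = 0"
  and sect_mult_scale_left: "sect_mult (sect_scale c s) x = sect_scale c (sect_mult s x)"
  and sect_mult_scale_right: "sect_mult x (sect_scale c s) = sect_scale c (sect_mult x s)"
  by (auto simp: sect_mult_def sect_scale_def fun_eq_iff wedge_add_left wedge_add_right
      wedge_scale_left wedge_scale_right)

lemma sect_mult_sum_left: "sect_mult (sum f S) x = (\<Sum>i\<in>S. sect_mult (f i) x)"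
  using sum_comp_morphism[of "\<lambda>s. sect_mult s x" f S] by (simp add: sect_mult_add_left comp_def)

lemma sect_mult_sum_right: "sect_mult x (sum f S) = (\<Sum>i\<in>S. sect_mult x (f i))"
  using sum_comp_morphism[of "sect_mult x" f S] by (simp add: sect_mult_add_right comp_def)

lemma sect_mult_uminus: "sect_mult (- s) x = - sect_mult s x" "sect_mult x (- s) = - sect_mult x s"
  using sect_mult_add_left[of s "- s" x] sect_mult_add_right[of x s "- s"]
  by (simp_all add: eq_neg_iff_add_eq_0 add.commute)

lemma sect_mult_diff: "sect_mult (s - s') x = sect_mult s x - sect_mult s' x"
  "sect_mult x (s - s') = sect_mult x s - sect_mult x s'"
  using sect_mult_add_left[of s "- s'" x] sect_mult_add_right[of x s "- s'"]
  by (simp_all add: sect_mult_uminus)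

context ext_bundle
begin

section \<open>Graded sections\<close>

lemma gr_sect: "s \<in> gr P V \<Longrightarrow> s \<in> sect V"
  by (simp add: graded_sections_def)

lemma grD: "s \<in> gr P V \<Longrightarrow> s t x I \<noteq> 0 \<Longrightarrow> P (card I)"
  unfolding graded_sections_def by blast

lemma gr_mono: "s \<in> gr P V \<Longrightarrow> (\<And>j. P j \<Longrightarrow> Q j) \<Longrightarrow> s \<in> gr Q V"
  by (auto simp: graded_sections_def)

lemma gr_zero [simp]: "0 \<in> gr P V"
  by (auto simp: graded_sections_def)

lemma gr_add: "s \<in> gr P V \<Longrightarrow> s' \<in> gr P V \<Longrightarrow> s + s' \<in> gr P V"
  by (auto simp: graded_sections_def) (metis add.right_neutral)

lemma gr_scale: "s \<in> gr P V \<Longrightarrow> sect_scale c s \<in> gr P V"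
  by (auto simp: graded_sections_def sect_scale_def dest: sect_scaleI)

lemma gr_uminus: "s \<in> gr P V \<Longrightarrow> - s \<in> gr P V"
  unfolding sect_uminus_eq by (rule gr_scale)

lemma gr_diff: "s \<in> gr P V \<Longrightarrow> s' \<in> gr P V \<Longrightarrow> s - s' \<in> gr P V"
  using gr_add[of s P V "- s'"] gr_uminus by simp

lemma gr_sum: "(\<And>i. i \<in> S \<Longrightarrow> f i \<in> gr P V) \<Longrightarrow> sum f S \<in> gr P V"
  by (rule sum_induct_closed[where P = "\<lambda>s. s \<in> gr P V"]) (auto intro: gr_add)

text \<open>Turns a degree condition into equations, which can be checked on an open cover and
  combined with other degree conditions.\<close>

lemma gr_iff: "s \<in> gr P V \<longleftrightarrow> s \<in> sect V \<and> (\<forall>j. \<not> P j \<longrightarrow> sect_comp j s = 0)"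
  by (auto simp: graded_sections_def sect_comp_def fun_eq_iff)

lemma gr_comp: "s \<in> sect V \<Longrightarrow> P j \<Longrightarrow> sect_comp j s \<in> gr P V"
  by (auto simp: gr_iff sect_compI sect_comp_comp)

lemma gr_comp_self: "s \<in> gr (\<lambda>l. l = j) V \<Longrightarrow> sect_comp j s = s"
  by (auto simp: graded_sections_def sect_comp_def fun_eq_iff)

lemma gr_comp_eq_0: "s \<in> gr P V \<Longrightarrow> \<not> P j \<Longrightarrow> sect_comp j s = 0"
  by (simp add: gr_iff)

lemma sect_comp_large: "s \<in> sect V \<Longrightarrow> rank B < j \<Longrightarrow> sect_comp j s = 0"
  using sect_finite_support(2) by (fastforce simp: sect_comp_def fun_eq_iff)

lemma sect_decomp: assumes "s \<in> sect V" shows "s = (\<Sum>j\<le>rank B. sect_comp j s)"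
proof (intro ext)
  fix t x I
  have "(\<Sum>j\<le>rank B. sect_comp j s) t x I = (\<Sum>j\<le>rank B. if j = card I then s t x I else 0)"
    by (simp add: sum_fun_apply sect_comp_def eq_commute)
  also have "\<dots> = s t x I" using sect_finite_support(2)[OF assms, of t x I] by auto
  finally show "s t x I = (\<Sum>j\<le>rank B. sect_comp j s) t x I" ..
qed

lemma sect_eqI:
  assumes "s \<in> sect V" "s' \<in> sect V" "\<And>j. sect_comp j s = sect_comp j s'" shows "s = s'"
  using sect_decomp[OF assms(1)] sect_decomp[OF assms(2)] assms(3) by simp

lemma gr_mult:
  assumes "s \<in> gr P V" "s' \<in> gr Q V" "\<And>m n. P m \<Longrightarrow> Q n \<Longrightarrow> R (m + n)"
  shows "sect_mult s s' \<in> gr R V"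
  using assms sect_multI[of s V s'] unfolding graded_sections_def sect_mult_def
  by (auto elim!: wedge_nonzeroE)

text \<open>Degrees add in a product, so a left factor of degree \<open>i\<close> carries the
  component of degree \<open>m\<close> of the right factor to degree \<open>i + m\<close>. With its
  mirror image it transfers the Leibniz rule to homogeneous components.\<close>

lemma mult_comp_right:
  assumes "s \<in> gr (\<lambda>l. l = i) V"
  shows "sect_comp (i + m) (sect_mult s x) = sect_mult s (sect_comp m x)"
proof (intro ext)
  fix t y K
  have *: "(if card K = i + m then wedge_sign I (K - I) * s t y I * x t y (K - I) else 0)
     = wedge_sign I (K - I) * s t y I * (if card (K - I) = m then x t y (K - I) else 0)"
    if "I \<in> Pow K" "finite K" for I
  proof (cases "s t y I = 0")
    case False
    then have "card I = i" using grD[OF assms] by blast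
    moreover have "card K = card I + card (K - I)"
      using that by (metis PowD card_Un_disjoint Diff_disjoint Un_Diff_cancel finite_Diff finite_subset sup.absorb2)
    ultimately show ?thesis by simp
  qed simp
  show "sect_comp (i + m) (sect_mult s x) t y K = sect_mult s (sect_comp m x) t y K"
  proof (cases "finite K")
    case True
    then have "(\<Sum>I\<in>Pow K. if card K = i + m then wedge_sign I (K - I) * s t y I * x t y (K - I) else 0)
     = (\<Sum>I\<in>Pow K. wedge_sign I (K - I) * s t y I * (if card (K - I) = m then x t y (K - I) else 0))"
      by (intro sum.cong * refl)
    then show ?thesis by (auto simp: sect_comp_def sect_mult_def wedge_def)
  qed (simp add: sect_comp_def sect_mult_def wedge_infinite)
qed

lemma mult_comp_left:
  assumes "s \<in> gr (\<lambda>l. l = i) V"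
  shows "sect_comp (m + i) (sect_mult x s) = sect_mult (sect_comp m x) s"
proof (intro ext)
  fix t y K
  have *: "(if card K = m + i then wedge_sign I (K - I) * x t y I * s t y (K - I) else 0)
     = wedge_sign I (K - I) * (if card I = m then x t y I else 0) * s t y (K - I)"
    if "I \<in> Pow K" "finite K" for I
  proof (cases "s t y (K - I) = 0")
    case False
    then have "card (K - I) = i" using grD[OF assms] by blast
    moreover have "card K = card I + card (K - I)"
      using that by (metis PowD card_Un_disjoint Diff_disjoint Un_Diff_cancel finite_Diff finite_subset sup.absorb2)
    ultimately show ?thesis by simp
  qed simp
  show "sect_comp (m + i) (sect_mult x s) t y K = sect_mult (sect_comp m x) s t y K"
  proof (cases "finite K")
    case True
    then have "(\<Sum>I\<in>Pow K. if card K = m + i then wedge_sign I (K - I) * x t y I * s t y (K - I) else 0)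
     = (\<Sum>I\<in>Pow K. wedge_sign I (K - I) * (if card I = m then x t y I else 0) * s t y (K - I))"
      by (intro sum.cong * refl)
    then show ?thesis by (auto simp: sect_comp_def sect_mult_def wedge_def)
  qed (simp add: sect_comp_def sect_mult_def wedge_infinite)
qed

lemma mult_one_left: assumes "s \<in> sect V" shows "sect_mult (sect_one B V) s = s"
proof (intro ext)
  fix t x I
  have "s t x \<in> ext_homog (\<lambda>_. True)"
    using sect_finite_support[OF assms] by (auto simp: ext_homog_def)
  then show "sect_mult (sect_one B V) s t x I = s t x I"
    using sectD(4)[OF assms, of t x] by (auto simp: sect_mult_def sect_one_def wedge_ext_one_left)
qed

end

section \<open>Sheaf endomorphisms and their degree filtration\<close>

definition endo_scale :: "complex \<Rightarrow> ('m, 'e) endo \<Rightarrow> ('m, 'e) endo"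
  where "endo_scale c F = (\<lambda>V s. sect_scale c (F V s))"

text \<open>Sections are themselves functions; only sums of endomorphisms are to be evaluated.\<close>

declare plus_fun_apply [simp del] zero_fun_apply [simp del] minus_apply [simp del] uminus_apply [simp del]

lemma endo_zero_apply [simp]: "(0 :: ('m, 'e) endo) V s = 0"
  and sect_zero_apply [simp]: "(0 :: ('m, 'e) sect \<Rightarrow> ('m, 'e) sect) s = 0"
  and endo_add_apply [simp]: "((F :: ('m, 'e) endo) + G) V s = F V s + G V s"
  and endo_diff_apply [simp]: "((F :: ('m, 'e) endo) - G) V s = F V s - G V s"
  and endo_uminus_apply [simp]: "(- (F :: ('m, 'e) endo)) V s = - F V s"
  by (simp_all only: plus_fun_apply zero_fun_apply minus_apply uminus_apply)

lemma endo_sum_apply: "(\<Sum>i\<in>S. (f i :: ('m, 'e) endo)) V s = (\<Sum>i\<in>S. f i V s)"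
  by (simp only: sum_fun_apply)

lemma endo_eqI: "(\<And>V s. (F :: ('m, 'e) endo) V s = G V s) \<Longrightarrow> F = G"
  by (rule ext, rule ext)

lemma endo_comp_apply [simp]: "(F \<bullet>\<bullet> G) V s = F V (G V s)"
  by (simp add: endo_comp_def)

lemma endo_comp_assoc: "F \<bullet>\<bullet> G \<bullet>\<bullet> H = F \<bullet>\<bullet> (G \<bullet>\<bullet> H)"
  by (simp add: endo_comp_def)

lemma endo_comp_diff_left: "(F - G) \<bullet>\<bullet> H = F \<bullet>\<bullet> H - G \<bullet>\<bullet> H"
  by (rule endo_eqI) simp

lemma endo_comp_sum_left: "(\<Sum>i\<in>S. f i) \<bullet>\<bullet> H = (\<Sum>i\<in>S. f i \<bullet>\<bullet> H)"
  by (rule endo_eqI) (simp add: endo_sum_apply)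

lemma endo_comp_scale_left: "endo_scale c F \<bullet>\<bullet> H = endo_scale c (F \<bullet>\<bullet> H)"
  by (rule endo_eqI) (simp add: endo_scale_def)

lemma endo_scale_scale: "endo_scale c (endo_scale c' F) = endo_scale (c * c') F"
  by (rule endo_eqI) (simp add: endo_scale_def sect_scale_scale)

lemma endo_scale_diff: "endo_scale c (F - G) = endo_scale c F - endo_scale c G"
  by (rule endo_eqI) (simp add: endo_scale_def sect_scale_diff)

lemma endo_scale_sum_left: "endo_scale (sum c S) F = (\<Sum>i\<in>S. endo_scale (c i) F)"
  by (rule endo_eqI) (simp add: endo_scale_def sect_scale_sum_left endo_sum_apply)

lemma endo_scale_simps [simp]: "endo_scale 1 F = F" "endo_scale 0 F = 0"
  by (rule endo_eqI, simp add: endo_scale_def)+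

lemma endo_res_add: "endo_res W (F + G) = endo_res W F + endo_res W G"
  and endo_res_diff: "endo_res W (F - G) = endo_res W F - endo_res W G"
  and endo_res_uminus: "endo_res W (- F) = - endo_res W F"
  and endo_res_zero [simp]: "endo_res W 0 = 0"
  and endo_res_comp: "endo_res W (F \<bullet>\<bullet> G) = endo_res W F \<bullet>\<bullet> endo_res W G"
  and endo_res_res: "endo_res W (endo_res W' F) = endo_res (W \<inter> W') F"
  by (rule endo_eqI; simp add: endo_res_def)+

text \<open>The Cauchy product of two truncated exponential series: the terms beyond the diagonal
  vanish for degree reasons, so the square of indices shrinks to the triangle.\<close>

lemma sum_triangle:
  fixes x :: "nat \<Rightarrow> nat \<Rightarrow> 'c::comm_monoid_add"
  assumes "\<And>n m. r < n + m \<Longrightarrow> x n m = 0"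
  shows "(\<Sum>n\<le>r. \<Sum>m\<le>r. x n m) = (\<Sum>p\<le>r. \<Sum>n\<le>p. x n (p - n))"
proof -
  have "(\<Sum>n\<le>r. \<Sum>m\<le>r. x n m) = (\<Sum>(n, m)\<in>{..r} \<times> {..r}. x n m)"
    by (rule sum.cartesian_product)
  also have "\<dots> = (\<Sum>(n, m)\<in>{(n, m). n + m \<le> r}. x n m)"
    using assms by (intro sum.mono_neutral_right) (auto, meson not_le)
  also have "\<dots> = (\<Sum>p\<le>r. \<Sum>n\<le>p. x n (p - n))"
    by (rule sum.triangle_reindex_eq)
  finally show ?thesis .
qed

context ext_bundle
begin

section \<open>The algebra of sheaf endomorphisms\<close>

abbreviation "End U \<equiv> End_sheaf X B U"
abbreviation "Ident U \<equiv> endo_id X B U"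

lemma End_outside:
  assumes "F \<in> End U" "\<not> (opn V \<and> V \<subseteq> U \<and> s \<in> sect V)" shows "F V s = 0"
  using assms(1)[unfolded End_sheaf_def mem_Collect_eq, THEN conjunct1] assms(2) by blast

lemma End_outside_open: "F \<in> End U \<Longrightarrow> \<not> (opn V \<and> V \<subseteq> U) \<Longrightarrow> F V s = 0"
  using End_outside by blast

lemma End_inside:
  assumes "F \<in> End U" "opn V" "V \<subseteq> U"
  shows "\<forall>s \<in> sect V. F V s \<in> sect V"
    and "\<forall>s \<in> sect V. \<forall>s' \<in> sect V. F V (s + s') = F V s + F V s'"
    and "\<forall>s \<in> sect V. \<forall>c. F V (sect_scale c s) = sect_scale c (F V s)"
    and "\<forall>W. opn W \<and> W \<subseteq> V \<longrightarrow> (\<forall>s \<in> sect V. F W (sect_res W s) = sect_res W (F V s))"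
    and "F V ` gr even V \<subseteq> gr even V" and "F V ` gr odd V \<subseteq> gr odd V"
proof -
  note * = assms(1)[unfolded End_sheaf_def mem_Collect_eq, THEN conjunct2, THEN spec[of _ V],
      THEN mp, OF conjI, OF assms(2,3)]
  show "\<forall>s \<in> sect V. F V s \<in> sect V"
    using * by (rule conjunct1)
  show "\<forall>s \<in> sect V. \<forall>s' \<in> sect V. F V (s + s') = F V s + F V s'"
    using *[THEN conjunct2] by (rule conjunct1)
  show "\<forall>s \<in> sect V. \<forall>c. F V (sect_scale c s) = sect_scale c (F V s)"
    using *[THEN conjunct2, THEN conjunct2] by (rule conjunct1)
  show "\<forall>W. opn W \<and> W \<subseteq> V \<longrightarrow> (\<forall>s \<in> sect V. F W (sect_res W s) = sect_res W (F V s))"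
    using *[THEN conjunct2, THEN conjunct2, THEN conjunct2] by (rule conjunct1)
  show "F V ` gr even V \<subseteq> gr even V"
    using *[THEN conjunct2, THEN conjunct2, THEN conjunct2, THEN conjunct2] by (rule conjunct1)
  show "F V ` gr odd V \<subseteq> gr odd V"
    using *[THEN conjunct2, THEN conjunct2, THEN conjunct2, THEN conjunct2] by (rule conjunct2)
qed

text \<open>No condition on \<open>V\<close> or \<open>s\<close> is imposed: off its domain an
  endomorphism has the value 0, which is a section over every set. The next rules are freed of side
  conditions in the same way.\<close>

lemma End_sect: assumes "F \<in> End U" shows "F V s \<in> sect V"
proof (cases "opn V \<and> V \<subseteq> U \<and> s \<in> sect V")
  case True
  then show ?thesis using End_inside(1)[OF assms] by blast
next
  case False
  then show ?thesis using End_outside[OF assms False] by simp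
qed

lemma End_add:
  assumes "F \<in> End U" "s \<in> sect V" "s' \<in> sect V" shows "F V (s + s') = F V s + F V s'"
proof (cases "opn V \<and> V \<subseteq> U")
  case True
  then show ?thesis using End_inside(2)[OF assms(1), of V] assms(2,3) by blast
next
  case False
  then show ?thesis using End_outside_open[OF assms(1) False] by simp
qed

lemma End_scale:
  assumes "F \<in> End U" "s \<in> sect V" shows "F V (sect_scale c s) = sect_scale c (F V s)"
proof (cases "opn V \<and> V \<subseteq> U")
  case True
  then show ?thesis using End_inside(3)[OF assms(1), of V] assms(2) by blast
next
  case False
  then show ?thesis using End_outside_open[OF assms(1) False] by simp
qed

lemma End_res:
  assumes "F \<in> End U" "opn V" "V \<subseteq> U" "s \<in> sect V" "opn W" "W \<subseteq> V"
  shows "F W (sect_res W s) = sect_res W (F V s)"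
  using End_inside(4)[OF assms(1-3)] assms(4-6) by blast

lemma End_parity:
  assumes "F \<in> End U" "P = even \<or> P = odd" "s \<in> gr P V" shows "F V s \<in> gr P V"
proof (cases "opn V \<and> V \<subseteq> U")
  case True
  then show ?thesis using End_inside(5,6)[OF assms(1), of V] assms(2,3) by blast
next
  case False
  then show ?thesis using End_outside_open[OF assms(1) False] by simp
qed

lemma End_zero: "F \<in> End U \<Longrightarrow> F V 0 = 0"
  using End_scale[of F U 0 V 0] by simp

lemma End_uminus: "F \<in> End U \<Longrightarrow> s \<in> sect V \<Longrightarrow> F V (- s) = - F V s"
  unfolding sect_uminus_eq by (rule End_scale)

lemma End_diff: "F \<in> End U \<Longrightarrow> s \<in> sect V \<Longrightarrow> s' \<in> sect V \<Longrightarrow> F V (s - s') = F V s - F V s'"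
  using End_add[of F U s V "- s'"] End_uminus[of F U s' V] by auto

lemma End_sum:
  assumes "F \<in> End U" "\<And>i. i \<in> S \<Longrightarrow> f i \<in> sect V" shows "F V (sum f S) = (\<Sum>i\<in>S. F V (f i))"
proof -
  have "F V (sum f T) = (\<Sum>i\<in>T. F V (f i))" if "T \<subseteq> S" "finite T" for T
    using that(2,1)
  proof (induction T rule: finite_induct)
    case empty
    then show ?case using End_zero[OF assms(1)] by (simp only: sum.empty)
  next
    case (insert x T)
    then have "F V (f x + sum f T) = F V (f x) + F V (sum f T)"
      using assms by (intro End_add[OF assms(1)] sect_sumI) auto
    moreover have "F V (sum f T) = (\<Sum>i\<in>T. F V (f i))" using insert by blast
    ultimately show ?case by (simp only: sum.insert[OF insert(1,2)])
  qed
  then show ?thesis using End_zero[OF assms(1)] by (cases "finite S") auto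
qed

lemma EndI:
  assumes "\<And>V s. \<not> (opn V \<and> V \<subseteq> U \<and> s \<in> sect V) \<Longrightarrow> F V s = 0"
    and "\<And>V s. opn V \<Longrightarrow> V \<subseteq> U \<Longrightarrow> s \<in> sect V \<Longrightarrow> F V s \<in> sect V"
    and "\<And>V s s'. opn V \<Longrightarrow> V \<subseteq> U \<Longrightarrow> s \<in> sect V \<Longrightarrow> s' \<in> sect V \<Longrightarrow> F V (s + s') = F V s + F V s'"
    and "\<And>V s c. opn V \<Longrightarrow> V \<subseteq> U \<Longrightarrow> s \<in> sect V \<Longrightarrow> F V (sect_scale c s) = sect_scale c (F V s)"
    and "\<And>V W s. opn V \<Longrightarrow> V \<subseteq> U \<Longrightarrow> s \<in> sect V \<Longrightarrow> opn W \<Longrightarrow> W \<subseteq> V \<Longrightarrow>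
      F W (sect_res W s) = sect_res W (F V s)"
    and "\<And>V s P. opn V \<Longrightarrow> V \<subseteq> U \<Longrightarrow> P = even \<or> P = odd \<Longrightarrow> s \<in> gr P V \<Longrightarrow> F V s \<in> gr P V"
  shows "F \<in> End U"
proof -
  have par: "F V s \<in> gr even V" if "opn V" "V \<subseteq> U" "s \<in> gr even V" for V s
    using assms(6)[of V even s] that by simp
  have odd: "F V s \<in> gr odd V" if "opn V" "V \<subseteq> U" "s \<in> gr odd V" for V s
    using assms(6)[of V odd s] that by simp
  show ?thesis
    unfolding End_sheaf_def
    by (intro CollectI conjI allI impI ballI image_subsetI; (elim conjE)?;
      (rule assms(1) assms(2) assms(3) assms(4) assms(5) par odd; assumption))
qed

lemma End_eqI:
  assumes "F \<in> End U" "G \<in> End U"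
    and "\<And>V s. opn V \<Longrightarrow> V \<subseteq> U \<Longrightarrow> s \<in> sect V \<Longrightarrow> F V s = G V s"
  shows "F = G"
proof (rule endo_eqI)
  fix V s
  show "F V s = G V s"
  proof (cases "opn V \<and> V \<subseteq> U \<and> s \<in> sect V")
    case True
    then show ?thesis using assms(3) by blast
  next
    case False
    show ?thesis using End_outside[OF assms(1) False] End_outside[OF assms(2) False] by (rule trans[OF _ sym])
  qed
qed

lemma zero_End [simp]: "0 \<in> End U"
  by (rule EndI) auto

lemma add_End: assumes "F \<in> End U" "G \<in> End U" shows "F + G \<in> End U"
proof (rule EndI)
  fix V W s assume *: "opn V" "V \<subseteq> U" "s \<in> sect V" "opn W" "W \<subseteq> V"
  show "(F + G) W (sect_res W s) = sect_res W ((F + G) V s)"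
    using End_res[OF assms(1) *] End_res[OF assms(2) *] by (simp add: sect_res_add)
next
  fix V P s assume "P = even \<or> P = odd" "s \<in> gr P V"
  then show "(F + G) V s \<in> gr P V"
    using End_parity[OF assms(1)] End_parity[OF assms(2)] by (simp add: gr_add)
next
  fix V s assume "\<not> (opn V \<and> V \<subseteq> U \<and> s \<in> sect V)"
  then have "F V s = 0" "G V s = 0" using assms End_outside by blast+
  then show "(F + G) V s = 0" by simp
next
  fix V s show "(F + G) V s \<in> sect V" using assms by (simp add: End_sect sect_addI)
next
  fix V s s' assume "s \<in> sect V" "s' \<in> sect V"
  then show "(F + G) V (s + s') = (F + G) V s + (F + G) V s'"
    by (simp add: End_add[OF assms(1)] End_add[OF assms(2)])
next
  fix V s c assume "s \<in> sect V"
  then show "(F + G) V (sect_scale c s) = sect_scale c ((F + G) V s)"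
    by (simp add: End_scale[OF assms(1)] End_scale[OF assms(2)] sect_scale_add)
qed

lemma scale_End: assumes "F \<in> End U" shows "endo_scale c F \<in> End U"
proof (rule EndI)
  fix V W s assume *: "opn V" "V \<subseteq> U" "s \<in> sect V" "opn W" "W \<subseteq> V"
  show "endo_scale c F W (sect_res W s) = sect_res W (endo_scale c F V s)"
    using End_res[OF assms(1) *] by (simp add: endo_scale_def sect_res_scale)
next
  fix V P s assume "P = even \<or> P = odd" "s \<in> gr P V"
  then show "endo_scale c F V s \<in> gr P V"
    using End_parity[OF assms(1)] by (simp add: gr_scale endo_scale_def)
next
  fix V s assume "\<not> (opn V \<and> V \<subseteq> U \<and> s \<in> sect V)"
  then have "F V s = 0" using assms End_outside by blast
  then show "endo_scale c F V s = 0" by (simp add: endo_scale_def)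
next
  fix V s show "endo_scale c F V s \<in> sect V" using assms by (simp add: End_sect sect_scaleI endo_scale_def)
next
  fix V s s' assume "s \<in> sect V" "s' \<in> sect V"
  then show "endo_scale c F V (s + s') = endo_scale c F V s + endo_scale c F V s'"
    by (simp add: End_add[OF assms] endo_scale_def sect_scale_add)
next
  fix V s a assume "s \<in> sect V"
  then show "endo_scale c F V (sect_scale a s) = sect_scale a (endo_scale c F V s)"
    by (simp add: End_scale[OF assms] endo_scale_def sect_scale_scale mult.commute)
qed

lemma endo_uminus_eq: "- F = endo_scale (- 1) F"
  by (rule endo_eqI) (simp add: endo_scale_def sect_uminus_eq)

lemma uminus_End: "F \<in> End U \<Longrightarrow> - F \<in> End U"
  unfolding endo_uminus_eq by (rule scale_End)

lemma diff_End: "F \<in> End U \<Longrightarrow> G \<in> End U \<Longrightarrow> F - G \<in> End U"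
  using add_End[of F U "- G"] uminus_End by simp

lemma sum_End: "(\<And>i. i \<in> S \<Longrightarrow> f i \<in> End U) \<Longrightarrow> sum f S \<in> End U"
  by (rule sum_induct_closed[where P = "\<lambda>F. F \<in> End U"]) (auto intro: add_End)

lemma comp_End: assumes "F \<in> End U" "G \<in> End U" shows "F \<bullet>\<bullet> G \<in> End U"
proof (rule EndI)
  fix V W s assume *: "opn V" "V \<subseteq> U" "s \<in> sect V" "opn W" "W \<subseteq> V"
  show "(F \<bullet>\<bullet> G) W (sect_res W s) = sect_res W ((F \<bullet>\<bullet> G) V s)"
    using End_res[OF assms(1) *(1,2) End_sect[OF assms(2)] *(4,5)] End_res[OF assms(2) *] by simp
next
  fix V s assume "\<not> (opn V \<and> V \<subseteq> U \<and> s \<in> sect V)"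
  then have "G V s = 0" using assms End_outside by blast
  then show "(F \<bullet>\<bullet> G) V s = 0" by (simp only: endo_comp_apply End_zero[OF assms(1)])
next
  fix V s show "(F \<bullet>\<bullet> G) V s \<in> sect V" using assms by (simp add: End_sect)
next
  fix V s s' assume "s \<in> sect V" "s' \<in> sect V"
  then show "(F \<bullet>\<bullet> G) V (s + s') = (F \<bullet>\<bullet> G) V s + (F \<bullet>\<bullet> G) V s'"
    by (simp add: End_add[OF assms(1)] End_add[OF assms(2)] End_sect[OF assms(2)])
next
  fix V s a assume "s \<in> sect V"
  then show "(F \<bullet>\<bullet> G) V (sect_scale a s) = sect_scale a ((F \<bullet>\<bullet> G) V s)"
    by (simp add: End_scale[OF assms(1)] End_scale[OF assms(2)] End_sect[OF assms(2)])
next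
  fix V P s assume "P = even \<or> P = odd" "s \<in> gr P V"
  then show "(F \<bullet>\<bullet> G) V s \<in> gr P V"
    using End_parity[OF assms(1)] End_parity[OF assms(2)] by simp
qed

lemma Id_apply: "opn V \<Longrightarrow> V \<subseteq> U \<Longrightarrow> s \<in> sect V \<Longrightarrow> Ident U V s = s"
  by (simp add: endo_id_def)

lemma Id_End [simp]: "Ident U \<in> End U"
proof (rule EndI)
  fix V W s assume *: "opn V" "V \<subseteq> U" "s \<in> sect V" "opn W" "W \<subseteq> V"
  then show "Ident U W (sect_res W s) = sect_res W (Ident U V s)"
    using sect_resI[OF *(3-5)] by (simp add: endo_id_def)
qed (auto simp: endo_id_def sect_scaleI sect_addI gr_sect)

lemma res_End: assumes "F \<in> End U" "W \<subseteq> U" shows "endo_res W F \<in> End W"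
proof (rule EndI)
  fix V T s assume *: "opn V" "V \<subseteq> W" "s \<in> sect V" "opn T" "T \<subseteq> V"
  then show "endo_res W F T (sect_res T s) = sect_res T (endo_res W F V s)"
    using End_res[OF assms(1) *(1) _ *(3-5)] assms(2) by (auto simp: endo_res_def)
next
  fix V s assume "\<not> (opn V \<and> V \<subseteq> W \<and> s \<in> sect V)"
  then have "V \<subseteq> W \<Longrightarrow> F V s = 0" using assms End_outside by blast
  then show "endo_res W F V s = 0" by (simp add: endo_res_def)
next
  fix V s show "endo_res W F V s \<in> sect V" using assms by (simp add: End_sect endo_res_def)
next
  fix V s s' assume "s \<in> sect V" "s' \<in> sect V"
  then show "endo_res W F V (s + s') = endo_res W F V s + endo_res W F V s'"
    by (simp add: End_add[OF assms(1)] endo_res_def)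
next
  fix V s a assume "s \<in> sect V"
  then show "endo_res W F V (sect_scale a s) = sect_scale a (endo_res W F V s)"
    by (simp add: End_scale[OF assms(1)] endo_res_def)
next
  fix V P s assume "P = even \<or> P = odd" "s \<in> gr P V"
  then show "endo_res W F V s \<in> gr P V"
    using End_parity[OF assms(1)] by (simp add: endo_res_def)
qed

lemma res_self: assumes "F \<in> End U" shows "endo_res U F = F"
  by (rule End_eqI[OF res_End[OF assms subset_refl] assms]) (simp add: endo_res_def)

text \<open>These are equalities of functions, also off the domain, because \<open>Ident U\<close>
  vanishes there like every endomorphism over \<open>U\<close>.\<close>

lemma comp_Id: assumes "F \<in> End U" shows "F \<bullet>\<bullet> Ident U = F" "Ident U \<bullet>\<bullet> F = F"
  by (rule End_eqI[OF comp_End[OF assms Id_End] assms], simp add: Id_apply)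
    (rule End_eqI[OF comp_End[OF Id_End assms] assms], simp add: Id_apply End_sect[OF assms])

lemma endo_comp_diff_right:
  assumes "F \<in> End U" "G \<in> End U'" "H \<in> End U''" shows "F \<bullet>\<bullet> (G - H) = F \<bullet>\<bullet> G - F \<bullet>\<bullet> H"
  by (rule endo_eqI) (simp add: End_diff[OF assms(1)] End_sect[OF assms(2)] End_sect[OF assms(3)])

lemma endo_comp_sum_right:
  assumes "F \<in> End U" "\<And>i. i \<in> S \<Longrightarrow> f i \<in> End U" shows "F \<bullet>\<bullet> sum f S = (\<Sum>i\<in>S. F \<bullet>\<bullet> f i)"
proof (rule endo_eqI)
  fix V s
  have "F V (\<Sum>i\<in>S. f i V s) = (\<Sum>i\<in>S. F V (f i V s))"
    using assms by (intro End_sum) (auto intro: End_sect)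
  then show "(F \<bullet>\<bullet> sum f S) V s = (\<Sum>i\<in>S. F \<bullet>\<bullet> f i) V s"
    by (simp only: endo_sum_apply endo_comp_apply)
qed

lemma endo_comp_scale_right:
  assumes "F \<in> End U" "G \<in> End U'" shows "F \<bullet>\<bullet> endo_scale c G = endo_scale c (F \<bullet>\<bullet> G)"
  by (rule endo_eqI) (simp add: endo_scale_def End_scale[OF assms(1)] End_sect[OF assms(2)])

section \<open>The filtration by raised degree\<close>

definition Fil :: "nat \<Rightarrow> 'm set \<Rightarrow> ('m, 'e) endo set"
  where "Fil d U = {F \<in> End U. \<forall>V m. F V ` gr (\<lambda>l. m \<le> l) V \<subseteq> gr (\<lambda>l. m + d \<le> l) V}"

lemma Fil_End: "F \<in> Fil d U \<Longrightarrow> F \<in> End U"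
  by (simp add: Fil_def)

lemma FilD: "F \<in> Fil d U \<Longrightarrow> s \<in> gr (\<lambda>l. m \<le> l) V \<Longrightarrow> F V s \<in> gr (\<lambda>l. m + d \<le> l) V"
  by (auto simp: Fil_def)

lemma FilI: "F \<in> End U \<Longrightarrow> (\<And>V m s. s \<in> gr (\<lambda>l. m \<le> l) V \<Longrightarrow> F V s \<in> gr (\<lambda>l. m + d \<le> l) V) \<Longrightarrow> F \<in> Fil d U"
  by (auto simp: Fil_def)

text \<open>\<open>Fil\<close> speaks of lower bounds for degrees, a form stable under composition;
  by additivity it suffices to test homogeneous sections.\<close>

lemma Fil_homogI:
  assumes F: "F \<in> End U"
    and hom: "\<And>V j s. opn V \<Longrightarrow> V \<subseteq> U \<Longrightarrow> s \<in> gr (\<lambda>l. l = j) V \<Longrightarrow> F V s \<in> gr (\<lambda>l. j + d \<le> l) V"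
  shows "F \<in> Fil d U"
proof (rule FilI[OF F])
  fix V m s assume s: "s \<in> gr (\<lambda>l. m \<le> l) V"
  show "F V s \<in> gr (\<lambda>l. m + d \<le> l) V"
  proof (cases "opn V \<and> V \<subseteq> U")
    case True
    have "F V s = F V (\<Sum>j\<le>rank B. sect_comp j s)"
      using sect_decomp[OF gr_sect[OF s]] by simp
    also have "\<dots> = (\<Sum>j\<le>rank B. F V (sect_comp j s))"
      using gr_sect[OF s] by (intro End_sum[OF F] sect_compI)
    also have "\<dots> \<in> gr (\<lambda>l. m + d \<le> l) V"
    proof (rule gr_sum)
      fix j
      show "F V (sect_comp j s) \<in> gr (\<lambda>l. m + d \<le> l) V"
      proof (cases "m \<le> j")
        case True
        have "F V (sect_comp j s) \<in> gr (\<lambda>l. j + d \<le> l) V"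
          using \<open>opn V \<and> V \<subseteq> U\<close> gr_sect[OF s] by (intro hom gr_comp) auto
        then show ?thesis by (rule gr_mono) (use True in simp)
      next
        case False
        then show ?thesis using gr_comp_eq_0[OF s] End_zero[OF F] by simp
      qed
    qed
    finally show ?thesis .
  next
    case False
    then show ?thesis using End_outside_open[OF F False] by simp
  qed
qed

lemma Fil_mono: "F \<in> Fil d U \<Longrightarrow> d' \<le> d \<Longrightarrow> F \<in> Fil d' U"
  by (rule FilI[OF Fil_End]) (auto dest!: FilD intro: gr_mono)

lemma Fil_zero [simp]: "0 \<in> Fil d U"
  by (rule FilI) auto

lemma Fil_add: "F \<in> Fil d U \<Longrightarrow> G \<in> Fil d U \<Longrightarrow> F + G \<in> Fil d U"
  by (rule FilI) (auto simp: Fil_End add_End gr_add FilD)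

lemma Fil_scale: "F \<in> Fil d U \<Longrightarrow> endo_scale c F \<in> Fil d U"
proof (rule FilI)
  assume "F \<in> Fil d U"
  then show "endo_scale c F \<in> End U" by (intro scale_End Fil_End)
next
  fix V m s assume "F \<in> Fil d U" "s \<in> gr (\<lambda>l. m \<le> l) V"
  then show "endo_scale c F V s \<in> gr (\<lambda>l. m + d \<le> l) V"
    unfolding endo_scale_def by (intro gr_scale FilD)
qed

lemma Fil_uminus: "F \<in> Fil d U \<Longrightarrow> - F \<in> Fil d U"
  unfolding endo_uminus_eq by (rule Fil_scale)

lemma Fil_diff: "F \<in> Fil d U \<Longrightarrow> G \<in> Fil d U \<Longrightarrow> F - G \<in> Fil d U"
  using Fil_add[of F d U "- G"] Fil_uminus by simp

lemma Fil_sum: "(\<And>i. i \<in> S \<Longrightarrow> f i \<in> Fil d U) \<Longrightarrow> sum f S \<in> Fil d U"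
  by (rule sum_induct_closed[where P = "\<lambda>F. F \<in> Fil d U"]) (auto intro: Fil_add)

lemma Fil_comp: assumes "F \<in> Fil d U" "G \<in> Fil e U" shows "F \<bullet>\<bullet> G \<in> Fil (d + e) U"
proof (rule FilI)
  fix V m s assume "s \<in> gr (\<lambda>l. m \<le> l) V"
  then have "F V (G V s) \<in> gr (\<lambda>l. m + e + d \<le> l) V" using assms by (intro FilD)
  then show "(F \<bullet>\<bullet> G) V s \<in> gr (\<lambda>l. m + (d + e) \<le> l) V" by (simp add: ac_simps)
qed (use assms in \<open>simp add: comp_End Fil_End\<close>)

lemma Fil_Id [simp]: "Ident U \<in> Fil 0 U"
  by (rule FilI[OF Id_End]) (simp add: endo_id_def)

lemma Fil_res: assumes "F \<in> Fil d U" "W \<subseteq> U" shows "endo_res W F \<in> Fil d W"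
  by (rule FilI[OF res_End[OF Fil_End[OF assms(1)] assms(2)]])
    (use assms in \<open>auto simp: endo_res_def FilD\<close>)

text \<open>Parity excludes the degree \<open>j + d\<close> for odd \<open>d\<close>, so an odd
  bound improves by one at once. Only even filtration degrees matter from here on.\<close>

lemma Fil_parity: assumes F: "F \<in> Fil d U" and "odd d" shows "F \<in> Fil (Suc d) U"
proof (rule Fil_homogI[OF Fil_End[OF F]])
  fix V j s assume s: "s \<in> gr (\<lambda>l. l = j) V"
  define P where "P = (if even j then even else (odd :: nat \<Rightarrow> bool))"
  have "s \<in> gr P V" using s by (rule gr_mono) (simp add: P_def)
  then have "F V s \<in> gr P V" using End_parity[OF Fil_End[OF F]] by (simp add: P_def)
  moreover have "F V s \<in> gr (\<lambda>l. j + d \<le> l) V"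
    using s by (intro FilD[OF F] gr_mono[OF s]) auto
  moreover have "j + Suc d \<le> l" if "P l" "j + d \<le> l" for l
    using that \<open>odd d\<close> by (cases "l = j + d") (auto simp: P_def split: if_splits)
  ultimately show "F V s \<in> gr (\<lambda>l. j + Suc d \<le> l) V" unfolding gr_iff by blast
qed

text \<open>The degrees of a section lie between 0 and \<open>rank B\<close>. Every argument by
  increasing degree ends here.\<close>

lemma Fil_large: assumes F: "F \<in> Fil d U" and "rank B < d" shows "F = 0"
proof (rule endo_eqI)
  fix V s
  show "F V s = 0 V s"
  proof (cases "s \<in> sect V")
    case True
    then have "F V s \<in> gr (\<lambda>l. 0 + d \<le> l) V" by (intro FilD[OF F]) (simp add: gr_iff)
    then have "sect_comp j (F V s) = sect_comp j 0" for j
      using sect_comp_large[OF End_sect[OF Fil_End[OF F]], of j] \<open>rank B < d\<close> gr_comp_eq_0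
      by (cases "d \<le> j") auto
    then have "F V s = 0" by (intro sect_eqI[OF End_sect[OF Fil_End[OF F]] zero_sect])
    then show ?thesis by simp
  qed (use End_outside[OF Fil_End[OF F]] in auto)
qed

section \<open>Homogeneous components of endomorphisms\<close>

abbreviation "prj d F \<equiv> pr X B d F"

lemma pr_homog:
  assumes F: "F \<in> End U" and s: "s \<in> gr (\<lambda>l. l = j) V"
  shows "prj d F V s = sect_comp (j + d) (F V s)"
proof (cases "j \<le> rank B")
  case True
  have "(\<Sum>i\<le>rank B. sect_comp (i + d) (F V (sect_comp i s)))
    = (\<Sum>i\<le>rank B. if i = j then sect_comp (i + d) (F V s) else 0)"
    using s End_zero[OF F] by (intro sum.cong) (auto simp: gr_comp_self gr_comp_eq_0)
  then show ?thesis using True gr_sect[OF s] by (simp add: pr_def)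
next
  case False
  then have "s = 0" using gr_comp_self[OF s] sect_comp_large[OF gr_sect[OF s], of j] by simp
  then show ?thesis using End_zero[OF F] by (simp add: pr_def)
qed

lemma pr_add: "prj d (F + G) = prj d F + prj d G"
  by (rule endo_eqI) (simp add: pr_def sect_comp_add sum.distrib)

lemma pr_zero [simp]: "prj d 0 = 0"
  by (rule endo_eqI) (simp add: pr_def)

lemma pr_uminus: "prj d (- F) = - prj d F"
  using pr_add[of d F "- F"] by (simp add: eq_neg_iff_add_eq_0 add.commute)

lemma pr_diff: "prj d (F - G) = prj d F - prj d G"
  using pr_add[of d F "- G"] by (simp add: pr_uminus)

lemma pr_sum: "prj d (sum f S) = (\<Sum>i\<in>S. prj d (f i))"
  using sum_comp_morphism[of "prj d" f S] by (simp add: pr_add comp_def)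

lemma pr_res: "prj d (endo_res W F) = endo_res W (prj d F)"
  by (rule endo_eqI) (simp add: pr_def endo_res_def)

lemma pr_End: assumes F: "F \<in> End U" shows "prj d F \<in> End U"
proof (rule EndI)
  fix V s assume "\<not> (opn V \<and> V \<subseteq> U \<and> s \<in> sect V)"
  then show "prj d F V s = 0"
  proof (cases "s \<in> sect V")
    case True
    then have "F V s' = 0" for s' using \<open>\<not> _\<close> End_outside_open[OF F] by blast
    then show ?thesis by (simp add: pr_def)
  qed (simp add: pr_def)
next
  fix V s assume "opn V" "V \<subseteq> U" "s \<in> sect V"
  then show "prj d F V s \<in> sect V"
    by (auto simp: pr_def intro!: sect_sumI sect_compI End_sect[OF F])
next
  fix V s s' assume *: "opn V" "V \<subseteq> U" "s \<in> sect V" "s' \<in> sect V"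
  then show "prj d F V (s + s') = prj d F V s + prj d F V s'"
    by (simp add: pr_def sect_addI sect_comp_add End_add[OF F] sect_compI sum.distrib)
next
  fix V s c assume *: "opn V" "V \<subseteq> U" "s \<in> sect V"
  then show "prj d F V (sect_scale c s) = sect_scale c (prj d F V s)"
    by (simp add: pr_def sect_scaleI sect_comp_scale End_scale[OF F] sect_compI sect_scale_sum)
next
  fix V W s assume *: "opn V" "V \<subseteq> U" "s \<in> sect V" "opn W" "W \<subseteq> V"
  have "F W (sect_res W (sect_comp i s)) = sect_res W (F V (sect_comp i s))" for i
    using * by (intro End_res[OF F] sect_compI)
  then show "prj d F W (sect_res W s) = sect_res W (prj d F V s)"
    using * sect_resI[OF *(3-5)]
    by (simp add: pr_def sect_res_sum sect_res_comp)
next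
  fix V P s assume *: "opn V" "V \<subseteq> U" "P = even \<or> P = odd" "s \<in> gr P V"
  have "sect_comp (j + d) (F V (sect_comp j s)) \<in> gr P V" for j
  proof -
    have "sect_comp j s \<in> gr P V"
      using *(4) by (cases "P j") (auto simp: gr_comp gr_sect gr_comp_eq_0)
    then have "F V (sect_comp j s) \<in> gr P V" by (rule End_parity[OF F *(3)])
    then show ?thesis by (cases "P (j + d)") (auto simp: gr_comp gr_sect gr_comp_eq_0)
  qed
  then show "prj d F V s \<in> gr P V" using *(4) by (auto simp: pr_def gr_sect intro: gr_sum)
qed

lemma End_degD:
  assumes "F \<in> End_deg X B d U" shows "F \<in> End U" "s \<in> gr (\<lambda>l. l = j) V \<Longrightarrow> F V s \<in> gr (\<lambda>l. l = j + d) V"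
proof -
  show F: "F \<in> End U" using assms by (simp add: End_deg_def)
  assume s: "s \<in> gr (\<lambda>l. l = j) V"
  show "F V s \<in> gr (\<lambda>l. l = j + d) V"
  proof (cases "opn V \<and> V \<subseteq> U")
    case True
    then show ?thesis using assms s unfolding End_deg_def by blast
  next
    case False
    then show ?thesis using End_outside_open[OF F False] by simp
  qed
qed

lemma pr_End_deg: assumes "F \<in> End U" shows "prj d F \<in> End_deg X B d U"
  unfolding End_deg_def
proof (intro CollectI conjI allI impI image_subsetI)
  fix V j s assume "s \<in> gr (\<lambda>l. l = j) V"
  then show "prj d F V s \<in> gr (\<lambda>l. l = j + d) V"
    by (simp add: pr_homog[OF assms] gr_comp End_sect[OF assms])
qed (rule pr_End[OF assms])

lemma End_deg_Fil: "F \<in> End_deg X B d U \<Longrightarrow> F \<in> Fil d U"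
  by (rule Fil_homogI) (auto dest: End_degD intro: gr_mono[OF End_degD(2)])

lemma End_eq_homogI:
  assumes F: "F \<in> End U" and G: "G \<in> End U"
    and hom: "\<And>V j s. opn V \<Longrightarrow> V \<subseteq> U \<Longrightarrow> s \<in> gr (\<lambda>l. l = j) V \<Longrightarrow> F V s = G V s"
  shows "F = G"
proof (rule End_eqI[OF F G])
  fix V s assume V: "opn V" "V \<subseteq> U" and s: "s \<in> sect V"
  have "F V (\<Sum>j\<le>rank B. sect_comp j s) = (\<Sum>j\<le>rank B. F V (sect_comp j s))"
    by (intro End_sum[OF F] sect_compI s)
  also have "\<dots> = (\<Sum>j\<le>rank B. G V (sect_comp j s))"
    using V s by (intro sum.cong refl hom gr_comp) auto
  also have "\<dots> = G V (\<Sum>j\<le>rank B. sect_comp j s)"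
    by (intro End_sum[OF G, symmetric] sect_compI s)
  finally show "F V s = G V s" using sect_decomp[OF s] by simp
qed

lemma pr_Fil_eq_0: assumes F: "F \<in> Fil e U" and "d < e" shows "prj d F = 0"
proof (rule End_eq_homogI[OF pr_End[OF Fil_End[OF F]] zero_End])
  fix V j s assume s: "s \<in> gr (\<lambda>l. l = j) V"
  then have "F V s \<in> gr (\<lambda>l. j + e \<le> l) V" by (intro FilD[OF F] gr_mono[OF s]) auto
  then show "prj d F V s = 0 V s"
    using \<open>d < e\<close> by (simp add: pr_homog[OF Fil_End[OF F] s] gr_comp_eq_0)
qed

lemma pr_deg_self: assumes F: "F \<in> End_deg X B d U" shows "prj d F = F"
proof (rule End_eq_homogI[OF pr_End[OF End_degD(1)[OF F]] End_degD(1)[OF F]])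
  fix V j s assume s: "s \<in> gr (\<lambda>l. l = j) V"
  show "prj d F V s = F V s"
    using gr_comp_self[OF End_degD(2)[OF F s]] pr_homog[OF End_degD(1)[OF F] s] by simp
qed

lemma pr_deg_other: assumes F: "F \<in> End_deg X B e U" and "d \<noteq> e" shows "prj d F = 0"
proof (rule End_eq_homogI[OF pr_End[OF End_degD(1)[OF F]] zero_End])
  fix V j s assume s: "s \<in> gr (\<lambda>l. l = j) V"
  have "sect_comp (j + d) (F V s) = 0"
    using \<open>d \<noteq> e\<close> by (intro gr_comp_eq_0[OF End_degD(2)[OF F s]]) simp
  then show "prj d F V s = 0 V s"
    using pr_homog[OF End_degD(1)[OF F] s] by simp
qed

lemma pr_Id: assumes "0 < d" shows "prj d (Ident U) = 0"
proof (rule End_eq_homogI[OF pr_End[OF Id_End] zero_End])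
  fix V j s assume "opn V" "V \<subseteq> U" and s: "s \<in> gr (\<lambda>l. l = j) V"
  then show "prj d (Ident U) V s = 0 V s"
    using \<open>0 < d\<close> by (simp add: pr_homog[OF Id_End s] Id_apply gr_sect gr_comp_eq_0)
qed

text \<open>On a section of degree \<open>j\<close> the value has degrees at least
  \<open>j + d\<close>, and subtracting the component of \<open>F\<close> of degree \<open>d\<close>
  removes exactly the lowest of them.\<close>

lemma Fil_diff_pr:
  assumes F: "F \<in> Fil d U" shows "F - prj d F \<in> Fil (Suc d) U"
proof (rule Fil_homogI[OF diff_End[OF Fil_End[OF F] pr_End[OF Fil_End[OF F]]]])
  fix V j s assume s: "s \<in> gr (\<lambda>l. l = j) V"
  have F': "F V s \<in> gr (\<lambda>l. j + d \<le> l) V" by (intro FilD[OF F] gr_mono[OF s]) auto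
  show "(F - prj d F) V s \<in> gr (\<lambda>l. j + Suc d \<le> l) V"
    unfolding gr_iff
  proof (intro conjI allI impI)
    show "(F - prj d F) V s \<in> sect V"
      by (intro End_sect[OF diff_End[OF Fil_End[OF F] pr_End[OF Fil_End[OF F]]]])
    fix i assume "\<not> j + Suc d \<le> i"
    then show "sect_comp i ((F - prj d F) V s) = 0"
      by (cases "i = j + d")
        (simp_all add: pr_homog[OF Fil_End[OF F] s] sect_comp_diff sect_comp_comp gr_comp_eq_0[OF F'])
  qed
qed

lemma Fil_step:
  assumes F: "F \<in> Fil d U" and "even d" shows "F - prj d F \<in> Fil (d + 2) U"
  using Fil_parity[OF Fil_diff_pr[OF F]] \<open>even d\<close> by simp

text \<open>The component of degree \<open>d\<close> is the only obstruction to ascending by two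
  steps of the filtration.\<close>

lemma Fil_step_iff:
  assumes F: "F \<in> Fil d U" and "even d" shows "F \<in> Fil (d + 2) U \<longleftrightarrow> prj d F = 0"
  using Fil_step[OF assms] pr_Fil_eq_0[of F "d + 2" U d] by auto

end

section \<open>Derivations and their exponentials\<close>

context ext_bundle
begin

section \<open>Derivations and their components\<close>

abbreviation "Der U \<equiv> Der_sheaf X B U"

lemma Der_End: "D \<in> Der U \<Longrightarrow> D \<in> End U"
  by (simp add: Der_sheaf_def)

lemma Der_mult:
  assumes "D \<in> Der U" "opn V" "V \<subseteq> U" "s \<in> sect V" "s' \<in> sect V"
  shows "D V (sect_mult s s') = sect_mult (D V s) s' + sect_mult s (D V s')"
  using assms unfolding Der_sheaf_def by blast

lemma DerI:
  assumes "D \<in> End U"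
    and "\<And>V s s'. opn V \<Longrightarrow> V \<subseteq> U \<Longrightarrow> s \<in> sect V \<Longrightarrow> s' \<in> sect V \<Longrightarrow>
      D V (sect_mult s s') = sect_mult (D V s) s' + sect_mult s (D V s')"
  shows "D \<in> Der U"
  using assms unfolding Der_sheaf_def by blast

lemma Der_zero [simp]: "0 \<in> Der U"
  by (rule DerI) simp_all

lemma Der_add: assumes "D \<in> Der U" "D' \<in> Der U" shows "D + D' \<in> Der U"
proof (rule DerI[OF add_End[OF assms[THEN Der_End]]])
  fix V s s' assume *: "opn V" "V \<subseteq> U" "s \<in> sect V" "s' \<in> sect V"
  show "(D + D') V (sect_mult s s') = sect_mult ((D + D') V s) s' + sect_mult s ((D + D') V s')"
    by (simp add: Der_mult[OF assms(1) *] Der_mult[OF assms(2) *] sect_mult_add_left sect_mult_add_right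
        add_ac)
qed

lemma Der_uminus: assumes "D \<in> Der U" shows "- D \<in> Der U"
proof (rule DerI[OF uminus_End[OF Der_End[OF assms]]])
  fix V s s' assume *: "opn V" "V \<subseteq> U" "s \<in> sect V" "s' \<in> sect V"
  show "(- D) V (sect_mult s s') = sect_mult ((- D) V s) s' + sect_mult s ((- D) V s')"
    by (simp add: Der_mult[OF assms(1) *] sect_mult_uminus)
qed

lemma Der_diff: "D \<in> Der U \<Longrightarrow> D' \<in> Der U \<Longrightarrow> D - D' \<in> Der U"
  using Der_add[of D U "- D'"] Der_uminus by simp

lemma Der_sum: "(\<And>i. i \<in> S \<Longrightarrow> f i \<in> Der U) \<Longrightarrow> sum f S \<in> Der U"
  by (rule sum_induct_closed[where P = "\<lambda>F. F \<in> Der U"]) (auto intro: Der_add)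

lemma Der_res: assumes "D \<in> Der U" "W \<subseteq> U" shows "endo_res W D \<in> Der W"
proof (rule DerI[OF res_End[OF Der_End[OF assms(1)] assms(2)]])
  fix V s s' assume *: "opn V" "V \<subseteq> W" "s \<in> sect V" "s' \<in> sect V"
  then have "V \<subseteq> U" using assms(2) by blast
  then show "endo_res W D V (sect_mult s s') = sect_mult (endo_res W D V s) s' + sect_mult s (endo_res W D V s')"
    using * by (simp add: endo_res_def Der_mult[OF assms(1)])
qed

lemma Der_homogI:
  assumes D: "D \<in> End U"
    and hom: "\<And>V s s' i j. opn V \<Longrightarrow> V \<subseteq> U \<Longrightarrow> s \<in> gr (\<lambda>l. l = i) V \<Longrightarrow> s' \<in> gr (\<lambda>l. l = j) V \<Longrightarrow>
      D V (sect_mult s s') = sect_mult (D V s) s' + sect_mult s (D V s')"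
  shows "D \<in> Der U"
proof (rule DerI[OF D])
  fix V s s' assume *: "opn V" "V \<subseteq> U" "s \<in> sect V" "s' \<in> sect V"
  let ?c = "\<lambda>i. sect_comp i s" and ?c' = "\<lambda>i. sect_comp i s'" and ?R = "{..rank B}"
  have c: "?c i \<in> sect V" "?c' i \<in> sect V" for i using * sect_compI by blast+
  have s: "s = (\<Sum>i\<in>?R. ?c i)" "s' = (\<Sum>i\<in>?R. ?c' i)" using * sect_decomp by blast+
  have Ds: "D V s = (\<Sum>i\<in>?R. D V (?c i))" "D V s' = (\<Sum>i\<in>?R. D V (?c' i))"
    using End_sum[OF D, of ?R ?c V] End_sum[OF D, of ?R ?c' V] c s by simp_all
  have "sect_mult s s' = (\<Sum>i\<in>?R. sect_mult (?c i) s')"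
    by (subst s(1)) (rule sect_mult_sum_left)
  also have "\<dots> = (\<Sum>i\<in>?R. \<Sum>j\<in>?R. sect_mult (?c i) (?c' j))"
    by (subst s(2)) (simp only: sect_mult_sum_right)
  finally have "D V (sect_mult s s') = D V (\<Sum>i\<in>?R. \<Sum>j\<in>?R. sect_mult (?c i) (?c' j))"
    by (rule arg_cong)
  also have "\<dots> = (\<Sum>i\<in>?R. D V (\<Sum>j\<in>?R. sect_mult (?c i) (?c' j)))"
    by (intro End_sum[OF D] sect_sumI sect_multI c)
  also have "\<dots> = (\<Sum>i\<in>?R. \<Sum>j\<in>?R. D V (sect_mult (?c i) (?c' j)))"
    by (intro sum.cong refl End_sum[OF D] sect_multI c)
  also have "\<dots> = (\<Sum>i\<in>?R. \<Sum>j\<in>?R. sect_mult (D V (?c i)) (?c' j) + sect_mult (?c i) (D V (?c' j)))"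
    using * by (intro sum.cong refl hom gr_comp) auto
  also have "\<dots> = (\<Sum>i\<in>?R. sect_mult (D V (?c i)) (\<Sum>j\<in>?R. ?c' j))
      + (\<Sum>i\<in>?R. sect_mult (?c i) (\<Sum>j\<in>?R. D V (?c' j)))"
    by (simp only: sum.distrib sect_mult_sum_right)
  also have "\<dots> = sect_mult (D V s) s' + sect_mult s (D V s')"
    using s Ds by (simp only: sect_mult_sum_left[symmetric])
  finally show "D V (sect_mult s s') = sect_mult (D V s) s' + sect_mult s (D V s')" .
qed

text \<open>In the lowest possible degree the twists \<alpha> and \<beta> cannot be told from the
  identity, so a twisted Leibniz rule becomes the ordinary one. With trivial twists this shows that
  components of derivations are derivations; with automorphisms as twists it provides the steps in
  the construction of logarithms.\<close>

lemma leading_term_Der: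
  assumes F: "F \<in> Fil d U" and \<alpha>: "\<alpha> \<in> End U" "\<alpha> - Ident U \<in> Fil 1 U" and \<beta>: "\<beta> \<in> End U" "\<beta> - Ident U \<in> Fil 1 U"
    and leib: "\<And>V s s'. opn V \<Longrightarrow> V \<subseteq> U \<Longrightarrow> s \<in> sect V \<Longrightarrow> s' \<in> sect V \<Longrightarrow>
      F V (sect_mult s s') = sect_mult (F V s) (\<alpha> V s') + sect_mult (\<beta> V s) (F V s')"
  shows "prj d F \<in> Der_deg X B d U"
proof -
  note FE = Fil_End[OF F]
  have "prj d F \<in> Der U"
  proof (rule Der_homogI[OF pr_End[OF FE]])
    fix V s s' i j assume V: "opn V" "V \<subseteq> U" and s: "s \<in> gr (\<lambda>l. l = i) V" and s': "s' \<in> gr (\<lambda>l. l = j) V"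
    have geq: "x \<in> gr (\<lambda>l. k \<le> l) V" if "x \<in> gr (\<lambda>l. l = k) V" for x k
      using that by (rule gr_mono) simp
    \<comment> \<open>The deviations of the twists from the identity raise degrees by at least one,
      so they do not contribute in degree \<open>i + j + d\<close>.\<close>
    define y z where "y = (\<alpha> - Ident U) V s'" and "z = (\<beta> - Ident U) V s"
    have y: "\<alpha> V s' = s' + y" and z: "\<beta> V s = s + z"
      using V gr_sect[OF s] gr_sect[OF s'] by (simp_all add: y_def z_def Id_apply)
    have "y \<in> gr (\<lambda>l. j + 1 \<le> l) V" "z \<in> gr (\<lambda>l. i + 1 \<le> l) V"
      unfolding y_def z_def using FilD \<alpha>(2) \<beta>(2) geq s s' by blast+
    moreover have Fs: "F V s \<in> gr (\<lambda>l. i + d \<le> l) V" "F V s' \<in> gr (\<lambda>l. j + d \<le> l) V"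
      using FilD[OF F] geq s s' by blast+
    ultimately have "sect_mult (F V s) y \<in> gr (\<lambda>l. i + d + (j + 1) \<le> l) V"
      "sect_mult z (F V s') \<in> gr (\<lambda>l. i + 1 + (j + d) \<le> l) V"
      by (auto intro: gr_mult)
    then have yz: "sect_comp (i + d + j) (sect_mult (F V s) y) = 0"
      "sect_comp (i + (j + d)) (sect_mult z (F V s')) = 0"
      by (auto intro: gr_comp_eq_0)
    have "prj d F V (sect_mult s s') = sect_comp (i + j + d) (F V (sect_mult s s'))"
      by (rule pr_homog[OF FE gr_mult[OF s s']]) simp
    also have "\<dots> = sect_comp (i + d + j) (sect_mult (F V s) (s' + y))
        + sect_comp (i + (j + d)) (sect_mult (s + z) (F V s'))"
      using leib[OF V gr_sect[OF s] gr_sect[OF s']] by (simp add: y z sect_comp_add add_ac)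
    also have "\<dots> = sect_comp (i + d + j) (sect_mult (F V s) s') + sect_comp (i + (j + d)) (sect_mult s (F V s'))"
      using yz by (simp add: sect_mult_add_left sect_mult_add_right sect_comp_add)
    also have "\<dots> = sect_mult (prj d F V s) s' + sect_mult s (prj d F V s')"
      by (simp only: mult_comp_left[OF s'] mult_comp_right[OF s] pr_homog[OF FE s] pr_homog[OF FE s'])
    finally show "prj d F V (sect_mult s s') = sect_mult (prj d F V s) s' + sect_mult s (prj d F V s')" .
  qed
  then show ?thesis using pr_End_deg[OF FE] by (simp add: Der_deg_def)
qed

lemma Der_deg_Fil: "D \<in> Der_deg X B d U \<Longrightarrow> D \<in> Fil d U"
  by (simp add: Der_deg_def End_deg_Fil)

lemma Der_deg_Der: "D \<in> Der_deg X B d U \<Longrightarrow> D \<in> Der U"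
  by (simp add: Der_deg_def)

text \<open>Components are split off one at a time, so that the next one is always the leading term
  of what remains. The remainder is still a derivation, hence so is its leading term.\<close>

lemma Der_truncation:
  assumes D: "D \<in> Der U" "D \<in> Fil 2 U"
  shows "(\<forall>l\<in>{1..k}. prj (2 * l) D \<in> Der_deg X B (2 * l) U) \<and>
    D - (\<Sum>l=1..k. prj (2 * l) D) \<in> Der U \<inter> Fil (2 * k + 2) U"
proof (induction k)
  case 0
  have "D - (\<Sum>l=1..0. prj (2 * l) D) = D" "2 * 0 + 2 = (2::nat)" by simp_all
  then show ?case using D by (simp only:) simp
next
  case (Suc k)
  define F where "F = D - (\<Sum>l=1..k. prj (2 * l) D)"
  have F: "F \<in> Der U" "F \<in> Fil (2 * k + 2) U" using Suc unfolding F_def by blast+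
  \<comment> \<open>The components already removed have other degrees, so the leading term of the
    remainder is the component of \<open>D\<close> itself.\<close>
  have "prj (2 * Suc k) (prj (2 * l) D) = 0" if "l \<in> {1..k}" for l
    using that by (intro pr_deg_other[OF pr_End_deg[OF Der_End[OF D(1)]]]) auto
  then have "prj (2 * Suc k) F = prj (2 * Suc k) D"
    unfolding F_def by (simp add: pr_diff pr_sum)
  moreover have "prj (2 * k + 2) F \<in> Der_deg X B (2 * k + 2) U"
  proof (rule leading_term_Der[OF F(2) Id_End _ Id_End])
    show "Ident U - Ident U \<in> Fil 1 U" "Ident U - Ident U \<in> Fil 1 U" by simp_all
    fix V s s' assume "opn V" "V \<subseteq> U" "s \<in> sect V" "s' \<in> sect V"
    then show "F V (sect_mult s s') = sect_mult (F V s) (Ident U V s') + sect_mult (Ident U V s) (F V s')"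
      by (simp add: Id_apply Der_mult[OF F(1)])
  qed
  ultimately have D': "prj (2 * Suc k) D \<in> Der_deg X B (2 * Suc k) U" "prj (2 * Suc k) F = prj (2 * Suc k) D"
    by simp_all
  have "F - prj (2 * k + 2) F \<in> Fil (2 * k + 2 + 2) U"
    by (rule Fil_step[OF F(2)]) simp
  then have *: "F - prj (2 * Suc k) D \<in> Fil (2 * Suc k + 2) U" using D'(2) by simp
  have eq: "D - (\<Sum>l=1..Suc k. prj (2 * l) D) = F - prj (2 * Suc k) D"
    by (simp add: F_def)
  have "D - (\<Sum>l=1..Suc k. prj (2 * l) D) \<in> Der U \<inter> Fil (2 * Suc k + 2) U"
    unfolding eq by (rule IntI[OF Der_diff[OF F(1) Der_deg_Der[OF D'(1)]] *])
  moreover have "\<forall>l\<in>{1..Suc k}. prj (2 * l) D \<in> Der_deg X B (2 * l) U"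
    using Suc D'(1) by (auto simp: le_Suc_eq)
  ultimately show ?case by (rule conjI[rotated])
qed

text \<open>Replaces the direct sum by a condition without choices, from which closure under sums,
  negation and restriction is immediate.\<close>

lemma Der2_eq: "Der2 X B U = Der U \<inter> Fil 2 U"
proof (intro equalityI subsetI)
  fix F assume "F \<in> Der2 X B U"
  then obtain K D where K: "K \<subseteq> {1..}" "\<forall>k\<in>K. D k \<in> Der_deg X B (2 * k) U" "F = (\<Sum>k\<in>K. D k)"
    unfolding Der2_def by blast
  have "D k \<in> Fil 2 U" "D k \<in> Der U" if "k \<in> K" for k
    using K that Der_deg_Fil Der_deg_Der Fil_mono[of "D k" "2 * k" U 2] by (fastforce, blast)
  then show "F \<in> Der U \<inter> Fil 2 U"
    unfolding K(3) by (intro IntI Der_sum Fil_sum)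
next
  fix F assume F: "F \<in> Der U \<inter> Fil 2 U"
  have *: "\<forall>l\<in>{1..rank B}. prj (2 * l) F \<in> Der_deg X B (2 * l) U"
    "F - (\<Sum>l=1..rank B. prj (2 * l) F) \<in> Fil (2 * rank B + 2) U"
    using Der_truncation[of F U "rank B"] F by blast+
  \<comment> \<open>After \<open>rank B\<close> components the remainder lies in filtration degree
    \<open>2 * rank B + 2\<close>, where nothing is left.\<close>
  have "F - (\<Sum>l=1..rank B. prj (2 * l) F) = 0"
    by (rule Fil_large[OF *(2)]) simp
  then have "F = (\<Sum>l\<in>{1..rank B}. prj (2 * l) F)" by simp
  then show "F \<in> Der2 X B U"
    using *(1) unfolding Der2_def by (intro CollectI exI[of _ "{1..rank B}"] exI[of _ "\<lambda>l. prj (2 * l) F"]) auto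
qed

lemma Der2_pr: "F \<in> Der2 X B U \<Longrightarrow> 1 \<le> l \<Longrightarrow> prj (2 * l) F \<in> Der_deg X B (2 * l) U"
  using Der_truncation[of F U l] unfolding Der2_eq by simp

lemma Der2_truncation: "F \<in> Der2 X B U \<Longrightarrow> F - (\<Sum>l=1..k. prj (2 * l) F) \<in> Fil (2 * k + 2) U"
  using Der_truncation[of F U k] unfolding Der2_eq by simp

lemma Der2_decomp: assumes "F \<in> Der2 X B U" shows "F = (\<Sum>l=1..rank B. prj (2 * l) F)"
  using Fil_large[OF Der2_truncation[OF assms, of "rank B"]] by simp

lemma Der_deg_Der2: "D \<in> Der_deg X B (2 * k) U \<Longrightarrow> 1 \<le> k \<Longrightarrow> D \<in> Der2 X B U"
  unfolding Der2_eq using Der_deg_Der Der_deg_Fil Fil_mono by fastforce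

lemma Der2_zero [simp]: "0 \<in> Der2 X B U"
  and Der2_add: "F \<in> Der2 X B U \<Longrightarrow> G \<in> Der2 X B U \<Longrightarrow> F + G \<in> Der2 X B U"
  and Der2_diff: "F \<in> Der2 X B U \<Longrightarrow> G \<in> Der2 X B U \<Longrightarrow> F - G \<in> Der2 X B U"
  and Der2_uminus: "F \<in> Der2 X B U \<Longrightarrow> - F \<in> Der2 X B U"
  and Der2_res: "F \<in> Der2 X B U \<Longrightarrow> W \<subseteq> U \<Longrightarrow> endo_res W F \<in> Der2 X B W"
  and Der2_Fil: "F \<in> Der2 X B U \<Longrightarrow> F \<in> Fil 2 U"
  and Der2_Der: "F \<in> Der2 X B U \<Longrightarrow> F \<in> Der U"
  unfolding Der2_eq by (auto intro: Der_add Der_diff Der_uminus Fil_add Fil_diff Fil_uminus Der_res Fil_res)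

lemma Der2_End: "F \<in> Der2 X B U \<Longrightarrow> F \<in> End U"
  using Der2_Fil Fil_End by blast

section \<open>Powers and the exponential series\<close>

primrec epow :: "'m set \<Rightarrow> ('m, 'e) endo \<Rightarrow> nat \<Rightarrow> ('m, 'e) endo" where
  "epow U u 0 = Ident U"
| "epow U u (Suc n) = u \<bullet>\<bullet> epow U u n"

lemma epow_Fil: assumes "u \<in> Fil d U" shows "epow U u n \<in> Fil (d * n) U"
proof (induction n)
  case (Suc n)
  then show ?case using Fil_comp[OF assms Suc] by (simp only: epow.simps mult_Suc_right)
qed simp

lemma epow_End: "u \<in> End U \<Longrightarrow> epow U u n \<in> End U"
  by (induction n) (simp_all add: comp_End)

lemma epow_add: assumes "u \<in> End U" shows "epow U u (m + n) = epow U u m \<bullet>\<bullet> epow U u n"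
  by (induction m) (simp_all add: comp_Id[OF epow_End[OF assms]] endo_comp_assoc)

lemma epow_uminus: assumes "u \<in> End U" shows "epow U (- u) n = endo_scale ((- 1) ^ n) (epow U u n)"
proof (induction n)
  case (Suc n)
  have "epow U (- u) (Suc n) = endo_scale (- 1) u \<bullet>\<bullet> endo_scale ((- 1) ^ n) (epow U u n)"
    using Suc by (simp add: endo_uminus_eq)
  also have "\<dots> = endo_scale (- 1) (endo_scale ((- 1) ^ n) (u \<bullet>\<bullet> epow U u n))"
    by (simp only: endo_comp_scale_left endo_comp_scale_right[OF assms epow_End[OF assms]])
  finally show ?case by (simp only: endo_scale_scale epow.simps power_Suc)
qed simp

lemma epow_apply:
  assumes "u \<in> End U" "opn V" "V \<subseteq> U" "s \<in> sect V" shows "epow U u n V s = (u V ^^ n) s"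
  by (induction n) (simp_all add: Id_apply assms)

abbreviation "dpow U u n \<equiv> endo_scale (1 / fact n) (epow U u n)"

abbreviation "Exp U u \<equiv> endo_exp X B U u"

lemma exp_eq_sum: assumes u: "u \<in> End U" shows "Exp U u = (\<Sum>n\<le>rank B. dpow U u n)"
proof (rule endo_eqI)
  fix V s
  show "Exp U u V s = (\<Sum>n\<le>rank B. dpow U u n) V s"
  proof (cases "opn V \<and> V \<subseteq> U \<and> s \<in> sect V")
    case True
    then show ?thesis by (simp add: endo_exp_def endo_sum_apply endo_scale_def epow_apply[OF u])
  next
    case False
    then have "Exp U u V s = 0" unfolding endo_exp_def by (rule if_not_P)
    moreover have "(\<Sum>n\<le>rank B. dpow U u n) \<in> End U" by (intro sum_End scale_End epow_End u)
    then have "(\<Sum>n\<le>rank B. dpow U u n) V s = 0" using False by (rule End_outside)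
    ultimately show ?thesis by (rule trans[OF _ sym])
  qed
qed

lemma exp_End: "u \<in> End U \<Longrightarrow> Exp U u \<in> End U"
  unfolding exp_eq_sum by (intro sum_End scale_End epow_End)

lemma exp_diff_id: assumes "u \<in> Fil 2 U" shows "Exp U u - Ident U \<in> Fil 2 U"
proof -
  note u = Fil_End[OF assms]
  have "{..rank B} = insert 0 {1..rank B}" by auto
  then have "Exp U u = dpow U u 0 + (\<Sum>n\<in>{1..rank B}. dpow U u n)"
    unfolding exp_eq_sum[OF u] by (simp only: sum.insert finite_atLeastAtMost atLeastAtMost_iff) simp
  then have "Exp U u - Ident U = (\<Sum>n\<in>{1..rank B}. dpow U u n)" by simp
  also have "\<dots> \<in> Fil 2 U"
  proof (intro Fil_sum Fil_scale)
    fix n assume "n \<in> {1..rank B}"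
    then show "epow U u n \<in> Fil 2 U" using epow_Fil[OF assms, of n] Fil_mono by fastforce
  qed
  finally show ?thesis .
qed

lemma exp_zero: "Exp U 0 = Ident U"
proof -
  have "Exp U 0 = (\<Sum>n\<in>{0}. dpow U 0 n)"
    unfolding exp_eq_sum[OF zero_End]
  proof (intro sum.mono_neutral_right ballI)
    fix n assume "n \<in> {..rank B} - {0}"
    then obtain m where "n = Suc m" by (cases n) auto
    then show "dpow U 0 n = 0" by (intro endo_eqI) (simp add: endo_scale_def)
  qed auto
  then show ?thesis by simp
qed

lemma exp_res: "W \<subseteq> U \<Longrightarrow> endo_res W (Exp U u) = Exp W (endo_res W u)"
  by (rule endo_eqI) (simp add: endo_res_def endo_exp_def subset_trans)

text \<open>To first order the exponential is the identity map on exponents: in the terms with at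
  least two factors, the difference \<open>a - b\<close> of degree \<open>d\<close> is accompanied
  by a further factor of degree 2.\<close>

lemma exp_first_order:
  assumes a: "a \<in> Fil 2 U" and b: "b \<in> Fil 2 U" and ab: "a - b \<in> Fil d U"
  shows "Exp U a - Exp U b - (a - b) \<in> Fil (d + 2) U"
proof (cases "rank B")
  \<comment> \<open>For rank 0 the series stops before its linear term; the exponents are then 0 as
    well.\<close>
  case 0
  then have "a = 0" "b = 0" using Fil_large a b by simp_all
  then show ?thesis by simp
next
  case (Suc r)
  note aE = Fil_End[OF a] and bE = Fil_End[OF b]
  note pE = epow_End[OF aE] epow_End[OF bE]
  \<comment> \<open>The noncommutative telescope: exactly one factor is replaced by the difference
    in each summand.\<close>
  have step: "epow U a (Suc n) - epow U b (Suc n) = a \<bullet>\<bullet> (epow U a n - epow U b n) + (a - b) \<bullet>\<bullet> epow U b n" for n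
    by (simp add: endo_comp_diff_right[OF aE pE] endo_comp_diff_left)
  have 1: "epow U a n - epow U b n \<in> Fil d U" for n
  proof (induction n)
    case (Suc n)
    have "a \<bullet>\<bullet> (epow U a n - epow U b n) \<in> Fil d U"
      using Fil_comp[OF a Suc] by (rule Fil_mono) simp
    moreover have "(a - b) \<bullet>\<bullet> epow U b n \<in> Fil d U"
      using Fil_comp[OF ab epow_Fil[OF b, of n]] by (rule Fil_mono) simp
    ultimately show ?case unfolding step by (rule Fil_add)
  next
    case 0
    have "epow U a 0 - epow U b 0 = 0" by simp
    then show ?case by (simp only: Fil_zero)
  qed
  have 2: "epow U a (Suc (Suc n)) - epow U b (Suc (Suc n)) \<in> Fil (d + 2) U" for n
  proof -
    have "a \<bullet>\<bullet> (epow U a (Suc n) - epow U b (Suc n)) \<in> Fil (d + 2) U"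
      using Fil_comp[OF a 1[of "Suc n"]] by (simp only: add.commute)
    moreover have "(a - b) \<bullet>\<bullet> epow U b (Suc n) \<in> Fil (d + 2) U"
      using Fil_comp[OF ab epow_Fil[OF b, of "Suc n"]] by (rule Fil_mono) simp
    ultimately show ?thesis using step[of "Suc n"] Fil_add by metis
  qed
  have sum: "Exp U u = Ident U + u + (\<Sum>n\<in>{2..rank B}. dpow U u n)" if "u \<in> End U" for u
    unfolding exp_eq_sum[OF that] Suc using comp_Id[OF that]
    by (simp add: atMost_atLeast0 sum.atLeast_Suc_atMost add.assoc numeral_2_eq_2)
  have "Exp U a - Exp U b - (a - b) = (\<Sum>n\<in>{2..rank B}. dpow U a n) - (\<Sum>n\<in>{2..rank B}. dpow U b n)"
    unfolding sum[OF aE] sum[OF bE] by simp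
  also have "\<dots> = (\<Sum>n\<in>{2..rank B}. endo_scale (1 / fact n) (epow U a n - epow U b n))"
    by (simp only: endo_scale_diff sum_subtractf)
  also have "\<dots> \<in> Fil (d + 2) U"
  proof (intro Fil_sum Fil_scale)
    fix n assume "n \<in> {2..rank B}"
    then obtain m where "n = Suc (Suc m)" by (metis atLeastAtMost_iff le_iff_add add_2_eq_Suc)
    then show "epow U a n - epow U b n \<in> Fil (d + 2) U" using 2 by blast
  qed
  finally show ?thesis .
qed

text \<open>Exponents and exponentials agree to the same order. For the harder direction the order
  is raised by two at a time: once \<open>a - b\<close> has some order, its difference from
  \<open>Exp U a - Exp U b\<close> has two orders more.\<close>

lemma exp_diff_Fil_iff:
  assumes a: "a \<in> Fil 2 U" and b: "b \<in> Fil 2 U" and "1 \<le> k"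
  shows "Exp U a - Exp U b \<in> Fil (2 * k) U \<longleftrightarrow> a - b \<in> Fil (2 * k) U"
proof
  assume *: "a - b \<in> Fil (2 * k) U"
  then have "Exp U a - Exp U b - (a - b) \<in> Fil (2 * k) U"
    using exp_first_order[OF a b *] Fil_mono by fastforce
  then show "Exp U a - Exp U b \<in> Fil (2 * k) U" using Fil_add[OF _ *] by fastforce
next
  have "Exp U a - Exp U b \<in> Fil (2 * Suc n) U \<Longrightarrow> a - b \<in> Fil (2 * Suc n) U" for n
  proof (induction n)
    case 0
    have "2 * Suc 0 = 2" by simp
    then show ?case using Fil_diff[OF a b] by (simp only:)
  next
    case (Suc n)
    have "Exp U a - Exp U b \<in> Fil (2 * Suc n) U" by (rule Fil_mono[OF Suc.prems]) simp
    then have "Exp U a - Exp U b - (a - b) \<in> Fil (2 * Suc n + 2) U"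
      by (intro exp_first_order[OF a b] Suc.IH)
    moreover have "2 * Suc n + 2 = 2 * Suc (Suc n)" by simp
    ultimately have "Exp U a - Exp U b - (a - b) \<in> Fil (2 * Suc (Suc n)) U" by (simp only:)
    then have "Exp U a - Exp U b - (Exp U a - Exp U b - (a - b)) \<in> Fil (2 * Suc (Suc n)) U"
      by (rule Fil_diff[OF Suc.prems])
    moreover have "Exp U a - Exp U b - (Exp U a - Exp U b - (a - b)) = a - b" by simp
    ultimately show ?case by (simp only:)
  qed
  then show "Exp U a - Exp U b \<in> Fil (2 * k) U \<Longrightarrow> a - b \<in> Fil (2 * k) U"
    using \<open>1 \<le> k\<close> by (metis Suc_le_D One_nat_def)
qed

lemma Fil_all_zero: "F \<in> Fil (2 * (rank B + 1)) U \<Longrightarrow> F = 0"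
  by (erule Fil_large) simp

lemma exp_inj:
  assumes a: "a \<in> Fil 2 U" and b: "b \<in> Fil 2 U" and eq: "Exp U a = Exp U b" shows "a = b"
proof -
  have "a - b \<in> Fil (2 * (rank B + 1)) U"
    using exp_diff_Fil_iff[OF a b, of "rank B + 1"] eq by simp
  then show ?thesis using Fil_all_zero by fastforce
qed

text \<open>In the Cauchy product the coefficient of the \<open>p\<close>-th power is (1 - 1)^p / p!
  by the binomial theorem, so only \<open>p = 0\<close> remains.\<close>

lemma exp_inverse: assumes u: "u \<in> Fil 2 U" shows "Exp U u \<bullet>\<bullet> Exp U (- u) = Ident U"
proof -
  note uE = Fil_End[OF u] and vE = uminus_End[OF Fil_End[OF u]]
  define c :: "nat \<Rightarrow> nat \<Rightarrow> complex" where "c n m = (- 1) ^ m / (fact n * fact m)" for n m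
  have dp: "dpow U u n \<bullet>\<bullet> dpow U (- u) m = endo_scale (c n m) (epow U u (n + m))" for n m
  proof -
    have "dpow U u n \<bullet>\<bullet> dpow U (- u) m = endo_scale (1 / fact n) (endo_scale (1 / fact m)
        (endo_scale ((- 1) ^ m) (epow U u n \<bullet>\<bullet> epow U u m)))"
      unfolding epow_uminus[OF uE] endo_comp_scale_left
      by (simp only: endo_comp_scale_right[OF epow_End[OF uE] scale_End[OF scale_End[OF epow_End[OF uE]]]]
          endo_comp_scale_right[OF epow_End[OF uE] scale_End[OF epow_End[OF uE]]]
          endo_comp_scale_right[OF epow_End[OF uE] epow_End[OF uE]])
    then show ?thesis by (simp add: endo_scale_scale epow_add[OF uE] c_def)
  qed
  have zero: "endo_scale (c n m) (epow U u (n + m)) = 0" if "rank B < n + m" for n m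
    using Fil_large[OF Fil_scale[OF epow_Fil[OF u, of "n + m"]], of "c n m"] that by simp
  have "Exp U u \<bullet>\<bullet> Exp U (- u) = (\<Sum>n\<le>rank B. \<Sum>m\<le>rank B. dpow U u n \<bullet>\<bullet> dpow U (- u) m)"
    unfolding exp_eq_sum[OF uE] exp_eq_sum[OF vE] endo_comp_sum_left
    by (intro sum.cong refl endo_comp_sum_right[OF scale_End[OF epow_End[OF uE]]] scale_End epow_End vE)
  also have "\<dots> = (\<Sum>n\<le>rank B. \<Sum>m\<le>rank B. endo_scale (c n m) (epow U u (n + m)))"
    by (simp only: dp)
  also have "\<dots> = (\<Sum>p\<le>rank B. \<Sum>n\<le>p. endo_scale (c n (p - n)) (epow U u (n + (p - n))))"
    by (rule sum_triangle) (rule zero)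
  also have "\<dots> = (\<Sum>p\<le>rank B. \<Sum>n\<le>p. endo_scale (c n (p - n)) (epow U u p))"
    by (intro sum.cong refl) simp
  also have "\<dots> = (\<Sum>p\<le>rank B. endo_scale (\<Sum>n\<le>p. c n (p - n)) (epow U u p))"
    by (simp only: endo_scale_sum_left)
  also have "\<dots> = (\<Sum>p\<in>{0}. endo_scale (\<Sum>n\<le>p. c n (p - n)) (epow U u p))"
  proof (intro sum.mono_neutral_right ballI)
    fix p assume "p \<in> {..rank B} - {0}"
    then have "p > 0" by simp
    have "c n (p - n) = of_nat (p choose n) * 1 ^ n * (- 1) ^ (p - n) / fact p" if "n \<le> p" for n
      using binomial_fact[OF that, where 'a = complex] by (simp add: c_def)
    then have "(\<Sum>n\<le>p. c n (p - n)) = (\<Sum>n\<le>p. of_nat (p choose n) * 1 ^ n * (- 1) ^ (p - n)) / fact p"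
      by (simp add: sum_divide_distrib)
    also have "\<dots> = (1 + - 1) ^ p / fact p" by (simp only: binomial_ring)
    also have "\<dots> = 0" using \<open>p > 0\<close> by (simp add: zero_power)
    finally show "endo_scale (\<Sum>n\<le>p. c n (p - n)) (epow U u p) = 0" by simp
  qed auto
  also have "\<dots> = Ident U" by (simp add: c_def)
  finally show ?thesis .
qed

section \<open>Exponentials of derivations are automorphisms\<close>

lemma dpow_mult:
  assumes D: "D \<in> Der U" and V: "opn V" "V \<subseteq> U" and s: "s \<in> sect V" and s': "s' \<in> sect V"
  shows "dpow U D n V (sect_mult s s') = (\<Sum>k\<le>n. sect_mult (dpow U D k V s) (dpow U D (n - k) V s'))"
proof (induction n)
  case 0
  then show ?case using V s s' by (simp add: Id_apply sect_multI)
next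
  case (Suc n)
  note DE = Der_End[OF D]
  let ?x = "\<lambda>k. dpow U D k V s" and ?y = "\<lambda>k. dpow U D k V s'"
  \<comment> \<open>Divided powers absorb the binomial coefficients of the Leibniz rule. Applying
    \<open>D\<close> to the case \<open>n\<close> gives each product of orders \<open>k\<close> and
    \<open>Suc n - k\<close> the weights \<open>k\<close> and \<open>Suc n - k\<close>, which add up
    to the common factor \<open>Suc n\<close>, divided away at the end.\<close>
  have Ddp: "D V (dpow U D k V x) = sect_scale (of_nat (Suc k)) (dpow U D (Suc k) V x)" for k x
    by (simp add: endo_scale_def sect_scale_scale End_scale[OF DE] End_sect[OF epow_End[OF DE]]
        flip: of_nat_Suc)
  have xy: "?x k \<in> sect V" "?y k \<in> sect V" for k
    using End_sect[OF scale_End[OF epow_End[OF DE]]] by blast+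
  have "sect_scale (of_nat (Suc n)) (dpow U D (Suc n) V (sect_mult s s')) = D V (dpow U D n V (sect_mult s s'))"
    by (rule Ddp[symmetric])
  also have "\<dots> = D V (\<Sum>k\<le>n. sect_mult (?x k) (?y (n - k)))"
    by (simp only: Suc)
  also have "\<dots> = (\<Sum>k\<le>n. D V (sect_mult (?x k) (?y (n - k))))"
    by (intro End_sum[OF DE] sect_multI xy)
  also have "\<dots> = (\<Sum>k\<le>n. sect_mult (D V (?x k)) (?y (n - k)) + sect_mult (?x k) (D V (?y (n - k))))"
    by (intro sum.cong refl Der_mult[OF D V] xy)
  also have "\<dots> = (\<Sum>k\<le>n. sect_scale (of_nat (Suc k)) (sect_mult (?x (Suc k)) (?y (n - k))))
      + (\<Sum>k\<le>n. sect_scale (of_nat (Suc (n - k))) (sect_mult (?x k) (?y (Suc (n - k)))))"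
    by (simp only: sum.distrib Ddp sect_mult_scale_left sect_mult_scale_right)
  also have "(\<Sum>k\<le>n. sect_scale (of_nat (Suc k)) (sect_mult (?x (Suc k)) (?y (n - k))))
      = (\<Sum>k\<le>Suc n. sect_scale (of_nat k) (sect_mult (?x k) (?y (Suc n - k))))"
    by (subst sum.atMost_Suc_shift) (simp only: of_nat_0 sect_scale_zero_left add_0 diff_Suc_Suc)
  also have "(\<Sum>k\<le>n. sect_scale (of_nat (Suc (n - k))) (sect_mult (?x k) (?y (Suc (n - k)))))
      = (\<Sum>k\<le>Suc n. sect_scale (of_nat (Suc n - k)) (sect_mult (?x k) (?y (Suc n - k))))"
    by (subst sum.atMost_Suc)
      (simp only: diff_self_eq_0 of_nat_0 sect_scale_zero_left add_0_right, intro sum.cong refl, simp only: atMost_iff Suc_diff_le)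
  also have "(\<Sum>k\<le>Suc n. sect_scale (of_nat k) (sect_mult (?x k) (?y (Suc n - k))))
      + (\<Sum>k\<le>Suc n. sect_scale (of_nat (Suc n - k)) (sect_mult (?x k) (?y (Suc n - k))))
      = (\<Sum>k\<le>Suc n. sect_scale (of_nat (Suc n)) (sect_mult (?x k) (?y (Suc n - k))))"
    unfolding sum.distrib[symmetric]
    by (intro sum.cong refl) (simp only: sect_scale_add_left[symmetric] of_nat_add[symmetric] atMost_iff le_add_diff_inverse)
  also have "\<dots> = sect_scale (of_nat (Suc n)) (\<Sum>k\<le>Suc n. sect_mult (?x k) (?y (Suc n - k)))"
    by (simp only: sect_scale_sum)
  finally have "sect_scale (1 / of_nat (Suc n)) (sect_scale (of_nat (Suc n)) (dpow U D (Suc n) V (sect_mult s s')))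
    = sect_scale (1 / of_nat (Suc n)) (sect_scale (of_nat (Suc n)) (\<Sum>k\<le>Suc n. sect_mult (?x k) (?y (Suc n - k))))"
    by (rule arg_cong)
  moreover have "1 / of_nat (Suc n) * of_nat (Suc n) = (1 :: complex)" by (simp del: of_nat_Suc)
  ultimately show ?case by (simp only: sect_scale_scale sect_scale_one)
qed

lemma exp_mult:
  assumes D: "D \<in> Der2 X B U" and V: "opn V" "V \<subseteq> U" and s: "s \<in> sect V" and s': "s' \<in> sect V"
  shows "Exp U D V (sect_mult s s') = sect_mult (Exp U D V s) (Exp U D V s')"
proof -
  note DE = Der2_End[OF D] and DF = Der2_Fil[OF D]
  let ?x = "\<lambda>k. dpow U D k V s" and ?y = "\<lambda>k. dpow U D k V s'"
  \<comment> \<open>The product has degrees at least \<open>2 * (n + m)\<close>, which exceeds the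
    rank; this admits the triangular rearrangement.\<close>
  have zero: "sect_mult (?x n) (?y m) = 0" if "rank B < n + m" for n m
  proof -
    have "s \<in> gr (\<lambda>l. 0 \<le> l) V" "s' \<in> gr (\<lambda>l. 0 \<le> l) V" using s s' by (simp_all add: gr_iff)
    then have "?x n \<in> gr (\<lambda>l. 0 + 2 * n \<le> l) V" "?y m \<in> gr (\<lambda>l. 0 + 2 * m \<le> l) V"
      using FilD[OF Fil_scale[OF epow_Fil[OF DF]]] by blast+
    then have xy: "sect_mult (?x n) (?y m) \<in> gr (\<lambda>l. 2 * n + 2 * m \<le> l) V"
      by (rule gr_mult) simp
    have "sect_comp j (sect_mult (?x n) (?y m)) = sect_comp j 0" for j
    proof (cases "rank B < j")
      case True
      then show ?thesis using sect_comp_large[OF gr_sect[OF xy]] by simp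
    next
      case False
      then show ?thesis using gr_comp_eq_0[OF xy, of j] that by simp
    qed
    then show ?thesis by (intro sect_eqI[OF gr_sect[OF xy] zero_sect])
  qed
  have "sect_mult (Exp U D V s) (Exp U D V s') = (\<Sum>n\<le>rank B. \<Sum>m\<le>rank B. sect_mult (?x n) (?y m))"
    unfolding exp_eq_sum[OF DE] endo_sum_apply sect_mult_sum_left unfolding sect_mult_sum_right ..
  also have "\<dots> = (\<Sum>p\<le>rank B. \<Sum>n\<le>p. sect_mult (?x n) (?y (p - n)))"
    by (rule sum_triangle) (rule zero)
  also have "\<dots> = Exp U D V (sect_mult s s')"
    unfolding exp_eq_sum[OF DE] endo_sum_apply dpow_mult[OF Der2_Der[OF D] V s s'] ..
  finally show ?thesis by (rule sym)
qed

lemma exp_bij: assumes D: "D \<in> Fil 2 U" and V: "opn V" "V \<subseteq> U" shows "bij_betw (Exp U D V) (sect V) (sect V)"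
proof (rule bij_betw_byWitness[where f' = "Exp U (- D) V"])
  note i = exp_inverse[OF D] exp_inverse[OF Fil_uminus[OF D], simplified]
  show "\<forall>s\<in>sect V. Exp U (- D) V (Exp U D V s) = s"
    using fun_cong[OF fun_cong[OF i(2)]] V by (simp add: Id_apply)
  show "\<forall>s\<in>sect V. Exp U D V (Exp U (- D) V s) = s"
    using fun_cong[OF fun_cong[OF i(1)]] V by (simp add: Id_apply)
  show "Exp U D V ` sect V \<subseteq> sect V" "Exp U (- D) V ` sect V \<subseteq> sect V"
    using End_sect[OF exp_End] Fil_End[OF D] uminus_End by blast+
qed

lemma mult_one_right: assumes "s \<in> sect V" shows "sect_mult s (sect_one B V) = s"
proof (intro ext)
  fix t x I
  have "s t x \<in> ext_homog (\<lambda>_. True)"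
    using sect_finite_support[OF assms] by (auto simp: ext_homog_def)
  then show "sect_mult s (sect_one B V) t x I = s t x I"
    using sectD(4)[OF assms, of t x] by (auto simp: sect_mult_def sect_one_def wedge_ext_one_right)
qed

text \<open>Multiplicativity and surjectivity suffice: if \<open>s\<close> is sent to 1, the image
  of 1 equals its product with the image of \<open>s\<close>, that is the image of the product of 1
  and \<open>s\<close>, which is 1.\<close>

lemma exp_one: assumes D: "D \<in> Der2 X B U" and V: "opn V" "V \<subseteq> U" shows "Exp U D V (sect_one B V) = sect_one B V"
proof -
  note o = one_sect[OF V(1)] and e = exp_End[OF Der2_End[OF D]]
  obtain s where s: "s \<in> sect V" "Exp U D V s = sect_one B V"
    using bij_betw_imp_surj_on[OF exp_bij[OF Der2_Fil[OF D] V]] o by (metis imageE)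
  have "Exp U D V (sect_one B V) = sect_mult (Exp U D V (sect_one B V)) (Exp U D V s)"
    unfolding s(2) by (rule mult_one_right[symmetric]) (rule End_sect[OF e])
  also have "\<dots> = Exp U D V (sect_mult (sect_one B V) s)"
    by (rule exp_mult[OF D V o s(1), symmetric])
  also have "\<dots> = sect_one B V" by (simp only: mult_one_left[OF s(1)] s(2))
  finally show ?thesis .
qed

text \<open>The filtration only gives degrees at least \<open>j + 2\<close>; preservation of parity
  sharpens this to the degrees \<open>j + 2 * k\<close>.\<close>

lemma exp_in_G: assumes D: "D \<in> Der2 X B U" shows "Exp U D \<in> G_sheaf X B U"
proof -
  note e = exp_End[OF Der2_End[OF D]]
  have gr: "Exp U D V s - s \<in> gr (\<lambda>l. \<exists>k\<ge>1. l = j + 2 * k) V"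
    if V: "opn V" "V \<subseteq> U" and s: "s \<in> gr (\<lambda>l. l = j) V" for V j s
  proof -
    define P where "P = (if even j then even else (odd :: nat \<Rightarrow> bool))"
    have "s \<in> gr P V" using s by (rule gr_mono) (simp add: P_def)
    then have "Exp U D V s - s \<in> gr P V"
      using End_parity[OF e] by (intro gr_diff) (simp_all add: P_def)
    moreover have "(Exp U D - Ident U) V s \<in> gr (\<lambda>l. j + 2 \<le> l) V"
      by (rule FilD[OF exp_diff_id[OF Der2_Fil[OF D]] gr_mono[OF s]]) simp
    then have "Exp U D V s - s \<in> gr (\<lambda>l. j + 2 \<le> l) V"
      using V gr_sect[OF s] by (simp add: Id_apply)
    moreover have "\<exists>k\<ge>1. l = j + 2 * k" if "P l" "j + 2 \<le> l" for l
    proof -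
      have "even (l - j)" using that unfolding P_def by (auto split: if_splits)
      then obtain k where "l - j = 2 * k" by (elim evenE)
      then show ?thesis using that(2) by (intro exI[of _ k]) auto
    qed
    ultimately show ?thesis unfolding gr_iff by blast
  qed
  show ?thesis
    unfolding G_sheaf_def
    by (intro CollectI conjI allI impI ballI e; (elim conjE)?)
      (assumption | rule exp_bij exp_one exp_mult gr Der2_Fil D)+
qed

text \<open>Composition near the identity is additive to first order. The error is \<open>(\<phi> -
  \<phi>') \<bullet>\<bullet> (\<psi> - Ident U) + (\<phi>' - Ident U) \<bullet>\<bullet> (\<psi> -
  \<psi>')\<close>, in which each summand pairs a difference with a factor of degree 2.\<close>

lemma comp_diff_Fil:
  assumes \<phi>: "\<phi> \<in> End U" "\<phi>' \<in> End U" and \<psi>: "\<psi> \<in> End U" "\<psi>' \<in> End U"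
    and id: "\<phi>' - Ident U \<in> Fil 2 U" "\<psi> - Ident U \<in> Fil 2 U"
    and d: "\<phi> - \<phi>' \<in> Fil d U" "\<psi> - \<psi>' \<in> Fil d U"
  shows "\<phi> \<bullet>\<bullet> \<psi> - \<phi>' \<bullet>\<bullet> \<psi>' - ((\<phi> - \<phi>') + (\<psi> - \<psi>')) \<in> Fil (d + 2) U"
proof -
  have "\<phi> \<bullet>\<bullet> \<psi> - \<phi>' \<bullet>\<bullet> \<psi>' - ((\<phi> - \<phi>') + (\<psi> - \<psi>'))
      = (\<phi> - \<phi>') \<bullet>\<bullet> (\<psi> - Ident U) + (\<phi>' - Ident U) \<bullet>\<bullet> (\<psi> - \<psi>')"
    by (simp add: endo_comp_diff_left endo_comp_diff_right[OF \<phi>(1) \<psi>(1) Id_End]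
        endo_comp_diff_right[OF \<phi>(2) \<psi>(1) Id_End] endo_comp_diff_right[OF \<phi>(2) \<psi>]
        endo_comp_diff_right[OF Id_End[of U] \<psi>] comp_Id \<phi> \<psi> algebra_simps)
  moreover have "(\<phi> - \<phi>') \<bullet>\<bullet> (\<psi> - Ident U) \<in> Fil (d + 2) U"
    by (rule Fil_comp[OF d(1) id(2)])
  moreover have "(\<phi>' - Ident U) \<bullet>\<bullet> (\<psi> - \<psi>') \<in> Fil (d + 2) U"
    using Fil_comp[OF id(1) d(2)] by (simp only: add.commute)
  ultimately show ?thesis using Fil_add by (simp only:)
qed

lemma id_comp_closed:
  assumes "\<phi> \<in> End U" "\<phi> - Ident U \<in> Fil 2 U" "\<psi> \<in> End U" "\<psi> - Ident U \<in> Fil 2 U"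
  shows "\<phi> \<bullet>\<bullet> \<psi> - Ident U \<in> Fil 2 U"
proof -
  have "\<phi> \<bullet>\<bullet> \<psi> - Ident U \<bullet>\<bullet> Ident U - ((\<phi> - Ident U) + (\<psi> - Ident U)) \<in> Fil (2 + 2) U"
    using assms by (intro comp_diff_Fil) simp_all
  then have "\<phi> \<bullet>\<bullet> \<psi> - Ident U - ((\<phi> - Ident U) + (\<psi> - Ident U)) \<in> Fil 2 U"
    unfolding comp_Id[OF Id_End] by (rule Fil_mono) simp
  from Fil_add[OF this Fil_add[OF assms(2,4)]] show ?thesis by simp
qed

text \<open>Correct \<open>D\<close> degree by degree by the leading term of \<open>\<phi> - exp D\<close>, which is a derivation.\<close>

lemma log_exists:
  assumes \<phi>: "\<phi> \<in> End U" "\<phi> - Ident U \<in> Fil 2 U"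
    and mult: "\<And>V s s'. opn V \<Longrightarrow> V \<subseteq> U \<Longrightarrow> s \<in> sect V \<Longrightarrow> s' \<in> sect V \<Longrightarrow>
      \<phi> V (sect_mult s s') = sect_mult (\<phi> V s) (\<phi> V s')"
  obtains D where "D \<in> Der2 X B U" "Exp U D = \<phi>"
proof -
  have "\<exists>D\<in>Der2 X B U. \<phi> - Exp U D \<in> Fil (2 * Suc k) U" for k
  proof (induction k)
    case 0
    have "2 * Suc 0 = 2" by simp
    then show ?case using \<phi>(2) exp_zero[of U] by (intro bexI[of _ 0]) (simp_all only: Der2_zero)
  next
    case (Suc k)
    then obtain D where D: "D \<in> Der2 X B U" and F: "\<phi> - Exp U D \<in> Fil (2 * Suc k) U" by blast
    define F where "F = \<phi> - Exp U D"
    define \<delta> where "\<delta> = prj (2 * Suc k) F"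
    note e = exp_End[OF Der2_End[OF D]] and F' = F[folded F_def]
    have "\<delta> \<in> Der_deg X B (2 * Suc k) U"
      unfolding \<delta>_def
    proof (rule leading_term_Der[OF F' \<phi>(1) Fil_mono[OF \<phi>(2)] e Fil_mono[OF exp_diff_id[OF Der2_Fil[OF D]]]])
      fix V s s' assume V: "opn V" "V \<subseteq> U" "s \<in> sect V" "s' \<in> sect V"
      \<comment> \<open>The difference of two multiplicative maps obeys the Leibniz rule twisted by
        these maps, as in a b - a' b' = (a - a') b + a' (b - b').\<close>
      show "F V (sect_mult s s') = sect_mult (F V s) (\<phi> V s') + sect_mult (Exp U D V s) (F V s')"
        unfolding F_def by (simp add: mult[OF V] exp_mult[OF D V] sect_mult_diff)
    qed simp_all
    then have \<delta>: "\<delta> \<in> Der2 X B U" "\<delta> \<in> Fil (2 * Suc k) U"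
      using Der_deg_Der2 Der_deg_Fil by (fastforce, blast)
    have "D + \<delta> - D \<in> Fil (2 * Suc k) U" using \<delta> by simp
    then have "Exp U (D + \<delta>) - Exp U D - (D + \<delta> - D) \<in> Fil (2 * Suc k + 2) U"
      using D \<delta> by (intro exp_first_order) (auto intro: Der2_Fil Der2_add)
    moreover have "F - \<delta> \<in> Fil (2 * Suc k + 2) U"
      unfolding \<delta>_def by (rule Fil_step[OF F']) simp
    ultimately have "F - \<delta> - (Exp U (D + \<delta>) - Exp U D - (D + \<delta> - D)) \<in> Fil (2 * Suc k + 2) U"
      by (rule Fil_diff[rotated])
    moreover have "F - \<delta> - (Exp U (D + \<delta>) - Exp U D - (D + \<delta> - D)) = \<phi> - Exp U (D + \<delta>)"
      by (simp add: F_def)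
    moreover have "2 * Suc k + 2 = 2 * Suc (Suc k)" by simp
    ultimately have "\<phi> - Exp U (D + \<delta>) \<in> Fil (2 * Suc (Suc k)) U" by (simp only:)
    then show ?case using Der2_add[OF D \<delta>(1)] by blast
  qed
  then obtain D where D: "D \<in> Der2 X B U" "\<phi> - Exp U D \<in> Fil (2 * Suc (rank B)) U" by blast
  have "\<phi> - Exp U D = 0" by (rule Fil_large[OF D(2)]) simp
  then show ?thesis using that[OF D(1)] by simp
qed

end

section \<open>Cochains of derivations\<close>

context ext_bundle
begin

lemma gr_res: "s \<in> gr P V \<Longrightarrow> opn W \<Longrightarrow> W \<subseteq> V \<Longrightarrow> sect_res W s \<in> gr P W"
  unfolding gr_iff by (auto simp: sect_resI simp flip: sect_res_comp)

lemma Der_deg_iff: "D \<in> Der_deg X B d U \<longleftrightarrow> D \<in> Der U \<and> prj d D = D"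
  unfolding Der_deg_def using pr_End_deg[OF Der_End, of D U d] pr_deg_self[of D d U] by auto

lemma Der_deg_uminus: "D \<in> Der_deg X B d U \<Longrightarrow> - D \<in> Der_deg X B d U"
  unfolding Der_deg_iff by (simp add: Der_uminus pr_uminus)

lemma Der_deg_add: "D \<in> Der_deg X B d U \<Longrightarrow> D' \<in> Der_deg X B d U \<Longrightarrow> D + D' \<in> Der_deg X B d U"
  unfolding Der_deg_iff by (simp add: Der_add pr_add)

lemma Der_deg_diff: "D \<in> Der_deg X B d U \<Longrightarrow> D' \<in> Der_deg X B d U \<Longrightarrow> D - D' \<in> Der_deg X B d U"
  using Der_deg_add[of D d U "- D'"] Der_deg_uminus by simp

text \<open>Three factors are what both uses require: the multiplicative coboundary of a 1-cochain
  and the action of a 0-cochain on a 1-cochain.\<close>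

lemma exp_triple:
  assumes Fil: "a \<in> Fil 2 W" "a' \<in> Fil 2 W" "b \<in> Fil 2 W" "b' \<in> Fil 2 W" "c \<in> Fil 2 W" "c' \<in> Fil 2 W"
    and d: "a - a' \<in> Fil d W" "b - b' \<in> Fil d W" "c - c' \<in> Fil d W"
  shows "Exp W a \<bullet>\<bullet> Exp W b \<bullet>\<bullet> Exp W c - Exp W a' \<bullet>\<bullet> Exp W b' \<bullet>\<bullet> Exp W c' - ((a - a') + (b - b') + (c - c')) \<in> Fil (d + 2) W"
proof -
  define A A' B1 B1' C C' where defs: "A = Exp W a" "A' = Exp W a'" "B1 = Exp W b" "B1' = Exp W b'" "C = Exp W c" "C' = Exp W c'"
  note E = Fil[THEN Fil_End, THEN exp_End] and Idd = Fil[THEN exp_diff_id]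
  have fo: "A - A' - (a - a') \<in> Fil (d + 2) W" "B1 - B1' - (b - b') \<in> Fil (d + 2) W" "C - C' - (c - c') \<in> Fil (d + 2) W"
    unfolding defs by (rule exp_first_order[OF Fil(1,2) d(1)] exp_first_order[OF Fil(3,4) d(2)]
        exp_first_order[OF Fil(5,6) d(3)])+
  \<comment> \<open>An estimate modulo degree \<open>d + 2\<close> also carries membership in degree
    \<open>d\<close> from one side to the other; this supplies the premises of the next
    estimate.\<close>
  have close: "x \<in> Fil d W" if "x - y \<in> Fil (d + 2) W" "y \<in> Fil d W" for x y
  proof -
    have "(x - y) + y \<in> Fil d W" using that by (intro Fil_add) (auto intro: Fil_mono)
    then show ?thesis by simp
  qed
  have dd: "A - A' \<in> Fil d W" "B1 - B1' \<in> Fil d W" "C - C' \<in> Fil d W"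
    using close fo d by blast+
  have 1: "A \<bullet>\<bullet> B1 - A' \<bullet>\<bullet> B1' - ((A - A') + (B1 - B1')) \<in> Fil (d + 2) W"
    unfolding defs by (intro comp_diff_Fil E Idd dd[unfolded defs])
  have AB: "A \<bullet>\<bullet> B1 - A' \<bullet>\<bullet> B1' \<in> Fil d W"
    using close[OF 1] Fil_add[OF dd(1,2)] .
  have 2: "A \<bullet>\<bullet> B1 \<bullet>\<bullet> C - A' \<bullet>\<bullet> B1' \<bullet>\<bullet> C' - ((A \<bullet>\<bullet> B1 - A' \<bullet>\<bullet> B1') + (C - C')) \<in> Fil (d + 2) W"
    unfolding defs
    by (intro comp_diff_Fil comp_End id_comp_closed E Idd AB[unfolded defs] dd[unfolded defs])
  have "A \<bullet>\<bullet> B1 \<bullet>\<bullet> C - A' \<bullet>\<bullet> B1' \<bullet>\<bullet> C' - ((a - a') + (b - b') + (c - c'))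
    = (A \<bullet>\<bullet> B1 \<bullet>\<bullet> C - A' \<bullet>\<bullet> B1' \<bullet>\<bullet> C' - ((A \<bullet>\<bullet> B1 - A' \<bullet>\<bullet> B1') + (C - C')))
     + (A \<bullet>\<bullet> B1 - A' \<bullet>\<bullet> B1' - ((A - A') + (B1 - B1')))
     + (A - A' - (a - a')) + (B1 - B1' - (b - b')) + (C - C' - (c - c'))"
    by (simp add: algebra_simps)
  also have "\<dots> \<in> Fil (d + 2) W"
    by (intro Fil_add 1 2 fo)
  finally show ?thesis unfolding defs .
qed

end

locale covered_bundle = ext_bundle X B
  for X :: "'m cmanifold" and B :: "('m, 'e) vbundle" +
  fixes I :: "'i set" and U :: "'i \<Rightarrow> 'm set"
  assumes cover_open: "\<And>i. i \<in> I \<Longrightarrow> opn (U i)"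
    and cover: "(\<Union>i\<in>I. U i) = topspace (mtop X)"
    and no_global: "H0_Der2 X B = {0}"
begin

section \<open>Gluing local derivations\<close>

lemma cover_ex: "x \<in> topspace (mtop X) \<Longrightarrow> \<exists>i. i \<in> I \<and> x \<in> U i"
  unfolding cover[symmetric] by (elim UN_E) (intro exI conjI)

lemma cover_subset: "i \<in> I \<Longrightarrow> U i \<subseteq> topspace (mtop X)"
  by (rule openin_subset[OF cover_open])

lemma sect_separated:
  assumes V: "opn V" and s: "s \<in> sect V" "s' \<in> sect V"
    and eq: "\<And>i. i \<in> I \<Longrightarrow> sect_res (V \<inter> U i) s = sect_res (V \<inter> U i) s'"
  shows "s = s'"
proof (rule ext, rule ext)
  fix t x
  show "s t x = s' t x"
  proof (cases "x \<in> V")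
    case True
    then have "x \<in> topspace (mtop X)" using openin_subset[OF V] by (rule rev_subsetD)
    then obtain i where i: "i \<in> I" "x \<in> U i" using cover_ex by blast
    then show ?thesis using fun_cong[OF fun_cong[OF eq[OF i(1)], of t], of x] True
      by (simp add: sect_res_def)
  next
    case False
    then show ?thesis using sectD(4)[OF s(1), of t x] sectD(4)[OF s(2), of t x] by simp
  qed
qed

text \<open>The sheaf property of homogeneous derivations. A section is mapped piecewise over the
  cover; once the result is known to restrict correctly to every cover member, all algebraic laws
  follow from separatedness.\<close>

lemma glue_Der_deg:
  assumes v: "\<And>i. i \<in> I \<Longrightarrow> v i \<in> Der_deg X B d (U i)"
    and comp: "\<And>i j. i \<in> I \<Longrightarrow> j \<in> I \<Longrightarrow> endo_res (U i \<inter> U j) (v i) = endo_res (U i \<inter> U j) (v j)"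
  shows "\<exists>D\<in>Der_deg X B d (topspace (mtop X)). \<forall>i\<in>I. endo_res (U i) D = v i"
proof -
  let ?T = "topspace (mtop X)"
  have vE: "v i \<in> End (U i)" if "i \<in> I" for i using v[OF that] Der_deg_Der Der_End by blast
  \<comment> \<open>At each point the value is read off from one arbitrary cover member containing
    that point.\<close>
  define c where "c x = (SOME i. i \<in> I \<and> x \<in> U i)" for x
  have c: "c x \<in> I \<and> x \<in> U (c x)" if "x \<in> ?T" for x
    unfolding c_def by (rule someI_ex[OF cover_ex[OF that]])
  define D :: "('m, 'e) endo" where "D V s = (if opn V \<and> V \<subseteq> ?T \<and> s \<in> sect V then
      (\<lambda>t x. if x \<in> V then v (c x) (V \<inter> U (c x)) (sect_res (V \<inter> U (c x)) s) t x else 0) else 0)" for V s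
  \<comment> \<open>The choice does not matter: on the intersection with another cover member the
    two local derivations coincide, and both commute with restriction to it.\<close>
  have key: "sect_res (V \<inter> U i) (D V s) = v i (V \<inter> U i) (sect_res (V \<inter> U i) s)"
    if V: "opn V" "V \<subseteq> ?T" and s: "s \<in> sect V" and i: "i \<in> I" for V s i
  proof (rule ext, rule ext)
    fix t x
    show "sect_res (V \<inter> U i) (D V s) t x = v i (V \<inter> U i) (sect_res (V \<inter> U i) s) t x"
    proof (cases "x \<in> V \<inter> U i")
      case True
      define j W where "j = c x" and "W = V \<inter> U i \<inter> U j"
      have j: "j \<in> I" "x \<in> U j" using c[of x] True V unfolding j_def by blast+
      have o: "opn (V \<inter> U i)" "opn (V \<inter> U j)" "opn W"
        using V(1) cover_open i j(1) unfolding W_def by (blast intro: openin_Int)+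
      have xW: "x \<in> W" using True j unfolding W_def by blast
      have r: "v k W (sect_res W s) = sect_res W (v k (V \<inter> U k) (sect_res (V \<inter> U k) s))"
        if k: "k \<in> I" "opn (V \<inter> U k)" "W \<subseteq> V \<inter> U k" for k
        using End_res[OF vE[OF k(1)] k(2) Int_lower2 sect_resI[OF s k(2) Int_lower1] o(3) k(3)] k(3)
        by (simp add: sect_res_res inf.absorb1)
      have "v i W = v j W"
        using fun_cong[OF comp[OF i j(1)], of W] unfolding W_def by (simp add: endo_res_def Int_assoc le_infI2)
      moreover have "W \<subseteq> V \<inter> U i" "W \<subseteq> V \<inter> U j" unfolding W_def by blast+
      ultimately have "sect_res W (v i (V \<inter> U i) (sect_res (V \<inter> U i) s)) = sect_res W (v j (V \<inter> U j) (sect_res (V \<inter> U j) s))"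
        using r[OF i o(1)] r[OF j(1) o(2)] by simp
      from fun_cong[OF fun_cong[OF this, of t], of x]
      have "v i (V \<inter> U i) (sect_res (V \<inter> U i) s) t x = v j (V \<inter> U j) (sect_res (V \<inter> U j) s) t x"
        using xW by (simp add: sect_res_def)
      then show ?thesis using True V s by (simp add: D_def sect_res_def j_def)
    next
      case False
      then have "\<not> (t \<in> trivs B \<and> x \<in> V \<inter> U i \<and> x \<in> fst t)" by blast
      from sectD(4)[OF End_sect[OF vE[OF i]] this]
      show ?thesis unfolding sect_res_def[of _ "D V s"] if_not_P[OF False] by (rule sym)
    qed
  qed
  have Dsect: "D V s \<in> sect V" if V: "opn V" "V \<subseteq> ?T" and s: "s \<in> sect V" for V s
  proof (rule sect_local)
    fix t x assume "x \<notin> V" then show "D V s t x = 0" using that by (simp add: D_def)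
  next
    fix x assume "x \<in> V"
    then obtain i where i: "i \<in> I" "x \<in> U i" using cover_ex V by blast
    have "sect_res (V \<inter> U i) (D V s) \<in> sect (V \<inter> U i)"
      unfolding key[OF V s i(1)] by (rule End_sect[OF vE[OF i(1)]])
    then show "\<exists>W. opn W \<and> x \<in> W \<and> W \<subseteq> V \<and> sect_res W (D V s) \<in> sect W"
      using i \<open>x \<in> V\<close> V cover_open[OF i(1)] by (intro exI[of _ "V \<inter> U i"]) auto
  qed
  have o: "opn (V \<inter> U i)" if "opn V" "i \<in> I" for V i using that cover_open by blast
  note rs = sect_resI[OF _ o Int_lower1]
  \<comment> \<open>Stated for two degree conditions \<open>P\<close> and \<open>Q\<close>, so that
    it yields preservation of parity as well as the shift by \<open>d\<close>.\<close>
  have Dgr: "D V s \<in> gr Q V"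
    if V: "opn V" "V \<subseteq> ?T" and s: "s \<in> gr P V"
      and PQ: "\<And>i s. i \<in> I \<Longrightarrow> s \<in> gr P (V \<inter> U i) \<Longrightarrow> v i (V \<inter> U i) s \<in> gr Q (V \<inter> U i)" for V s P Q
    unfolding gr_iff
  proof (intro conjI allI impI Dsect[OF V gr_sect[OF s]])
    fix j assume j: "\<not> Q j"
    show "sect_comp j (D V s) = 0"
    proof (rule sect_separated[OF V(1) sect_compI[OF Dsect[OF V gr_sect[OF s]]] zero_sect])
      fix i assume i: "i \<in> I"
      have "v i (V \<inter> U i) (sect_res (V \<inter> U i) s) \<in> gr Q (V \<inter> U i)"
        by (intro PQ[OF i] gr_res[OF s] o[OF V(1) i]) simp
      from gr_comp_eq_0[OF this j]
      show "sect_res (V \<inter> U i) (sect_comp j (D V s)) = sect_res (V \<inter> U i) 0"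
        by (simp add: sect_res_comp key[OF V gr_sect[OF s] i])
    qed
  qed
  have DE: "D \<in> End ?T"
  proof (rule EndI)
    fix V s assume "\<not> (opn V \<and> V \<subseteq> ?T \<and> s \<in> sect V)"
    then show "D V s = 0" unfolding D_def by (rule if_not_P)
  next
    fix V s assume "opn V" "V \<subseteq> ?T" "s \<in> sect V" then show "D V s \<in> sect V" by (rule Dsect)
  next
    fix V s s' assume V: "opn V" "V \<subseteq> ?T" and s: "s \<in> sect V" and s': "s' \<in> sect V"
    show "D V (s + s') = D V s + D V s'"
    proof (rule sect_separated[OF V(1) Dsect[OF V sect_addI[OF s s']] sect_addI[OF Dsect[OF V s] Dsect[OF V s']]])
      fix i assume i: "i \<in> I"
      show "sect_res (V \<inter> U i) (D V (s + s')) = sect_res (V \<inter> U i) (D V s + D V s')"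
        by (simp only: sect_res_add key[OF V _ i] s s' sect_addI[OF s s'] End_add[OF vE[OF i] rs[OF s V(1) i] rs[OF s' V(1) i]])
    qed
  next
    fix V s a assume V: "opn V" "V \<subseteq> ?T" and s: "s \<in> sect V"
    show "D V (sect_scale a s) = sect_scale a (D V s)"
    proof (rule sect_separated[OF V(1) Dsect[OF V sect_scaleI[OF s]] sect_scaleI[OF Dsect[OF V s]]])
      fix i assume i: "i \<in> I"
      show "sect_res (V \<inter> U i) (D V (sect_scale a s)) = sect_res (V \<inter> U i) (sect_scale a (D V s))"
        by (simp only: sect_res_scale key[OF V _ i] s sect_scaleI[OF s] End_scale[OF vE[OF i] rs[OF s V(1) i]])
    qed
  next
    fix V W s assume V: "opn V" "V \<subseteq> ?T" and s: "s \<in> sect V" and W: "opn W" "W \<subseteq> V"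
    note sW = sect_resI[OF s W]
    have WT: "W \<subseteq> ?T" using W V by blast
    show "D W (sect_res W s) = sect_res W (D V s)"
    proof (rule sect_separated[OF W(1) Dsect[OF W(1) WT sW] sect_resI[OF Dsect[OF V s] W]])
      fix i assume i: "i \<in> I"
      have WV: "W \<inter> U i \<subseteq> V \<inter> U i" using W by blast
      have "sect_res (W \<inter> U i) (D W (sect_res W s)) = v i (W \<inter> U i) (sect_res (W \<inter> U i) s)"
      proof -
        have "W \<inter> U i \<inter> W = W \<inter> U i" by blast
        then show ?thesis by (simp only: key[OF W(1) WT sW i] sect_res_res)
      qed
      also have "\<dots> = v i (W \<inter> U i) (sect_res (W \<inter> U i) (sect_res (V \<inter> U i) s))"
        using WV by (simp add: sect_res_res inf.absorb1)
      also have "\<dots> = sect_res (W \<inter> U i) (v i (V \<inter> U i) (sect_res (V \<inter> U i) s))"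
        by (rule End_res[OF vE[OF i] o[OF V(1) i] Int_lower2 rs[OF s V(1) i] o[OF W(1) i] WV])
      also have "\<dots> = sect_res (W \<inter> U i) (sect_res W (D V s))"
      proof -
        have "W \<inter> U i \<inter> (V \<inter> U i) = W \<inter> U i" "W \<inter> U i \<inter> W = W \<inter> U i" using W by blast+
        then show ?thesis by (simp only: key[OF V s i, symmetric] sect_res_res)
      qed
      finally show "sect_res (W \<inter> U i) (D W (sect_res W s)) = sect_res (W \<inter> U i) (sect_res W (D V s))" .
    qed
  next
    fix V s P assume V: "opn V" "V \<subseteq> ?T" and P: "P = even \<or> P = odd" and s: "s \<in> gr P V"
    show "D V s \<in> gr P V" by (rule Dgr[OF V s]) (rule End_parity[OF vE P])
  qed
  have "D \<in> Der ?T"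
  proof (rule DerI[OF DE])
    fix V s s' assume V: "opn V" "V \<subseteq> ?T" and s: "s \<in> sect V" and s': "s' \<in> sect V"
    note m = sect_multI[OF s s'] and D = Dsect[OF V s] Dsect[OF V s']
    show "D V (sect_mult s s') = sect_mult (D V s) s' + sect_mult s (D V s')"
    proof (rule sect_separated[OF V(1) Dsect[OF V m] sect_addI[OF sect_multI[OF D(1) s'] sect_multI[OF s D(2)]]])
      fix i assume i: "i \<in> I"
      note L = Der_mult[OF Der_deg_Der[OF v[OF i]] o[OF V(1) i] Int_lower2 rs[OF s V(1) i] rs[OF s' V(1) i]]
      show "sect_res (V \<inter> U i) (D V (sect_mult s s')) = sect_res (V \<inter> U i) (sect_mult (D V s) s' + sect_mult s (D V s'))"
        by (simp only: sect_res_add sect_res_mult key[OF V _ i] s s' m L)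
    qed
  qed
  moreover have "D \<in> End_deg X B d ?T"
    unfolding End_deg_def
  proof (intro CollectI conjI DE allI impI image_subsetI)
    fix V j s assume "opn V \<and> V \<subseteq> ?T" and s: "s \<in> gr (\<lambda>l. l = j) V"
    then have V: "opn V" "V \<subseteq> ?T" by blast+
    have "v i \<in> End_deg X B d (U i)" if "i \<in> I" for i using v[OF that] by (simp add: Der_deg_def)
    then show "D V s \<in> gr (\<lambda>l. l = j + d) V" using Dgr[OF V s] End_degD(2) by blast
  qed
  moreover have "endo_res (U i) D = v i" if i: "i \<in> I" for i
  proof -
    have "U i \<subseteq> ?T" by (rule cover_subset[OF i])
    then show ?thesis
    proof (intro End_eqI[OF res_End[OF DE] vE[OF i]])
      fix V s assume V: "opn V" "V \<subseteq> U i" "s \<in> sect V"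
      then have VT: "V \<subseteq> ?T" using \<open>U i \<subseteq> ?T\<close> by blast
      have "V \<inter> U i = V" using V by blast
      then have "sect_res V (D V s) = v i V (sect_res V s)" using key[OF V(1) VT V(3) i] by simp
      then show "endo_res (U i) D V s = v i V s"
        using V by (simp add: endo_res_def sect_res_self sect_res_self[OF Dsect[OF V(1) VT V(3)]])
    qed
  qed
  ultimately show ?thesis by (auto simp: Der_deg_def)
qed

text \<open>The form in which the absence of global derivations is used: leading terms that match on
  overlaps must vanish.\<close>

lemma no_global_cochain:
  assumes v: "\<And>i. i \<in> I \<Longrightarrow> v i \<in> Der_deg X B (2 * k) (U i)" and "1 \<le> k"
    and comp: "\<And>i j. i \<in> I \<Longrightarrow> j \<in> I \<Longrightarrow> endo_res (U i \<inter> U j) (v i) = endo_res (U i \<inter> U j) (v j)"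
    and i: "i \<in> I"
  shows "v i = 0"
proof -
  obtain D where D: "D \<in> Der_deg X B (2 * k) (topspace (mtop X))" "\<forall>i\<in>I. endo_res (U i) D = v i"
    using glue_Der_deg[OF v comp] by blast
  have "D \<in> H0_Der2 X B" unfolding H0_Der2_def by (rule Der_deg_Der2[OF D(1) \<open>1 \<le> k\<close>])
  then have "D = 0" using no_global by simp
  then show ?thesis using D(2) i by (metis endo_res_zero)
qed

section \<open>Cocycles and the action on cochains of derivations\<close>

abbreviation "tilde \<equiv> C1_tilde X B I U"
abbreviation "D2 \<equiv> Der2 X B"

lemma C1_D:
  assumes "u \<in> C1 I U S"
  shows "i \<in> I \<Longrightarrow> j \<in> I \<Longrightarrow> u i j \<in> S (U i \<inter> U j)" "i \<in> I \<Longrightarrow> j \<in> I \<Longrightarrow> u j i = - u i j"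
    "\<not> (i \<in> I \<and> j \<in> I) \<Longrightarrow> u i j = 0"
proof -
  note * = assms[unfolded C1_def mem_Collect_eq]
  show "u i j \<in> S (U i \<inter> U j)" if "i \<in> I" "j \<in> I"
    using *[THEN conjunct1, THEN bspec, THEN bspec, OF that] by (rule conjunct1)
  show "u j i = - u i j" if "i \<in> I" "j \<in> I"
    using *[THEN conjunct1, THEN bspec, THEN bspec, OF that] by (rule conjunct2)
  show "u i j = 0" if "\<not> (i \<in> I \<and> j \<in> I)"
    using *[THEN conjunct2, THEN spec, THEN spec, THEN mp, OF that] .
qed

lemma C1_I:
  assumes "\<And>i j. i \<in> I \<Longrightarrow> j \<in> I \<Longrightarrow> u i j \<in> S (U i \<inter> U j)"
    and "\<And>i j. i \<in> I \<Longrightarrow> j \<in> I \<Longrightarrow> u j i = - u i j"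
    and "\<And>i j. \<not> (i \<in> I \<and> j \<in> I) \<Longrightarrow> u i j = 0"
  shows "u \<in> C1 I U S"
  unfolding C1_def by (intro CollectI conjI ballI allI impI; (rule assms; assumption))

lemma tilde_C1: "u \<in> tilde \<Longrightarrow> u \<in> C1 I U D2"
  by (simp add: C1_tilde_def)

lemmas tilde_D = C1_D[OF tilde_C1]

lemma tilde_cocycle:
  assumes "u \<in> tilde" "i \<in> I" "j \<in> I" "k \<in> I"
  shows "mult_d1 I U (exp_cochain X B I U u) i j k = Ident (U i \<inter> U j \<inter> U k)"
proof -
  have "exp_cochain X B I U u \<in> Z1_G X B I U" using assms(1) by (simp add: C1_tilde_def)
  then show ?thesis using assms(2-4) by (simp add: Z1_G_def)
qed

text \<open>Exponentials of derivations are automorphisms of the required kind, so only the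
  multiplicative cocycle identity has to be verified.\<close>

lemma tilde_I:
  assumes "u \<in> C1 I U D2"
    "\<And>i j k. i \<in> I \<Longrightarrow> j \<in> I \<Longrightarrow> k \<in> I \<Longrightarrow> mult_d1 I U (exp_cochain X B I U u) i j k = Ident (U i \<inter> U j \<inter> U k)"
  shows "u \<in> tilde"
proof -
  have "exp_cochain X B I U u i j \<in> G_sheaf X B (U i \<inter> U j)" if "i \<in> I" "j \<in> I" for i j
    using exp_in_G[OF C1_D(1)[OF assms(1) that]] that by (simp add: exp_cochain_def)
  moreover have "\<exists>u'\<in>C1 I U D2. exp_cochain X B I U u = exp_cochain X B I U u'" using assms(1) by blast
  ultimately have "exp_cochain X B I U u \<in> Z1_G X B I U" using assms(2) by (simp add: Z1_G_def)
  then show ?thesis using assms(1) by (simp add: C1_tilde_def)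
qed

lemma mult_exp:
  assumes "i \<in> I" "j \<in> I" "k \<in> I"
  shows "mult_d1 I U (exp_cochain X B I U u) i j k =
    (let W = U i \<inter> U j \<inter> U k in
     Exp W (endo_res W (u i j)) \<bullet>\<bullet> Exp W (endo_res W (u j k)) \<bullet>\<bullet> Exp W (endo_res W (u k i)))"
proof -
  define W where "W = U i \<inter> U j \<inter> U k"
  have "W \<subseteq> U i \<inter> U j" "W \<subseteq> U j \<inter> U k" "W \<subseteq> U k \<inter> U i" unfolding W_def by blast+
  then show ?thesis using assms unfolding mult_d1_def exp_cochain_def W_def[symmetric] Let_def
    by (simp add: exp_res)
qed

lemma C0_D: "v \<in> C0 I U S \<Longrightarrow> i \<in> I \<Longrightarrow> v i \<in> S (U i)" "v \<in> C0 I U S \<Longrightarrow> i \<notin> I \<Longrightarrow> v i = 0"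
  by (simp_all add: C0_def)

lemma C0_I: "(\<And>i. i \<in> I \<Longrightarrow> v i \<in> S (U i)) \<Longrightarrow> (\<And>i. i \<notin> I \<Longrightarrow> v i = 0) \<Longrightarrow> v \<in> C0 I U S"
  by (simp add: C0_def)

definition acts where
  "acts v u u' \<longleftrightarrow> v \<in> C0 I U D2 \<and> u \<in> tilde \<and> u' \<in> tilde \<and>
    exp_cochain X B I U u' = exp_act X B I U v (exp_cochain X B I U u)"

lemma exp_act_apply:
  assumes "i \<in> I" "j \<in> I"
  shows "exp_act X B I U v (exp_cochain X B I U u) i j = (let W = U i \<inter> U j in
    Exp W (endo_res W (v i)) \<bullet>\<bullet> Exp W (u i j) \<bullet>\<bullet> Exp W (- endo_res W (v j)))"
  using assms by (simp add: exp_act_def exp_cochain_def Let_def exp_res endo_res_uminus)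

lemma actsD:
  assumes "acts v u u'" "i \<in> I" "j \<in> I"
  shows "Exp (U i \<inter> U j) (u' i j) = Exp (U i \<inter> U j) (endo_res (U i \<inter> U j) (v i)) \<bullet>\<bullet> Exp (U i \<inter> U j) (u i j)
    \<bullet>\<bullet> Exp (U i \<inter> U j) (- endo_res (U i \<inter> U j) (v j))"
proof -
  have "exp_cochain X B I U u' i j = exp_act X B I U v (exp_cochain X B I U u) i j"
    using assms(1) by (simp add: acts_def)
  then show ?thesis unfolding exp_act_apply[OF assms(2,3)] Let_def using assms by (simp add: exp_cochain_def)
qed

lemma actsI:
  assumes "v \<in> C0 I U D2" "u \<in> tilde" "u' \<in> tilde"
    and "\<And>i j. i \<in> I \<Longrightarrow> j \<in> I \<Longrightarrow> Exp (U i \<inter> U j) (u' i j) = Exp (U i \<inter> U j) (endo_res (U i \<inter> U j) (v i))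
      \<bullet>\<bullet> Exp (U i \<inter> U j) (u i j) \<bullet>\<bullet> Exp (U i \<inter> U j) (- endo_res (U i \<inter> U j) (v j))"
  shows "acts v u u'"
proof -
  have "exp_cochain X B I U u' i j = exp_act X B I U v (exp_cochain X B I U u) i j" for i j
  proof (cases "i \<in> I \<and> j \<in> I")
    case True
    then have "exp_act X B I U v (exp_cochain X B I U u) i j = Exp (U i \<inter> U j) (u' i j)"
      using assms(4) by (simp only: exp_act_apply Let_def)
    then show ?thesis using True by (simp only: exp_cochain_def if_True simp_thms)
  next
    case False
    then show ?thesis by (simp only: exp_cochain_def exp_act_def if_not_P[OF False] if_False)
  qed
  then have "exp_cochain X B I U u' = exp_act X B I U v (exp_cochain X B I U u)"
    by (rule ext[OF ext])
  then show ?thesis using assms(1-3) unfolding acts_def by blast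
qed

lemma acts_tilde: "acts v u u' \<Longrightarrow> u \<in> tilde" "acts v u u' \<Longrightarrow> u' \<in> tilde" "acts v u u' \<Longrightarrow> v \<in> C0 I U D2"
  by (simp_all add: acts_def)

lemma acts_zero: assumes "u \<in> tilde" shows "acts 0 u u"
proof (rule actsI[OF _ assms assms])
  show "0 \<in> C0 I U D2" by (rule C0_I) (simp_all add: zero_fun_apply)
  fix i j assume "i \<in> I" "j \<in> I"
  then have "Exp (U i \<inter> U j) (u i j) \<in> End (U i \<inter> U j)" using exp_End Der2_End tilde_D(1)[OF assms] by blast
  then show "Exp (U i \<inter> U j) (u i j) = Exp (U i \<inter> U j) (endo_res (U i \<inter> U j) (0 i))
      \<bullet>\<bullet> Exp (U i \<inter> U j) (u i j) \<bullet>\<bullet> Exp (U i \<inter> U j) (- endo_res (U i \<inter> U j) (0 j))"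
    by (simp add: zero_fun_apply exp_zero comp_Id)
qed

lemma exp_inverse_left: "u \<in> Fil 2 W \<Longrightarrow> Exp W (- u) \<bullet>\<bullet> Exp W u = Ident W"
  using exp_inverse[of "- u" W] Fil_uminus by simp

text \<open>Each transformed component is a multiplicative map congruent to the identity, hence has
  a logarithm. In the cocycle identity the neighbouring factors coming from \<open>v\<close> cancel,
  and what remains is a conjugate of the identity.\<close>

lemma acts_exists:
  assumes v: "v \<in> C0 I U D2" and u: "u \<in> tilde"
  shows "\<exists>u'. acts v u u'"
proof -
  define \<phi> where "\<phi> i j = Exp (U i \<inter> U j) (endo_res (U i \<inter> U j) (v i)) \<bullet>\<bullet> Exp (U i \<inter> U j) (u i j)
    \<bullet>\<bullet> Exp (U i \<inter> U j) (- endo_res (U i \<inter> U j) (v j))" for i j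
  have vr: "endo_res W (v i) \<in> D2 W" if "i \<in> I" "W \<subseteq> U i" for i W
    using Der2_res[OF C0_D(1)[OF v that(1)] that(2)] .
  have "\<exists>D\<in>D2 (U i \<inter> U j). Exp (U i \<inter> U j) D = \<phi> i j" if ij: "i \<in> I" "j \<in> I" for i j
  proof -
    define W where "W = U i \<inter> U j"
    have D: "endo_res W (v i) \<in> D2 W" "u i j \<in> D2 W" "- endo_res W (v j) \<in> D2 W"
      using vr ij tilde_D(1)[OF u ij] Der2_uminus unfolding W_def by auto
    note E = D[THEN Der2_End, THEN exp_End] and F = D[THEN Der2_Fil, THEN exp_diff_id]
    have \<phi>: "\<phi> i j = Exp W (endo_res W (v i)) \<bullet>\<bullet> Exp W (u i j) \<bullet>\<bullet> Exp W (- endo_res W (v j))"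
      unfolding \<phi>_def W_def ..
    obtain D where "D \<in> D2 W" "Exp W D = \<phi> i j"
    proof (rule log_exists)
      show "\<phi> i j \<in> End W" unfolding \<phi> by (intro comp_End E)
      show "\<phi> i j - Ident W \<in> Fil 2 W" unfolding \<phi> by (intro id_comp_closed comp_End E F)
      fix V s s' assume V: "opn V" "V \<subseteq> W" and s: "s \<in> sect V" "s' \<in> sect V"
      show "\<phi> i j V (sect_mult s s') = sect_mult (\<phi> i j V s) (\<phi> i j V s')"
        unfolding \<phi>
        by (simp add: exp_mult[OF D(1) V] exp_mult[OF D(2) V] exp_mult[OF D(3) V] s End_sect[OF E(1)]
            End_sect[OF E(2)] End_sect[OF E(3)])
    qed blast
    then show ?thesis unfolding W_def by blast
  qed
  then obtain w where w: "\<And>i j. i \<in> I \<Longrightarrow> j \<in> I \<Longrightarrow> w i j \<in> D2 (U i \<inter> U j)"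
    "\<And>i j. i \<in> I \<Longrightarrow> j \<in> I \<Longrightarrow> Exp (U i \<inter> U j) (w i j) = \<phi> i j"
    by metis
  \<comment> \<open>Cochains are required to vanish at indices outside \<open>I\<close>, where the
    chosen logarithms are arbitrary.\<close>
  define u' where "u' i j = (if i \<in> I \<and> j \<in> I then w i j else 0)" for i j
  have u': "u' i j \<in> D2 (U i \<inter> U j)" "Exp (U i \<inter> U j) (u' i j) = \<phi> i j" if "i \<in> I" "j \<in> I" for i j
    using w that by (simp_all add: u'_def)
  have \<phi>_res: "Exp W (endo_res W (u' i j)) = Exp W (endo_res W (v i)) \<bullet>\<bullet> Exp W (endo_res W (u i j)) \<bullet>\<bullet> Exp W (- endo_res W (v j))"
    if "i \<in> I" "j \<in> I" "W \<subseteq> U i \<inter> U j" for i j W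
  proof -
    have "Exp W (endo_res W (u' i j)) = endo_res W (\<phi> i j)"
      unfolding u'(2)[OF that(1,2), symmetric] by (rule exp_res[OF that(3), symmetric])
    then show ?thesis unfolding \<phi>_def
      using that(3) by (simp add: endo_res_comp exp_res endo_res_uminus endo_res_res inf.absorb1)
  qed
  \<comment> \<open>Bracketed so that it cancels adjacent factors of \<open>v j\<close> in the
    middle of a long product.\<close>
  have inv: "F \<bullet>\<bullet> Exp W (- endo_res W (v j)) \<bullet>\<bullet> (Exp W (endo_res W (v j)) \<bullet>\<bullet> G) = F \<bullet>\<bullet> G"
    if "j \<in> I" "W \<subseteq> U j" "G \<in> End W" for F G W j
  proof -
    have "F \<bullet>\<bullet> Exp W (- endo_res W (v j)) \<bullet>\<bullet> (Exp W (endo_res W (v j)) \<bullet>\<bullet> G)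
      = F \<bullet>\<bullet> ((Exp W (- endo_res W (v j)) \<bullet>\<bullet> Exp W (endo_res W (v j))) \<bullet>\<bullet> G)"
      by (simp only: endo_comp_assoc)
    then show ?thesis using exp_inverse_left[OF Der2_Fil[OF vr[OF that(1,2)]]] comp_Id[OF that(3)] by simp
  qed
  have "u' \<in> tilde"
  proof (rule tilde_I)
    \<comment> \<open>The logarithms were chosen independently for (i, j) and (j, i). Their
      exponentials are mutually inverse, and injectivity of the exponential turns this into a change
      of sign.\<close>
    have alt: "u' j i = - u' i j" if ij: "i \<in> I" "j \<in> I" for i j
    proof -
      define W where "W = U i \<inter> U j"
      have W: "W \<subseteq> U i \<inter> U j" "W \<subseteq> U j \<inter> U i" "W \<subseteq> U i" "W \<subseteq> U j" unfolding W_def by blast+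
      have m: "u' i j \<in> D2 W" "u' j i \<in> D2 W" "u i j \<in> D2 W" "u j i \<in> D2 W"
        using u'(1)[OF ij] u'(1)[OF ij(2,1)] tilde_D(1)[OF u ij] tilde_D(1)[OF u ij(2,1)]
        unfolding W_def by (simp_all add: Int_commute)
      note self = m[THEN Der2_End, THEN res_self]
      note vi = vr[OF ij(1) W(3)] and vj = vr[OF ij(2) W(4)]
      have E: "Exp W (u j i) \<bullet>\<bullet> Exp W (- endo_res W (v i)) \<in> End W"
        using m vi by (intro comp_End exp_End Der2_End Der2_uminus)
      have "Exp W (u' i j) \<bullet>\<bullet> Exp W (u' j i) = Exp W (endo_res W (v i)) \<bullet>\<bullet> Exp W (u i j) \<bullet>\<bullet> Exp W (- endo_res W (v j))
          \<bullet>\<bullet> (Exp W (endo_res W (v j)) \<bullet>\<bullet> (Exp W (u j i) \<bullet>\<bullet> Exp W (- endo_res W (v i))))"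
        using \<phi>_res[OF ij W(1)] \<phi>_res[OF ij(2,1) W(2)] self by (simp only: endo_comp_assoc)
      also have "\<dots> = Exp W (endo_res W (v i)) \<bullet>\<bullet> Exp W (u i j) \<bullet>\<bullet> (Exp W (u j i) \<bullet>\<bullet> Exp W (- endo_res W (v i)))"
        by (rule inv[OF ij(2) W(4) E])
      also have "\<dots> = Exp W (endo_res W (v i)) \<bullet>\<bullet> ((Exp W (u i j) \<bullet>\<bullet> Exp W (- u i j)) \<bullet>\<bullet> Exp W (- endo_res W (v i)))"
        using tilde_D(2)[OF u ij] by (simp only: endo_comp_assoc)
      also have "\<dots> = Ident W"
        using exp_inverse[OF Der2_Fil[OF m(3)]] exp_inverse[OF Der2_Fil[OF vi]]
          comp_Id(2)[OF exp_End[OF Der2_End[OF Der2_uminus[OF vi]]]] by simp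
      finally have "Exp W (u' i j) \<bullet>\<bullet> Exp W (u' j i) = Ident W" .
      then have "Exp W (- u' i j) \<bullet>\<bullet> Exp W (u' i j) \<bullet>\<bullet> Exp W (u' j i) = Exp W (- u' i j) \<bullet>\<bullet> Ident W"
        by (simp only: endo_comp_assoc)
      then have "Exp W (u' j i) = Exp W (- u' i j)"
        using exp_inverse_left[OF Der2_Fil[OF m(1)]] m(1,2)
        by (simp only: comp_Id exp_End Der2_End Der2_uminus)
      then show ?thesis by (rule exp_inj[rotated 2]) (use m in \<open>auto intro: Der2_Fil Der2_uminus\<close>)
    qed
    show "u' \<in> C1 I U D2"
    proof (rule C1_I)
      show "u' i j \<in> D2 (U i \<inter> U j)" if "i \<in> I" "j \<in> I" for i j using u'(1) that .
      show "u' j i = - u' i j" if "i \<in> I" "j \<in> I" for i j using alt that .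
      show "u' i j = 0" if "\<not> (i \<in> I \<and> j \<in> I)" for i j unfolding u'_def by (rule if_not_P[OF that])
    qed
    fix i j k assume ijk: "i \<in> I" "j \<in> I" "k \<in> I"
    define W where "W = U i \<inter> U j \<inter> U k"
    have W: "W \<subseteq> U i \<inter> U j" "W \<subseteq> U j \<inter> U k" "W \<subseteq> U k \<inter> U i" "W \<subseteq> U i" "W \<subseteq> U j" "W \<subseteq> U k"
      unfolding W_def by blast+
    define a b c where abc: "a = Exp W (endo_res W (u i j))" "b = Exp W (endo_res W (u j k))" "c = Exp W (endo_res W (u k i))"
    have E: "a \<in> End W" "b \<in> End W" "c \<in> End W"
      unfolding abc
      by (intro exp_End res_End[OF Der2_End[OF tilde_D(1)[OF u]]] ijk W)+
    have vE: "Exp W (- endo_res W (v l)) \<in> End W" if "l \<in> I" "W \<subseteq> U l" for l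
      using vr[OF that] by (intro exp_End uminus_End Der2_End)
    note vi = vr[OF ijk(1) W(4)]
    have "mult_d1 I U (exp_cochain X B I U u') i j k =
      Exp W (endo_res W (v i)) \<bullet>\<bullet> a \<bullet>\<bullet> Exp W (- endo_res W (v j)) \<bullet>\<bullet> (Exp W (endo_res W (v j)) \<bullet>\<bullet>
        (b \<bullet>\<bullet> Exp W (- endo_res W (v k)) \<bullet>\<bullet> (Exp W (endo_res W (v k)) \<bullet>\<bullet> (c \<bullet>\<bullet> Exp W (- endo_res W (v i))))))"
      unfolding mult_exp[OF ijk] Let_def W_def[symmetric] abc
      by (simp only: \<phi>_res[OF ijk(1,2) W(1)] \<phi>_res[OF ijk(2,3) W(2)] \<phi>_res[OF ijk(3,1) W(3)] endo_comp_assoc)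
    also have "\<dots> = Exp W (endo_res W (v i)) \<bullet>\<bullet> a \<bullet>\<bullet> Exp W (- endo_res W (v j)) \<bullet>\<bullet> (Exp W (endo_res W (v j)) \<bullet>\<bullet>
        (b \<bullet>\<bullet> (c \<bullet>\<bullet> Exp W (- endo_res W (v i)))))"
      by (subst inv[OF ijk(3) W(6) comp_End[OF E(3) vE[OF ijk(1) W(4)]]]) (rule refl)
    also have "\<dots> = Exp W (endo_res W (v i)) \<bullet>\<bullet> a \<bullet>\<bullet> (b \<bullet>\<bullet> (c \<bullet>\<bullet> Exp W (- endo_res W (v i))))"
      by (rule inv[OF ijk(2) W(5) comp_End[OF E(2) comp_End[OF E(3) vE[OF ijk(1) W(4)]]]])
    also have "\<dots> = Exp W (endo_res W (v i)) \<bullet>\<bullet> ((a \<bullet>\<bullet> b \<bullet>\<bullet> c) \<bullet>\<bullet> Exp W (- endo_res W (v i)))"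
      by (simp only: endo_comp_assoc)
    also have "a \<bullet>\<bullet> b \<bullet>\<bullet> c = Ident W"
      using tilde_cocycle[OF u ijk] unfolding mult_exp[OF ijk] Let_def W_def[symmetric] abc .
    also have "Exp W (endo_res W (v i)) \<bullet>\<bullet> (Ident W \<bullet>\<bullet> Exp W (- endo_res W (v i))) = Ident W"
      using exp_inverse[OF Der2_Fil[OF vi]] comp_Id(2)[OF vE[OF ijk(1) W(4)]] by simp
    finally show "mult_d1 I U (exp_cochain X B I U u') i j k = Ident (U i \<inter> U j \<inter> U k)" unfolding W_def .
  qed
  then have "acts v u u'"
    using u'(2) unfolding \<phi>_def by (intro actsI[OF v u])
  then show ?thesis by (rule exI[of _ u'])
qed

lemma acts_uminus: assumes "acts v u u'" shows "acts (- v) u' u"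
proof (rule actsI)
  note v = acts_tilde(3)[OF assms] and u = acts_tilde(1)[OF assms]
  show "- v \<in> C0 I U D2"
    using C0_D[OF v] by (intro C0_I) (simp_all add: uminus_apply Der2_uminus)
  show "u' \<in> tilde" "u \<in> tilde" using acts_tilde assms by blast+
  fix i j assume ij: "i \<in> I" "j \<in> I"
  define W where "W = U i \<inter> U j"
  define a b where "a = endo_res W (v i)" and "b = endo_res W (v j)"
  have D: "a \<in> D2 W" "b \<in> D2 W" "u i j \<in> D2 W"
    unfolding a_def b_def W_def using C0_D(1)[OF v] ij tilde_D(1)[OF u ij] by (auto intro: Der2_res)
  have E: "Exp W (u i j) \<in> End W" using D exp_End Der2_End by blast
  have "Exp W (- a) \<bullet>\<bullet> Exp W (u' i j) \<bullet>\<bullet> Exp W b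
    = (Exp W (- a) \<bullet>\<bullet> Exp W a) \<bullet>\<bullet> Exp W (u i j) \<bullet>\<bullet> (Exp W (- b) \<bullet>\<bullet> Exp W b)"
    using actsD[OF assms ij] unfolding W_def[symmetric] a_def b_def by (simp only: endo_comp_assoc)
  then have "Exp W (- a) \<bullet>\<bullet> Exp W (u' i j) \<bullet>\<bullet> Exp W b = Exp W (u i j)"
    using D[THEN Der2_Fil] by (simp only: exp_inverse_left comp_Id[OF E])
  then show "Exp (U i \<inter> U j) (u i j) = Exp (U i \<inter> U j) (endo_res (U i \<inter> U j) ((- v) i))
      \<bullet>\<bullet> Exp (U i \<inter> U j) (u' i j) \<bullet>\<bullet> Exp (U i \<inter> U j) (- endo_res (U i \<inter> U j) ((- v) j))"
    unfolding W_def a_def b_def by (simp only: uminus_apply endo_res_uminus minus_minus)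
qed

text \<open>The product of the exponentials of \<open>w i\<close> and \<open>v i\<close> is again
  the exponential of some derivation, so the two actions combine into one.\<close>

lemma acts_trans: assumes 1: "acts v u u'" and 2: "acts w u' u''" shows "\<exists>z. acts z u u''"
proof -
  note v = acts_tilde(3)[OF 1] and w = acts_tilde(3)[OF 2]
  have "\<exists>D\<in>D2 (U i). Exp (U i) D = Exp (U i) (w i) \<bullet>\<bullet> Exp (U i) (v i)" if i: "i \<in> I" for i
  proof -
    note D = C0_D(1)[OF w i] C0_D(1)[OF v i]
    note E = D[THEN Der2_End, THEN exp_End] and F = D[THEN Der2_Fil, THEN exp_diff_id]
    obtain D where "D \<in> D2 (U i)" "Exp (U i) D = Exp (U i) (w i) \<bullet>\<bullet> Exp (U i) (v i)"
    proof (rule log_exists)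
      show "Exp (U i) (w i) \<bullet>\<bullet> Exp (U i) (v i) \<in> End (U i)" by (intro comp_End E)
      show "Exp (U i) (w i) \<bullet>\<bullet> Exp (U i) (v i) - Ident (U i) \<in> Fil 2 (U i)" by (intro id_comp_closed E F)
      fix V s s' assume V: "opn V" "V \<subseteq> U i" and s: "s \<in> sect V" "s' \<in> sect V"
      show "(Exp (U i) (w i) \<bullet>\<bullet> Exp (U i) (v i)) V (sect_mult s s')
        = sect_mult ((Exp (U i) (w i) \<bullet>\<bullet> Exp (U i) (v i)) V s) ((Exp (U i) (w i) \<bullet>\<bullet> Exp (U i) (v i)) V s')"
        by (simp add: exp_mult[OF D(1) V] exp_mult[OF D(2) V] s End_sect[OF E(2)])
    qed blast
    then show ?thesis by blast
  qed
  then obtain z0 where z0: "\<And>i. i \<in> I \<Longrightarrow> z0 i \<in> D2 (U i)"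
    "\<And>i. i \<in> I \<Longrightarrow> Exp (U i) (z0 i) = Exp (U i) (w i) \<bullet>\<bullet> Exp (U i) (v i)"
    by metis
  define z where "z i = (if i \<in> I then z0 i else 0)" for i
  have zC: "z \<in> C0 I U D2" by (rule C0_I) (simp_all add: z_def z0)
  have "acts z u u''"
  proof (rule actsI[OF zC acts_tilde(1)[OF 1] acts_tilde(2)[OF 2]])
    fix i j assume ij: "i \<in> I" "j \<in> I"
    define W where "W = U i \<inter> U j"
    have W: "W \<subseteq> U i" "W \<subseteq> U j" unfolding W_def by blast+
    have R: "endo_res W (v l) \<in> D2 W" "endo_res W (w l) \<in> D2 W" "endo_res W (z l) \<in> D2 W" if "l \<in> I" "W \<subseteq> U l" for l
      by (rule Der2_res[OF C0_D(1)[OF v that(1)] that(2)] Der2_res[OF C0_D(1)[OF w that(1)] that(2)]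
          Der2_res[OF C0_D(1)[OF zC that(1)] that(2)])+
    have z: "Exp W (endo_res W (z l)) = Exp W (endo_res W (w l)) \<bullet>\<bullet> Exp W (endo_res W (v l))" if "l \<in> I" "W \<subseteq> U l" for l
      using arg_cong[OF z0(2)[OF that(1)], of "endo_res W"] that by (simp add: endo_res_comp exp_res z_def)
    \<comment> \<open>The right-hand factor of the action involves the exponential of
      \<open>- z\<close>; it is the inverse of the product and therefore has the reversed
      order.\<close>
    have zi: "Exp W (- endo_res W (z l)) = Exp W (- endo_res W (v l)) \<bullet>\<bullet> Exp W (- endo_res W (w l))" if l: "l \<in> I" "W \<subseteq> U l" for l
    proof -
      define a b c where abc: "a = endo_res W (v l)" "b = endo_res W (w l)" "c = endo_res W (z l)"
      have D: "a \<in> D2 W" "b \<in> D2 W" "c \<in> D2 W" unfolding abc using R[OF l] by blast+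
      note E = D[THEN Der2_uminus, THEN Der2_End, THEN exp_End] D[THEN Der2_End, THEN exp_End]
      have "Exp W (- a) \<bullet>\<bullet> Exp W (- b) = Exp W (- a) \<bullet>\<bullet> Exp W (- b) \<bullet>\<bullet> (Exp W c \<bullet>\<bullet> Exp W (- c))"
        using exp_inverse[OF Der2_Fil[OF D(3)]] comp_Id(1)[OF comp_End[OF E(1,2)]] by simp
      also have "\<dots> = Exp W (- a) \<bullet>\<bullet> ((Exp W (- b) \<bullet>\<bullet> Exp W b) \<bullet>\<bullet> (Exp W a \<bullet>\<bullet> Exp W (- c)))"
        using z[OF l] unfolding abc by (simp only: endo_comp_assoc)
      also have "\<dots> = Exp W (- a) \<bullet>\<bullet> (Exp W a \<bullet>\<bullet> Exp W (- c))"
        using exp_inverse_left[OF Der2_Fil[OF D(2)]] comp_Id(2)[OF comp_End[OF E(4,3)]] by simp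
      also have "\<dots> = (Exp W (- a) \<bullet>\<bullet> Exp W a) \<bullet>\<bullet> Exp W (- c)" by (simp only: endo_comp_assoc)
      also have "\<dots> = Exp W (- c)"
        using exp_inverse_left[OF Der2_Fil[OF D(1)]] comp_Id(2)[OF E(3)] by simp
      finally show ?thesis unfolding abc by (rule sym)
    qed
    have "Exp W (u'' i j) = Exp W (endo_res W (z i)) \<bullet>\<bullet> Exp W (u i j) \<bullet>\<bullet> Exp W (- endo_res W (z j))"
      using actsD[OF 1 ij] actsD[OF 2 ij] unfolding W_def[symmetric] z[OF ij(1) W(1)] zi[OF ij(2) W(2)]
      by (simp only: endo_comp_assoc)
    then show "Exp (U i \<inter> U j) (u'' i j) = Exp (U i \<inter> U j) (endo_res (U i \<inter> U j) (z i))
      \<bullet>\<bullet> Exp (U i \<inter> U j) (u i j) \<bullet>\<bullet> Exp (U i \<inter> U j) (- endo_res (U i \<inter> U j) (z j))" unfolding W_def .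
  qed
  then show ?thesis by (rule exI[of _ z])
qed

section \<open>The orbit relation\<close>

definition cohomologous where "cohomologous u u' \<longleftrightarrow> (\<exists>v. acts v u u')"

lemma cohomologous_refl: "u \<in> tilde \<Longrightarrow> cohomologous u u"
  and cohomologous_sym: "cohomologous u u' \<Longrightarrow> cohomologous u' u"
  and cohomologous_trans: "cohomologous u u' \<Longrightarrow> cohomologous u' u'' \<Longrightarrow> cohomologous u u''"
  and cohomologous_tilde: "cohomologous u u' \<Longrightarrow> u \<in> tilde" "cohomologous u u' \<Longrightarrow> u' \<in> tilde"
  unfolding cohomologous_def using acts_zero acts_uminus acts_trans acts_tilde by blast+

lemma C1_eqI:
  assumes "u \<in> tilde" "u' \<in> tilde" "\<And>i j. i \<in> I \<Longrightarrow> j \<in> I \<Longrightarrow> u i j = u' i j" shows "u = u'"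
proof (rule ext, rule ext)
  fix i j
  show "u i j = u' i j"
  proof (cases "i \<in> I \<and> j \<in> I")
    case False
    show ?thesis unfolding tilde_D(3)[OF assms(1) False] tilde_D(3)[OF assms(2) False] ..
  qed (use assms(3) in blast)
qed

lemma exp_cochain_inj:
  assumes "u \<in> tilde" "u' \<in> tilde" "exp_cochain X B I U u = exp_cochain X B I U u'" shows "u = u'"
proof (rule C1_eqI[OF assms(1,2)])
  fix i j assume ij: "i \<in> I" "j \<in> I"
  then have "Exp (U i \<inter> U j) (u i j) = Exp (U i \<inter> U j) (u' i j)"
    using fun_cong[OF fun_cong[OF assms(3), of i], of j] by (simp add: exp_cochain_def)
  then show "u i j = u' i j"
    using tilde_D(1)[OF assms(1) ij] tilde_D(1)[OF assms(2) ij] exp_inj Der2_Fil by blast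
qed

lemma G_class_exp:
  assumes "u \<in> tilde"
  shows "G_class X B I U (exp_cochain X B I U u) = exp_cochain X B I U ` {u'. cohomologous u u'}"
proof (intro equalityI subsetI)
  fix g assume "g \<in> G_class X B I U (exp_cochain X B I U u)"
  then obtain v where v: "v \<in> C0 I U D2" "g = exp_act X B I U v (exp_cochain X B I U u)"
    unfolding G_class_def by blast
  obtain u' where u': "acts v u u'" using acts_exists[OF v(1) assms] by blast
  then have "cohomologous u u'" unfolding cohomologous_def by blast
  moreover have "g = exp_cochain X B I U u'" using u' v(2) unfolding acts_def by simp
  ultimately show "g \<in> exp_cochain X B I U ` {u'. cohomologous u u'}" by blast
next
  fix g assume "g \<in> exp_cochain X B I U ` {u'. cohomologous u u'}"
  then show "g \<in> G_class X B I U (exp_cochain X B I U u)"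
    unfolding G_class_def cohomologous_def acts_def by blast
qed

text \<open>Orbits consist of automorphism cochains; injectivity of the exponential allows them to
  be treated as classes of derivation cochains.\<close>

lemma G_class_eq_iff:
  assumes u: "u \<in> tilde" "u' \<in> tilde"
  shows "G_class X B I U (exp_cochain X B I U u) = G_class X B I U (exp_cochain X B I U u') \<longleftrightarrow> cohomologous u u'"
proof
  assume "cohomologous u u'"
  then have "{y. cohomologous u y} = {y. cohomologous u' y}" using cohomologous_sym cohomologous_trans by blast
  then show "G_class X B I U (exp_cochain X B I U u) = G_class X B I U (exp_cochain X B I U u')"
    unfolding G_class_exp[OF u(1)] G_class_exp[OF u(2)] by (rule arg_cong)
next
  assume "G_class X B I U (exp_cochain X B I U u) = G_class X B I U (exp_cochain X B I U u')"
  then have "exp_cochain X B I U u' \<in> exp_cochain X B I U ` {y. cohomologous u y}"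
    using cohomologous_refl[OF u(2)] unfolding G_class_exp[OF u(1)] G_class_exp[OF u(2)] by blast
  then obtain y where "cohomologous u y" "exp_cochain X B I U u' = exp_cochain X B I U y" by blast
  then show "cohomologous u u'" using exp_cochain_inj[OF u(2)] cohomologous_tilde(2) by blast
qed

end

section \<open>Truncations and the obstruction maps\<close>

context covered_bundle
begin

text \<open>Agreement below degree \<open>2q\<close>, expressed by the filtration so that
  first-order estimates apply to it directly. For \<open>q = 1\<close> it holds between any two
  cocycles.\<close>

definition trunc_eq :: "nat \<Rightarrow> ('i, 'm, 'e) cochain1 \<Rightarrow> ('i, 'm, 'e) cochain1 \<Rightarrow> bool" where
  "trunc_eq q u u' \<longleftrightarrow> (\<forall>i\<in>I. \<forall>j\<in>I. u i j - u' i j \<in> Fil (2 * q) (U i \<inter> U j))"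

lemma trunc_eqD: "trunc_eq q u u' \<Longrightarrow> i \<in> I \<Longrightarrow> j \<in> I \<Longrightarrow> u i j - u' i j \<in> Fil (2 * q) (U i \<inter> U j)"
  by (simp only: trunc_eq_def)

lemma trunc_eq_1: assumes "u \<in> tilde" "u' \<in> tilde" shows "trunc_eq 1 u u'"
proof -
  have "u i j - u' i j \<in> Fil (2 * 1) (U i \<inter> U j)" if "i \<in> I" "j \<in> I" for i j
    using Fil_diff[OF Der2_Fil[OF tilde_D(1)[OF assms(1) that]] Der2_Fil[OF tilde_D(1)[OF assms(2) that]]]
    by (simp only: mult_1_right)
  then show ?thesis unfolding trunc_eq_def by blast
qed

lemma pr_upto_apply: "pr_upto X B k u i j = (\<Sum>l=1..k. prj (2 * l) (u i j))"
  unfolding pr_upto_def sum_fun_apply pr_cochain_def ..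

lemma pr_upto_in_Der2: assumes "u \<in> tilde" "i \<in> I" "j \<in> I" shows "pr_upto X B k u i j \<in> D2 (U i \<inter> U j)"
  unfolding pr_upto_apply
proof (rule sum_induct_closed[where P = "\<lambda>F. F \<in> D2 (U i \<inter> U j)"])
  fix l assume "l \<in> {1..k}"
  then show "prj (2 * l) (u i j) \<in> D2 (U i \<inter> U j)"
    using Der_deg_Der2[OF Der2_pr[OF tilde_D(1)[OF assms], of l]] by simp
qed (auto intro: Der2_add)

lemma diff_pr_upto:
  assumes "u \<in> tilde" "i \<in> I" "j \<in> I" "1 \<le> q"
  shows "u i j - pr_upto X B (q - 1) u i j \<in> Fil (2 * q) (U i \<inter> U j)"
proof -
  have "2 * (q - 1) + 2 = 2 * q" using assms(4) by simp
  then show ?thesis using Der2_truncation[OF tilde_D(1)[OF assms(1-3)], of "q - 1"]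
    unfolding pr_upto_apply by simp
qed

lemma pr_trunc_eq:
  assumes "trunc_eq q u u'" "i \<in> I" "j \<in> I" "l < q" shows "prj (2 * l) (u i j) = prj (2 * l) (u' i j)"
  using pr_Fil_eq_0[OF trunc_eqD[OF assms(1-3)], of "2 * l"] assms(4) by (simp add: pr_diff)

text \<open>A cochain in \<open>tilde\<close> differs from its truncation by terms of degree at
  least \<open>2q\<close>; conversely such terms have no components below \<open>2q\<close>.\<close>

lemma pr_upto_eq_iff:
  assumes u: "u \<in> tilde" "u' \<in> tilde" and q: "1 \<le> q"
  shows "pr_upto X B (q - 1) u = pr_upto X B (q - 1) u' \<longleftrightarrow> trunc_eq q u u'"
proof
  assume eq: "pr_upto X B (q - 1) u = pr_upto X B (q - 1) u'"
  have "u i j - u' i j \<in> Fil (2 * q) (U i \<inter> U j)" if "i \<in> I" "j \<in> I" for i j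
    using Fil_diff[OF diff_pr_upto[OF u(1) that q] diff_pr_upto[OF u(2) that q]] unfolding eq by simp
  then show "trunc_eq q u u'" unfolding trunc_eq_def by blast
next
  assume t: "trunc_eq q u u'"
  show "pr_upto X B (q - 1) u = pr_upto X B (q - 1) u'"
  proof (rule ext, rule ext)
    fix i j
    show "pr_upto X B (q - 1) u i j = pr_upto X B (q - 1) u' i j"
    proof (cases "i \<in> I \<and> j \<in> I")
      case True
      then have ij: "i \<in> I" "j \<in> I" by blast+
      show ?thesis unfolding pr_upto_apply
      proof (rule sum.cong[OF refl])
        fix l assume "l \<in> {1..q - 1}"
        then show "prj (2 * l) (u i j) = prj (2 * l) (u' i j)"
          by (intro pr_trunc_eq[OF t ij]) auto
      qed
    next
      case False
      show ?thesis unfolding pr_upto_apply tilde_D(3)[OF u(1) False] tilde_D(3)[OF u(2) False] ..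
    qed
  qed
qed

text \<open>The basic comparison: if two actions start from cochains and 0-cochains agreeing below
  degree \<open>2q\<close>, the results differ, modulo degree \<open>2q + 2\<close>, by the
  difference of the starting cochains and the coboundary-like difference of the 0-cochains. All
  products of exponents cancel to this order.\<close>

lemma acts_difference:
  assumes u: "acts g u u'" and x: "acts h x x'" and q: "1 \<le> q"
    and ux: "trunc_eq q u x" and gh: "\<And>i. i \<in> I \<Longrightarrow> g i - h i \<in> Fil (2 * q) (U i)"
    and ij: "i \<in> I" "j \<in> I"
  shows "u' i j - x' i j - (endo_res (U i \<inter> U j) (g i - h i) + (u i j - x i j) - endo_res (U i \<inter> U j) (g j - h j))
    \<in> Fil (2 * q + 2) (U i \<inter> U j)"
proof -
  define W where "W = U i \<inter> U j"
  have W: "W \<subseteq> U i" "W \<subseteq> U j" unfolding W_def by blast+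
  note g = C0_D(1)[OF acts_tilde(3)[OF u]] and h = C0_D(1)[OF acts_tilde(3)[OF x]]
  define a a' b b' where ab: "a = endo_res W (g i)" "a' = endo_res W (h i)" "b = endo_res W (g j)" "b' = endo_res W (h j)"
  have F: "a \<in> Fil 2 W" "a' \<in> Fil 2 W" "u i j \<in> Fil 2 W" "x i j \<in> Fil 2 W" "- b \<in> Fil 2 W" "- b' \<in> Fil 2 W"
    "u' i j \<in> Fil 2 W" "x' i j \<in> Fil 2 W"
    unfolding ab using Der2_Fil[OF tilde_D(1)[OF acts_tilde(1)[OF u] ij]] Der2_Fil[OF tilde_D(1)[OF acts_tilde(1)[OF x] ij]]
      Der2_Fil[OF tilde_D(1)[OF acts_tilde(2)[OF u] ij]] Der2_Fil[OF tilde_D(1)[OF acts_tilde(2)[OF x] ij]]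
    by (auto simp: W_def intro!: Fil_uminus Fil_res Der2_Fil[OF g] Der2_Fil[OF h] ij)
  have aa: "a - a' \<in> Fil (2 * q) W" "b - b' \<in> Fil (2 * q) W"
    unfolding ab endo_res_diff[symmetric] by (rule Fil_res[OF gh[OF ij(1)] W(1)] Fil_res[OF gh[OF ij(2)] W(2)])+
  have bb: "- b - - b' \<in> Fil (2 * q) W" using Fil_uminus[OF aa(2)] by simp
  have uxW: "u i j - x i j \<in> Fil (2 * q) W" using trunc_eqD[OF ux ij] unfolding W_def .
  define T where "T = (a - a') + (u i j - x i j) + (- b - - b')"
  have T: "T \<in> Fil (2 * q) W" unfolding T_def by (intro Fil_add aa uxW bb)
  have 1: "Exp W (u' i j) - Exp W (x' i j) - T \<in> Fil (2 * q + 2) W"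
    using exp_triple[OF F(1-6) aa(1) uxW bb] actsD[OF u ij] actsD[OF x ij]
    unfolding W_def[symmetric] ab[symmetric] T_def by (simp only:)
  \<comment> \<open>The estimate concerns exponentials. A coarser version of it first shows that the
    exponents agree below degree \<open>2q\<close>, which is what permits passing to the exponents
    without loss.\<close>
  have "Exp W (u' i j) - Exp W (x' i j) - T \<in> Fil (2 * q) W" by (rule Fil_mono[OF 1]) simp
  from Fil_add[OF this T] have "Exp W (u' i j) - Exp W (x' i j) \<in> Fil (2 * q) W" by simp
  then have "u' i j - x' i j \<in> Fil (2 * q) W"
    using exp_diff_Fil_iff[OF F(7,8) q] by blast
  from exp_first_order[OF F(7,8) this]
  have "Exp W (u' i j) - Exp W (x' i j) - T - (Exp W (u' i j) - Exp W (x' i j) - (u' i j - x' i j)) \<in> Fil (2 * q + 2) W"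
    by (rule Fil_diff[OF 1])
  moreover have "Exp W (u' i j) - Exp W (x' i j) - T - (Exp W (u' i j) - Exp W (x' i j) - (u' i j - x' i j))
    = u' i j - x' i j - (endo_res W (g i - h i) + (u i j - x i j) - endo_res W (g j - h j))"
    unfolding T_def ab by (simp add: endo_res_diff)
  ultimately show ?thesis unfolding W_def by (simp only:)
qed

text \<open>With the same 0-cochain on both sides the extra terms of the comparison vanish; thus the
  action descends to truncations.\<close>

lemma acts_trunc_eq:
  assumes u: "acts v u u'" and x: "acts v x x'" and q: "1 \<le> q" and ux: "trunc_eq q u x"
  shows "trunc_eq q u' x'"
proof -
  have "u' i j - x' i j \<in> Fil (2 * q) (U i \<inter> U j)" if ij: "i \<in> I" "j \<in> I" for i j
  proof -
    have "u' i j - x' i j - (u i j - x i j) \<in> Fil (2 * q + 2) (U i \<inter> U j)"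
      using acts_difference[OF u x q ux _ ij] by simp
    then have "u' i j - x' i j - (u i j - x i j) \<in> Fil (2 * q) (U i \<inter> U j)" by (rule Fil_mono) simp
    from Fil_add[OF this trunc_eqD[OF ux ij]] show ?thesis by simp
  qed
  then show ?thesis unfolding trunc_eq_def by blast
qed

text \<open>Here the absence of global derivations enters. It forces \<open>g\<close> and
  \<open>h\<close> to agree below degree \<open>2q\<close>, and then the component of
  \<open>g - h\<close> of degree \<open>2q\<close> is the 0-cochain sought.\<close>

lemma acts_coboundary:
  assumes u: "acts g u u'" and x: "acts h x x'" and q: "1 \<le> q"
    and ux: "trunc_eq q u x" and ux': "trunc_eq q u' x'"
  shows "\<exists>w. (\<forall>i\<in>I. w i \<in> Der_deg X B (2 * q) (U i)) \<and> (\<forall>i\<in>I. \<forall>j\<in>I.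
    prj (2 * q) (u' i j) - prj (2 * q) (x' i j) - (prj (2 * q) (u i j) - prj (2 * q) (x i j))
      = endo_res (U i \<inter> U j) (w i) - endo_res (U i \<inter> U j) (w j))"
proof -
  note g = C0_D(1)[OF acts_tilde(3)[OF u]] and h = C0_D(1)[OF acts_tilde(3)[OF x]]
  have gh: "g i - h i \<in> D2 (U i)" if "i \<in> I" for i using g[OF that] h[OF that] by (rule Der2_diff)
  have mono: "trunc_eq k u x" "trunc_eq k u' x'" if "k \<le> q" for k
    using that ux ux' unfolding trunc_eq_def by (meson Fil_mono mult_le_mono2)+
  \<comment> \<open>Agreement of \<open>g\<close> and \<open>h\<close> is raised by one even degree
    at a time; in degree 2 and above there is nothing to show at the start.\<close>
  have close: "\<forall>i\<in>I. g i - h i \<in> Fil (2 * Suc k) (U i)" if "Suc k \<le> q" for k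
    using that
  proof (induction k)
    case 0
    have "2 * Suc 0 = 2" by simp
    then show ?case using Der2_Fil[OF gh] by (simp only:) blast
  next
    case (Suc k)
    let ?q = "Suc k"
    have IH: "\<And>i. i \<in> I \<Longrightarrow> g i - h i \<in> Fil (2 * ?q) (U i)"
      using Suc.IH[OF Suc_leD[OF Suc.prems]] by blast
    have q2: "2 * ?q + 2 = 2 * Suc ?q" by simp
    have "endo_res (U i \<inter> U j) (prj (2 * ?q) (g i - h i)) = endo_res (U i \<inter> U j) (prj (2 * ?q) (g j - h j))"
      if ij: "i \<in> I" "j \<in> I" for i j
    proof -
      let ?W = "U i \<inter> U j" and ?d = "\<lambda>i. g i - h i"
      have *: "u' i j - x' i j - (endo_res ?W (?d i) + (u i j - x i j) - endo_res ?W (?d j)) \<in> Fil (2 * ?q + 2) ?W"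
        by (rule acts_difference[OF u x _ mono(1) IH ij]) (use Suc.prems in simp_all)
      \<comment> \<open>Below the final degree both differences of 1-cochains are negligible, so the
        comparison reduces to the two restrictions of \<open>g - h\<close>.\<close>
      have t: "u' i j - x' i j \<in> Fil (2 * ?q + 2) ?W" "u i j - x i j \<in> Fil (2 * ?q + 2) ?W"
        unfolding q2 by (rule trunc_eqD[OF mono(2)[OF Suc.prems] ij] trunc_eqD[OF mono(1)[OF Suc.prems] ij])+
      have "u' i j - x' i j - (u i j - x i j) - (u' i j - x' i j - (endo_res ?W (?d i) + (u i j - x i j) - endo_res ?W (?d j)))
        \<in> Fil (2 * ?q + 2) ?W"
        by (rule Fil_diff[OF Fil_diff[OF t] *])
      moreover have "u' i j - x' i j - (u i j - x i j) - (u' i j - x' i j - (endo_res ?W (?d i) + (u i j - x i j) - endo_res ?W (?d j)))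
        = endo_res ?W (?d i) - endo_res ?W (?d j)" by (simp add: algebra_simps)
      ultimately have "endo_res ?W (?d i) - endo_res ?W (?d j) \<in> Fil (2 * ?q + 2) ?W" by (simp only:)
      then have "prj (2 * ?q) (endo_res ?W (?d i) - endo_res ?W (?d j)) = 0" by (rule pr_Fil_eq_0) simp
      then have "prj (2 * ?q) (endo_res ?W (?d i)) - prj (2 * ?q) (endo_res ?W (?d j)) = 0" by (simp only: pr_diff)
      then show ?thesis by (simp only: pr_res right_minus_eq)
    qed
    note compat = this
    \<comment> \<open>The leading terms of \<open>g - h\<close> match on overlaps and therefore form
      a global derivation.\<close>
    have "prj (2 * ?q) (g i - h i) = 0" if i: "i \<in> I" for i
    proof (rule no_global_cochain[where v = "\<lambda>i. prj (2 * ?q) (g i - h i)" and k = ?q])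
      show "prj (2 * ?q) (g i - h i) \<in> Der_deg X B (2 * ?q) (U i)" if "i \<in> I" for i
        by (rule Der2_pr[OF gh[OF that]]) simp
    qed (use compat i in simp_all)
    then have "g i - h i \<in> Fil (2 * ?q + 2) (U i)" if "i \<in> I" for i
      using Fil_step_iff[OF IH[OF that]] that by simp
    then show ?case unfolding q2 by blast
  qed
  have c: "g i - h i \<in> Fil (2 * q) (U i)" if "i \<in> I" for i
    using close[of "q - 1"] q that by simp
  show ?thesis
  proof (intro exI[of _ "\<lambda>i. prj (2 * q) (g i - h i)"] conjI ballI)
    fix i assume "i \<in> I" then show "prj (2 * q) (g i - h i) \<in> Der_deg X B (2 * q) (U i)"
      using Der2_pr[OF gh q] by blast
  next
    fix i j assume ij: "i \<in> I" "j \<in> I"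
    let ?W = "U i \<inter> U j" and ?d = "\<lambda>i. g i - h i"
    have "prj (2 * q) (u' i j - x' i j - (endo_res ?W (?d i) + (u i j - x i j) - endo_res ?W (?d j))) = 0"
      by (rule pr_Fil_eq_0[OF acts_difference[OF u x q ux c ij]]) simp_all
    then have "prj (2 * q) (u' i j) - prj (2 * q) (x' i j) - (endo_res ?W (prj (2 * q) (?d i))
      + (prj (2 * q) (u i j) - prj (2 * q) (x i j)) - endo_res ?W (prj (2 * q) (?d j))) = 0"
      by (simp only: pr_diff pr_add pr_res)
    then show "prj (2 * q) (u' i j) - prj (2 * q) (x' i j) - (prj (2 * q) (u i j) - prj (2 * q) (x i j))
      = endo_res ?W (prj (2 * q) (?d i)) - endo_res ?W (prj (2 * q) (?d j))"
      by (simp add: algebra_simps)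
  qed
qed

text \<open>Acting by a homogeneous 0-cochain of degree \<open>2q\<close> leaves the lower degrees
  untouched and changes degree \<open>2q\<close> by a prescribed coboundary. It is the move by which
  one cocycle is pushed into another.\<close>

lemma adjust_top_degree:
  assumes u: "u \<in> tilde" and q: "1 \<le> q" and w: "\<And>i. i \<in> I \<Longrightarrow> w i \<in> Der_deg X B (2 * q) (U i)"
  shows "\<exists>u'. cohomologous u u' \<and> (\<forall>i\<in>I. \<forall>j\<in>I.
    u' i j - u i j - (endo_res (U i \<inter> U j) (w i) - endo_res (U i \<inter> U j) (w j)) \<in> Fil (2 * q + 2) (U i \<inter> U j))"
proof -
  define v where "v i = (if i \<in> I then w i else 0)" for i
  have v: "v \<in> C0 I U D2"
    by (rule C0_I) (simp_all add: v_def Der_deg_Der2[OF w q])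
  obtain u' where u': "acts v u u'" using acts_exists[OF v u] by blast
  have "u' i j - u i j - (endo_res (U i \<inter> U j) (w i) - endo_res (U i \<inter> U j) (w j)) \<in> Fil (2 * q + 2) (U i \<inter> U j)"
    if ij: "i \<in> I" "j \<in> I" for i j
  proof -
    \<comment> \<open>The basic comparison is applied to the action of \<open>v\<close> and the
      trivial action on the same cocycle.\<close>
    have "u' i j - u i j - (endo_res (U i \<inter> U j) (v i - 0 i) + (u i j - u i j) - endo_res (U i \<inter> U j) (v j - 0 j))
      \<in> Fil (2 * q + 2) (U i \<inter> U j)"
    proof (rule acts_difference[OF u' acts_zero[OF u] q _ _ ij])
      show "trunc_eq q u u" by (simp add: trunc_eq_def)
      show "v i - 0 i \<in> Fil (2 * q) (U i)" if "i \<in> I" for i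
        using Der_deg_Fil[OF w[OF that]] that by (simp add: v_def zero_fun_apply)
    qed
    then show ?thesis using ij by (simp add: v_def zero_fun_apply)
  qed
  then show ?thesis using u' unfolding cohomologous_def by blast
qed

lemma pr_pr_upto:
  assumes u: "u \<in> tilde" and ij: "i \<in> I" "j \<in> I" and "1 \<le> q"
  shows "prj (2 * q) (pr_upto X B (q - 1) u i j) = 0"
  unfolding pr_upto_apply pr_sum
proof (rule sum.neutral, rule ballI)
  fix l assume "l \<in> {1..q - 1}"
  then have "2 * q \<noteq> 2 * l" using \<open>1 \<le> q\<close> by auto
  then show "prj (2 * q) (prj (2 * l) (u i j)) = 0"
    by (rule pr_deg_other[OF pr_End_deg[OF Der2_End[OF tilde_D(1)[OF u ij]]]])
qed

text \<open>The exponentials of the full cocycle multiply to the identity. Replacing each exponent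
  by its truncation changes the product, in degree \<open>2q\<close>, by minus the sum of the
  omitted components, which is minus a coboundary.\<close>

lemma R_map_apply:
  assumes u: "u \<in> tilde" and q: "1 \<le> q" and ijk: "i \<in> I" "j \<in> I" "k \<in> I"
  shows "R_map X B I U q u i j k = - d1 I U (pr_cochain X B (2 * q) u) i j k"
proof -
  define W where "W = U i \<inter> U j \<inter> U k"
  have W: "W \<subseteq> U i \<inter> U j" "W \<subseteq> U j \<inter> U k" "W \<subseteq> U k \<inter> U i" unfolding W_def by blast+
  let ?t = "pr_upto X B (q - 1) u" and ?p = "prj (2 * q)" and ?r = "endo_res W"
  define M where "M = Exp W (?r (?t i j)) \<bullet>\<bullet> Exp W (?r (?t j k)) \<bullet>\<bullet> Exp W (?r (?t k i))"
  have F: "?r (u l m) \<in> Fil 2 W" "?r (?t l m) \<in> Fil 2 W" "?r (u l m) - ?r (?t l m) \<in> Fil (2 * q) W"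
    if lm: "l \<in> I" "m \<in> I" "W \<subseteq> U l \<inter> U m" for l m
    using Fil_res[OF Der2_Fil[OF tilde_D(1)[OF u lm(1,2)]] lm(3)]
      Fil_res[OF Der2_Fil[OF pr_upto_in_Der2[OF u lm(1,2)]] lm(3)]
      Fil_res[OF diff_pr_upto[OF u lm(1,2) q] lm(3)]
    by (simp_all only: endo_res_diff)
  \<comment> \<open>The truncation has no component of degree \<open>2q\<close>, so only that of
    \<open>u\<close> is left.\<close>
  have pd: "?p (?r (u l m) - ?r (?t l m)) = ?r (?p (u l m))" if "l \<in> I" "m \<in> I" for l m
    using pr_pr_upto[OF u that q] by (simp add: pr_diff pr_res)
  have "Exp W (?r (u i j)) \<bullet>\<bullet> Exp W (?r (u j k)) \<bullet>\<bullet> Exp W (?r (u k i)) = Ident W"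
    using tilde_cocycle[OF u ijk] unfolding mult_exp[OF ijk] Let_def W_def[symmetric] .
  then have "Ident W - M - ((?r (u i j) - ?r (?t i j)) + (?r (u j k) - ?r (?t j k)) + (?r (u k i) - ?r (?t k i)))
      \<in> Fil (2 * q + 2) W"
    using exp_triple[OF F(1)[OF ijk(1,2) W(1)] F(2)[OF ijk(1,2) W(1)] F(1)[OF ijk(2,3) W(2)] F(2)[OF ijk(2,3) W(2)]
      F(1)[OF ijk(3,1) W(3)] F(2)[OF ijk(3,1) W(3)] F(3)[OF ijk(1,2) W(1)] F(3)[OF ijk(2,3) W(2)] F(3)[OF ijk(3,1) W(3)]]
    unfolding M_def by (simp only:)
  then have "?p (Ident W - M - ((?r (u i j) - ?r (?t i j)) + (?r (u j k) - ?r (?t j k)) + (?r (u k i) - ?r (?t k i)))) = 0"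
    by (rule pr_Fil_eq_0) simp
  moreover have "?p (Ident W) = 0" using q by (intro pr_Id) simp
  ultimately have "- ?p M - (?r (?p (u i j)) + ?r (?p (u j k)) + ?r (?p (u k i))) = 0"
    using pd[OF ijk(1,2)] pd[OF ijk(2,3)] pd[OF ijk(3,1)] by (simp only: pr_diff[of _ _ M] pr_diff[of _ "_ - M"] pr_add) simp
  then have "- ?p M = ?r (?p (u i j)) + ?r (?p (u j k)) + ?r (?p (u k i))"
    by (simp only: right_minus_eq)
  then have "?p M = - (?r (?p (u i j)) + ?r (?p (u j k)) + ?r (?p (u k i)))"
    by (rule minus_equation_iff[THEN iffD1, symmetric])
  \<comment> \<open>The multiplicative coboundary runs through (k, i), the additive one through (i,
    k); alternation accounts for the sign.\<close>
  also have "?p (u k i) = - ?p (u i k)" using tilde_D(2)[OF u ijk(1,3)] by (simp only: pr_uminus)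
  also have "- (?r (?p (u i j)) + ?r (?p (u j k)) + ?r (- ?p (u i k)))
      = - (?r (?p (u j k)) - ?r (?p (u i k)) + ?r (?p (u i j)))"
    unfolding endo_res_uminus by (simp add: algebra_simps)
  finally have "?p M = - (?r (?p (u j k)) - ?r (?p (u i k)) + ?r (?p (u i j)))" .
  moreover have "R_map X B I U q u i j k = ?p M"
    unfolding R_map_def mult_exp[OF ijk] Let_def W_def[symmetric] M_def ..
  ultimately show ?thesis
    using ijk by (simp add: d1_def pr_cochain_def W_def)
qed

lemma R_map_eq:
  assumes u: "u \<in> tilde" and q: "1 \<le> q"
  shows "R_map X B I U q u = - d1 I U (pr_cochain X B (2 * q) u)"
proof (rule ext, rule ext, rule ext)
  fix i j k
  show "R_map X B I U q u i j k = (- d1 I U (pr_cochain X B (2 * q) u)) i j k"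
  proof (cases "i \<in> I \<and> j \<in> I \<and> k \<in> I")
    case True
    then show ?thesis using R_map_apply[OF u q] by (simp only: uminus_apply)
  next
    case False
    have "R_map X B I U q u i j k = 0"
      unfolding R_map_def mult_d1_def if_not_P[OF False] by (rule pr_zero)
    moreover have "d1 I U (pr_cochain X B (2 * q) u) i j k = 0"
      unfolding d1_def by (rule if_not_P[OF False])
    ultimately show ?thesis by (simp only: uminus_apply minus_zero)
  qed
qed

lemma R_map_cong: "pr_upto X B (q - 1) u = pr_upto X B (q - 1) u' \<Longrightarrow> R_map X B I U q u = R_map X B I U q u'"
  unfolding R_map_def by simp

section \<open>Coboundaries and additive cohomology classes\<close>

lemma d1_add: "d1 I U (u + u') = d1 I U u + d1 I U (u' :: ('i, 'm, 'e) cochain1)"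
proof (rule ext, rule ext, rule ext)
  fix i j k
  show "d1 I U (u + u') i j k = (d1 I U u + d1 I U u') i j k"
  proof (cases "i \<in> I \<and> j \<in> I \<and> k \<in> I")
    case True
    then show ?thesis by (simp add: d1_def plus_fun_apply endo_res_add)
  next
    case False
    then show ?thesis by (simp only: d1_def plus_fun_apply if_not_P[OF False] if_False add_0_right)
  qed
qed

lemma d1_zero: "d1 I U 0 = (0 :: ('i, 'm, 'e) cochain2)"
  using d1_add[of "0 :: ('i, 'm, 'e) cochain1" 0] by simp

lemma d1_uminus: "d1 I U (- u) = - d1 I U (u :: ('i, 'm, 'e) cochain1)"
  using d1_add[of u "- u"] by (simp add: d1_zero eq_neg_iff_add_eq_0 add.commute)

lemma d1_sum: "d1 I U (sum f S) = (\<Sum>q\<in>S. d1 I U (f q :: ('i, 'm, 'e) cochain1))"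
  using sum_comp_morphism[of "d1 I U" f S] by (simp add: d1_add d1_zero comp_def)

lemma d0_add: "d0 I U (v + v') = d0 I U v + (d0 I U v' :: ('i, 'm, 'e) cochain1)"
proof (rule ext, rule ext)
  fix i j
  show "d0 I U (v + v') i j = (d0 I U v + d0 I U v') i j"
    by (simp add: d0_def plus_fun_apply endo_res_add)
qed

lemma d0_zero: "d0 I U 0 = (0 :: ('i, 'm, 'e) cochain1)"
  using d0_add[of 0 0] by simp

lemma C0_D2_add:
  assumes "v \<in> C0 I U D2" "w \<in> C0 I U D2" shows "v + w \<in> C0 I U D2"
proof (rule C0_I)
  show "(v + w) i \<in> D2 (U i)" if "i \<in> I" for i
    using C0_D(1)[OF assms(1) that] C0_D(1)[OF assms(2) that] by (simp only: plus_fun_apply Der2_add)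
  show "(v + w) i = 0" if "i \<notin> I" for i
    by (simp only: plus_fun_apply C0_D(2)[OF assms(1) that] C0_D(2)[OF assms(2) that] add_0_left)
qed

lemma C0_D2_uminus:
  assumes "v \<in> C0 I U D2" shows "- v \<in> C0 I U D2"
proof (rule C0_I)
  show "(- v) i \<in> D2 (U i)" if "i \<in> I" for i
    using C0_D(1)[OF assms that] by (simp only: uminus_apply Der2_uminus)
  show "(- v) i = 0" if "i \<notin> I" for i
    by (simp only: uminus_apply C0_D(2)[OF assms that] minus_zero)
qed

lemma C0_D2_zero: "0 \<in> C0 I U D2"
  by (rule C0_I) (simp_all add: zero_fun_apply)

lemma Der2_class_eqI:
  assumes w: "w \<in> C0 I U D2" and c: "c' = c + d0 I U w"
  shows "Der2_class X B I U c' = Der2_class X B I U c"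
proof (intro equalityI subsetI)
  fix z assume "z \<in> Der2_class X B I U c'"
  then obtain v where v: "v \<in> C0 I U D2" "z = c' + d0 I U v" unfolding Der2_class_def by blast
  have "z = c + d0 I U (w + v)" unfolding v(2) c d0_add by (simp only: add.assoc)
  then show "z \<in> Der2_class X B I U c" unfolding Der2_class_def using C0_D2_add[OF w v(1)] by blast
next
  fix z assume "z \<in> Der2_class X B I U c"
  then obtain v where v: "v \<in> C0 I U D2" "z = c + d0 I U v" unfolding Der2_class_def by blast
  have "d0 I U w + d0 I U (- w + v) = d0 I U v" unfolding d0_add[symmetric] by simp
  then have "z = c' + d0 I U (- w + v)" unfolding v(2) c by (simp only: add.assoc)
  then show "z \<in> Der2_class X B I U c'"
    unfolding Der2_class_def using C0_D2_add[OF C0_D2_uminus[OF w] v(1)] by blast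
qed

lemma Der2_class_eqD:
  assumes "Der2_class X B I U c = Der2_class X B I U c'"
  obtains v where "v \<in> C0 I U D2" "c' = c + d0 I U v"
proof -
  have "c' = c' + d0 I U 0" by (simp only: d0_zero add_0_right)
  then have "c' \<in> Der2_class X B I U c'"
    unfolding Der2_class_def using C0_D2_zero by (intro CollectI exI[of _ 0] conjI)
  then have "c' \<in> Der2_class X B I U c" by (simp only: assms)
  then have "\<exists>v. c' = c + d0 I U v \<and> v \<in> C0 I U D2" unfolding Der2_class_def by (rule CollectD)
  then show ?thesis using that by blast
qed

section \<open>Orbits of truncations and the choice of transported cocycles\<close>

definition truncated_orbit :: "nat \<Rightarrow> ('i, 'm, 'e) cochain1 \<Rightarrow> ('i, 'm, 'e) cochain1 set" where
  "truncated_orbit q t = {y. \<exists>y'. cohomologous y y' \<and> pr_upto X B (q - 1) y' = t}"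

text \<open>The inner choice depends on the orbit of the truncation \<open>t\<close> only, not on \<open>t\<close>.\<close>

definition transported :: "nat \<Rightarrow> ('i, 'm, 'e) cochain1 \<Rightarrow> ('i, 'm, 'e) cochain1" where
  "transported q t = (SOME w. cohomologous (SOME y. y \<in> truncated_orbit q t) w \<and> pr_upto X B (q - 1) w = t)"

abbreviation "sel q u \<equiv> transported q (pr_upto X B (q - 1) u)"

lemma transported_spec: assumes "u \<in> tilde"
  shows "cohomologous (SOME y. y \<in> truncated_orbit q (pr_upto X B (q - 1) u)) (sel q u) \<and> pr_upto X B (q - 1) (sel q u) = pr_upto X B (q - 1) u"
proof -
  have "u \<in> truncated_orbit q (pr_upto X B (q - 1) u)" unfolding truncated_orbit_def using cohomologous_refl[OF assms] by blast
  then have "(SOME y. y \<in> truncated_orbit q (pr_upto X B (q - 1) u)) \<in> truncated_orbit q (pr_upto X B (q - 1) u)"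
    by (rule someI[where P = "\<lambda>y. y \<in> truncated_orbit q (pr_upto X B (q - 1) u)"])
  then have "\<exists>w. cohomologous (SOME y. y \<in> truncated_orbit q (pr_upto X B (q - 1) u)) w \<and> pr_upto X B (q - 1) w = pr_upto X B (q - 1) u"
    unfolding truncated_orbit_def by blast
  then show ?thesis unfolding transported_def by (rule someI_ex)
qed

lemma sel_tilde: "u \<in> tilde \<Longrightarrow> sel q u \<in> tilde"
  using transported_spec cohomologous_tilde(2) by blast

lemma sel_trunc_eq: assumes "u \<in> tilde" "1 \<le> q" shows "trunc_eq q u (sel q u)"
  by (rule pr_upto_eq_iff[OF assms(1) sel_tilde[OF assms(1)] assms(2), THEN iffD1])
    (rule conjunct2[OF transported_spec[OF assms(1)], symmetric])

lemma sel_cong: assumes "u \<in> tilde" "u' \<in> tilde" "1 \<le> q" "trunc_eq q u u'" shows "sel q u = sel q u'"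
  using pr_upto_eq_iff[OF assms(1-3)] assms(4) by simp

text \<open>The 0-cochain moving \<open>u\<close> to \<open>u'\<close> is applied to the witness
  \<open>y'\<close>. As \<open>y'\<close> and \<open>u\<close> have the same truncation, so have
  their images.\<close>

lemma truncated_orbit_subset:
  assumes "cohomologous u u'" and q: "1 \<le> q"
  shows "truncated_orbit q (pr_upto X B (q - 1) u) \<subseteq> truncated_orbit q (pr_upto X B (q - 1) u')"
proof
  fix y assume "y \<in> truncated_orbit q (pr_upto X B (q - 1) u)"
  then obtain y' where y': "cohomologous y y'" "pr_upto X B (q - 1) y' = pr_upto X B (q - 1) u" unfolding truncated_orbit_def by blast
  note tilde = cohomologous_tilde[OF assms(1)] cohomologous_tilde(2)[OF y'(1)]
  obtain v where v: "acts v u u'" using assms(1) unfolding cohomologous_def by blast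
  obtain z where z: "acts v y' z" using acts_exists[OF acts_tilde(3)[OF v] tilde(3)] by blast
  have "trunc_eq q y' u" using pr_upto_eq_iff[OF tilde(3,1) q] y'(2) by blast
  then have "trunc_eq q z u'" by (rule acts_trunc_eq[OF z v q])
  then have "pr_upto X B (q - 1) z = pr_upto X B (q - 1) u'"
    using pr_upto_eq_iff[OF acts_tilde(2)[OF z] tilde(2) q] by blast
  moreover have "cohomologous y z" using cohomologous_trans[OF y'(1)] z unfolding cohomologous_def by blast
  ultimately show "y \<in> truncated_orbit q (pr_upto X B (q - 1) u')" unfolding truncated_orbit_def by blast
qed

text \<open>For cohomologous \<open>u\<close> and \<open>u'\<close> the base point of the choice is
  the same, and both selected cocycles are obtained from it by the action.\<close>

lemma sel_cohomologous: assumes "cohomologous u u'" and q: "1 \<le> q" shows "cohomologous (sel q u) (sel q u')"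
proof -
  have "truncated_orbit q (pr_upto X B (q - 1) u) = truncated_orbit q (pr_upto X B (q - 1) u')"
    using truncated_orbit_subset[OF assms] truncated_orbit_subset[OF cohomologous_sym[OF assms(1)] q] by blast
  then have "cohomologous (SOME y. y \<in> truncated_orbit q (pr_upto X B (q - 1) u)) (sel q u')"
    using transported_spec[OF cohomologous_tilde(2)[OF assms(1)], of q] by simp
  with transported_spec[OF cohomologous_tilde(1)[OF assms(1)], of q] show ?thesis
    by (blast intro: cohomologous_sym cohomologous_trans)
qed

section \<open>The correction terms and the components of the corrected cochain\<close>

definition correction :: "nat \<Rightarrow> ('i, 'm, 'e) cochain1 \<Rightarrow> ('i, 'm, 'e) cochain1" where
  "correction q u = - pr_cochain X B (2 * q) (sel q u)"

lemma correction_apply: "correction q u i j = - prj (2 * q) (sel q u i j)"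
  by (simp add: correction_def pr_cochain_def uminus_apply)

lemma pr_cochain_C1:
  assumes u: "u \<in> tilde" and q: "1 \<le> q" shows "- pr_cochain X B (2 * q) u \<in> C1 I U (Der_deg X B (2 * q))"
proof (rule C1_I)
  fix i j assume ij: "i \<in> I" "j \<in> I"
  show "(- pr_cochain X B (2 * q) u) i j \<in> Der_deg X B (2 * q) (U i \<inter> U j)"
    using Der_deg_uminus[OF Der2_pr[OF tilde_D(1)[OF u ij] q]] by (simp add: pr_cochain_def uminus_apply)
  show "(- pr_cochain X B (2 * q) u) j i = - (- pr_cochain X B (2 * q) u) i j"
    using tilde_D(2)[OF u ij] by (simp only: pr_cochain_def uminus_apply pr_uminus)
next
  fix i j assume "\<not> (i \<in> I \<and> j \<in> I)"
  from tilde_D(3)[OF u this] show "(- pr_cochain X B (2 * q) u) i j = 0"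
    by (simp only: pr_cochain_def uminus_apply pr_zero minus_zero)
qed

text \<open>\<open>R_map\<close> cannot distinguish \<open>u\<close> from the selected cocycle, and
  for the latter the identity \<open>R_map_eq\<close> already exhibits the required
  primitive.\<close>

lemma d1_correction:
  assumes u: "u \<in> tilde" and q: "1 \<le> q" shows "d1 I U (correction q u) = R_map X B I U q u"
proof -
  have "R_map X B I U q u = R_map X B I U q (sel q u)"
    using transported_spec[OF u, of q] by (intro R_map_cong) simp
  then show ?thesis unfolding correction_def d1_uminus using R_map_eq[OF sel_tilde[OF u] q] by simp
qed

lemma correction_admissible: "admissible_family X B I U correction"
  unfolding admissible_family_def
proof (intro allI impI conjI ballI)
  fix q :: nat and u assume "2 \<le> q" and u: "u \<in> tilde"
  then have q: "1 \<le> q" by simp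
  show "correction q u \<in> C1 I U (Der_deg X B (2 * q))"
    unfolding correction_def by (rule pr_cochain_C1[OF sel_tilde[OF u] q])
  show "d1 I U (correction q u) = R_map X B I U q u" by (rule d1_correction[OF u q])
  fix u' assume "pr_upto X B (q - 1) u = pr_upto X B (q - 1) u'"
  then show "correction q u = correction q u'" unfolding correction_def by simp
qed

text \<open>The component of degree \<open>2q\<close> of the corrected cochain. The exception for
  \<open>q = 1\<close> reflects that corrections begin in degree 4.\<close>

definition corrected_part :: "nat \<Rightarrow> ('i, 'm, 'e) cochain1 \<Rightarrow> ('i, 'm, 'e) cochain1" where
  "corrected_part q u i j = prj (2 * q) (u i j) - (if q = 1 then 0 else prj (2 * q) (sel q u i j))"

lemma corrected_eq: "corrected B correction u i j = u i j + (\<Sum>q=2..rank B. correction q u i j)"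
  by (simp only: corrected_def plus_fun_apply sum_fun_apply)

lemma corrected_apply:
  assumes u: "u \<in> tilde" and ij: "i \<in> I" "j \<in> I"
  shows "corrected B correction u i j = (\<Sum>q=1..rank B. corrected_part q u i j)"
proof -
  have "(\<Sum>q=1..rank B. if q = 1 then 0 else prj (2 * q) (sel q u i j)) = (\<Sum>q=2..rank B. prj (2 * q) (sel q u i j))"
    by (rule sum.mono_neutral_cong_right) auto
  then have "(\<Sum>q=1..rank B. corrected_part q u i j) = u i j - (\<Sum>q=2..rank B. prj (2 * q) (sel q u i j))"
    unfolding corrected_part_def sum_subtractf using Der2_decomp[OF tilde_D(1)[OF u ij]] by simp
  then show ?thesis unfolding corrected_eq correction_apply sum_negf by simp
qed

lemma corrected_outside:
  assumes u: "u \<in> tilde" and ij: "\<not> (i \<in> I \<and> j \<in> I)" shows "corrected B correction u i j = 0"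
proof -
  have "correction q u i j = 0" for q
    unfolding correction_apply tilde_D(3)[OF sel_tilde[OF u] ij] pr_zero by simp
  then show ?thesis
    by (simp only: corrected_eq tilde_D(3)[OF u ij] sum.neutral_const add_0_right)
qed

lemma corrected_part_Der_deg:
  assumes u: "u \<in> tilde" and ij: "i \<in> I" "j \<in> I" and q: "1 \<le> q"
  shows "corrected_part q u i j \<in> Der_deg X B (2 * q) (U i \<inter> U j)"
  using Der2_pr[OF tilde_D(1)[OF u ij] q] Der2_pr[OF tilde_D(1)[OF sel_tilde[OF u] ij] q]
  by (auto simp: corrected_part_def intro: Der_deg_diff)

lemma pr_corrected:
  assumes u: "u \<in> tilde" and ij: "i \<in> I" "j \<in> I" and p: "p \<in> {1..rank B}"
  shows "prj (2 * p) (corrected B correction u i j) = corrected_part p u i j"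
proof -
  have "prj (2 * p) (corrected_part q u i j) = (if q = p then corrected_part p u i j else 0)" if "q \<in> {1..rank B}" for q
    using corrected_part_Der_deg[OF u ij, of q] that pr_deg_self pr_deg_other[of "corrected_part q u i j" "2 * q" "U i \<inter> U j" "2 * p"]
    by (auto simp: Der_deg_def)
  then have "(\<Sum>q=1..rank B. prj (2 * p) (corrected_part q u i j)) = (\<Sum>q=1..rank B. if q = p then corrected_part p u i j else 0)"
    by (intro sum.cong refl)
  then show ?thesis unfolding corrected_apply[OF u ij] pr_sum using p by simp
qed

text \<open>The exception for \<open>q = 1\<close> disappears in differences: all cocycles share the
  empty truncation, so the selected cocycle is constant and cancels. Degree 2 can then be treated
  like the others.\<close>

lemma corrected_part_diff:
  assumes "u \<in> tilde" "u' \<in> tilde" "1 \<le> q"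
  shows "corrected_part q u' i j - corrected_part q u i j =
    prj (2 * q) (u' i j) - prj (2 * q) (sel q u' i j) - (prj (2 * q) (u i j) - prj (2 * q) (sel q u i j))"
proof (cases "q = 1")
  case True
  have "sel 1 u = sel 1 u'" by (intro sel_cong assms trunc_eq_1) simp
  then show ?thesis unfolding corrected_part_def True by simp
qed (simp add: corrected_part_def)

text \<open>\<open>acts_coboundary\<close> applied to \<open>u\<close> and \<open>u'\<close> paired
  with their selected cocycles; both pairs agree below degree \<open>2q\<close>, and the selected
  cocycles are cohomologous.\<close>

lemma corrected_part_coboundary:
  assumes "cohomologous u u'" and q: "1 \<le> q"
  shows "\<exists>w. (\<forall>i\<in>I. w i \<in> Der_deg X B (2 * q) (U i)) \<and> (\<forall>i\<in>I. \<forall>j\<in>I.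
    corrected_part q u' i j - corrected_part q u i j = endo_res (U i \<inter> U j) (w i) - endo_res (U i \<inter> U j) (w j))"
proof -
  note u = cohomologous_tilde[OF assms(1)]
  obtain g where g: "acts g u u'" using assms(1) unfolding cohomologous_def by blast
  obtain h where h: "acts h (sel q u) (sel q u')" using sel_cohomologous[OF assms] unfolding cohomologous_def by blast
  show ?thesis
    unfolding corrected_part_diff[OF u q]
    by (rule acts_coboundary[OF g h q sel_trunc_eq[OF u(1) q] sel_trunc_eq[OF u(2) q]])
qed

lemma endo_res_sum: "endo_res W (sum f S) = (\<Sum>i\<in>S. endo_res W (f i))"
  using sum_comp_morphism[of "endo_res W" f S] by (simp add: endo_res_add comp_def)

lemma Der2_sum: "(\<And>i. i \<in> S \<Longrightarrow> f i \<in> D2 W) \<Longrightarrow> sum f S \<in> D2 W"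
  by (rule sum_induct_closed[where P = "\<lambda>F. F \<in> D2 W"]) (auto intro: Der2_add)

lemma cohomologous_corrected:
  assumes s: "cohomologous u u'"
  shows "Der2_class X B I U (corrected B correction u) = Der2_class X B I U (corrected B correction u')"
proof -
  note u = cohomologous_tilde[OF s]
  obtain w where w: "\<And>q i. 1 \<le> q \<Longrightarrow> i \<in> I \<Longrightarrow> w q i \<in> Der_deg X B (2 * q) (U i)"
    "\<And>q i j. 1 \<le> q \<Longrightarrow> i \<in> I \<Longrightarrow> j \<in> I \<Longrightarrow>
      corrected_part q u' i j - corrected_part q u i j = endo_res (U i \<inter> U j) (w q i) - endo_res (U i \<inter> U j) (w q j)"
    using corrected_part_coboundary[OF s] by metis
  \<comment> \<open>The sign is reversed because \<open>d0\<close> takes the value at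
    \<open>j\<close> minus that at \<open>i\<close>, while the action produces the opposite
    difference.\<close>
  define Z where "Z i = (if i \<in> I then - (\<Sum>q=1..rank B. w q i) else 0)" for i
  have Z: "Z \<in> C0 I U D2"
  proof (rule C0_I)
    fix i assume i: "i \<in> I"
    have "(\<Sum>q=1..rank B. w q i) \<in> D2 (U i)"
    proof (rule Der2_sum)
      fix q assume "q \<in> {1..rank B}"
      then have q: "1 \<le> q" by simp
      show "w q i \<in> D2 (U i)" by (rule Der_deg_Der2[OF w(1)[OF q i] q])
    qed
    then show "Z i \<in> D2 (U i)" using i by (simp add: Z_def Der2_uminus)
  qed (simp add: Z_def)
  have "corrected B correction u' = corrected B correction u + d0 I U Z"
  proof (rule ext, rule ext)
    fix i j
    show "corrected B correction u' i j = (corrected B correction u + d0 I U Z) i j"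
    proof (cases "i \<in> I \<and> j \<in> I")
      case True
      then have ij: "i \<in> I" "j \<in> I" by blast+
      let ?r = "endo_res (U i \<inter> U j)"
      have "corrected B correction u' i j - corrected B correction u i j = (\<Sum>q=1..rank B. corrected_part q u' i j - corrected_part q u i j)"
        by (simp only: corrected_apply[OF u(1) ij] corrected_apply[OF u(2) ij] sum_subtractf)
      also have "\<dots> = (\<Sum>q=1..rank B. ?r (w q i) - ?r (w q j))"
        using ij by (intro sum.cong refl w(2)) auto
      also have "\<dots> = d0 I U Z i j"
        using ij by (simp add: d0_def Z_def endo_res_uminus endo_res_sum sum_subtractf)
      finally show ?thesis by (simp only: plus_fun_apply diff_eq_eq add.commute)
    next
      case False
      have "d0 I U Z i j = 0" unfolding d0_def by (rule if_not_P[OF False])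
      then show ?thesis
        by (simp only: plus_fun_apply[of "corrected B correction u"] plus_fun_apply[of "corrected B correction u i"]
            corrected_outside[OF u(1) False] corrected_outside[OF u(2) False] add_0_right)
    qed
  qed
  then show ?thesis using Der2_class_eqI[OF Z] by metis
qed

text \<open>Injectivity. Starting from \<open>u\<close>, a cocycle in its orbit is improved until it
  agrees with \<open>u'\<close> in all degrees. At each stage both have the same selected cocycle,
  so equality of classes makes the discrepancy in the next degree a coboundary, which the action can
  remove.\<close>

lemma corrected_cohomologous:
  assumes u: "u \<in> tilde" "u' \<in> tilde"
    and eq: "Der2_class X B I U (corrected B correction u) = Der2_class X B I U (corrected B correction u')"
  shows "cohomologous u u'"
proof -
  obtain v where v: "v \<in> C0 I U D2" and c: "corrected B correction u' = corrected B correction u + d0 I U v"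
    using Der2_class_eqD[OF eq] .
  \<comment> \<open>Equality of classes is used separately in every degree, since projections
    commute with restrictions.\<close>
  have corrected_part: "corrected_part p u' i j - corrected_part p u i j = endo_res (U i \<inter> U j) (prj (2 * p) (v j)) - endo_res (U i \<inter> U j) (prj (2 * p) (v i))"
    if p: "p \<in> {1..rank B}" and ij: "i \<in> I" "j \<in> I" for p i j
  proof -
    have "corrected B correction u' i j = corrected B correction u i j + (endo_res (U i \<inter> U j) (v j) - endo_res (U i \<inter> U j) (v i))"
      unfolding c using ij by (simp add: plus_fun_apply d0_def)
    from arg_cong[OF this, of "prj (2 * p)"] show ?thesis
      using pr_corrected[OF u(1) ij p] pr_corrected[OF u(2) ij p] by (simp add: pr_add pr_diff pr_res)
  qed
  have "\<exists>y. cohomologous u y \<and> trunc_eq (Suc n) y u'" if "n \<le> rank B" for n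
    using that
  proof (induction n)
    case 0
    show ?case using cohomologous_refl[OF u(1)] trunc_eq_1[OF u] by auto
  next
    case (Suc n)
    let ?q = "Suc n"
    have q: "1 \<le> ?q" "?q \<in> {1..rank B}" using Suc.prems by auto
    obtain y where y: "cohomologous u y" "trunc_eq ?q y u'" using Suc by auto
    note yC = cohomologous_tilde(2)[OF y(1)]
    obtain w where w: "\<forall>i\<in>I. w i \<in> Der_deg X B (2 * ?q) (U i)"
      "\<forall>i\<in>I. \<forall>j\<in>I. corrected_part ?q y i j - corrected_part ?q u i j = endo_res (U i \<inter> U j) (w i) - endo_res (U i \<inter> U j) (w j)"
      using corrected_part_coboundary[OF y(1) q(1)] by blast
    \<comment> \<open>The discrepancy is the coboundary of \<open>v\<close> leading from
      \<open>u\<close> to \<open>u'\<close> corrected by that of \<open>w\<close> leading from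
      \<open>u\<close> to \<open>y\<close>; the signs follow the convention of the action.\<close>
    define z where "z i = - prj (2 * ?q) (v i) - w i" for i
    have z: "z i \<in> Der_deg X B (2 * ?q) (U i)" if "i \<in> I" for i
      unfolding z_def using w(1) Der2_pr[OF C0_D(1)[OF v that] q(1)] that
      by (intro Der_deg_diff Der_deg_uminus) auto
    obtain y' where y': "cohomologous y y'" "\<And>i j. i \<in> I \<Longrightarrow> j \<in> I \<Longrightarrow>
      y' i j - y i j - (endo_res (U i \<inter> U j) (z i) - endo_res (U i \<inter> U j) (z j)) \<in> Fil (2 * ?q + 2) (U i \<inter> U j)"
      using adjust_top_degree[OF yC q(1) z] by blast
    \<comment> \<open>Agreement below degree \<open>2 * ?q\<close> makes the corrections equal, so
      the difference of the corrected parts is the difference of the cocycles themselves in this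
      degree.\<close>
    have sel: "sel ?q y = sel ?q u'" by (rule sel_cong[OF yC u(2) q(1) y(2)])
    have "y' i j - u' i j \<in> Fil (2 * Suc ?q) (U i \<inter> U j)" if ij: "i \<in> I" "j \<in> I" for i j
    proof -
      let ?W = "U i \<inter> U j" and ?p = "prj (2 * ?q)"
      let ?r = "endo_res ?W"
      have zW: "?r (z l) \<in> Fil (2 * ?q) ?W" if "l \<in> I" "?W \<subseteq> U l" for l
        using Fil_res[OF Der_deg_Fil[OF z[OF that(1)]] that(2)] .
      have e: "y' i j - y i j - (?r (z i) - ?r (z j)) \<in> Fil (2 * ?q) ?W"
        by (rule Fil_mono[OF y'(2)[OF ij]]) simp
      have "(y' i j - y i j - (?r (z i) - ?r (z j))) + (?r (z i) - ?r (z j)) + (y i j - u' i j) \<in> Fil (2 * ?q) ?W"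
        using ij by (intro Fil_add Fil_diff zW e trunc_eqD[OF y(2)]) auto
      then have F: "y' i j - u' i j \<in> Fil (2 * ?q) ?W" by (simp add: algebra_simps)
      have "?p (y' i j - y i j - (?r (z i) - ?r (z j))) = 0"
        by (rule pr_Fil_eq_0[OF y'(2)[OF ij]]) simp
      then have 1: "?p (y' i j) - ?p (y i j) = ?r (?p (z i)) - ?r (?p (z j))"
        by (simp add: pr_diff pr_res)
      have pz: "?p (z l) = - ?p (v l) - w l" if "l \<in> I" for l
      proof -
        have "z l \<in> End_deg X B (2 * ?q) (U l)" using z[OF that] unfolding Der_deg_def by blast
        from pr_deg_self[OF this] show ?thesis unfolding z_def .
      qed
      have 2: "?p (u' i j) - ?p (y i j) = corrected_part ?q u' i j - corrected_part ?q y i j"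
        unfolding corrected_part_diff[OF yC u(2) q(1)] sel by simp
      have "corrected_part ?q u' i j - corrected_part ?q y i j = (corrected_part ?q u' i j - corrected_part ?q u i j) - (corrected_part ?q y i j - corrected_part ?q u i j)" by simp
      also have "\<dots> = (?r (?p (v j)) - ?r (?p (v i))) - (?r (w i) - ?r (w j))"
        using corrected_part[OF q(2) ij] w(2) ij by simp
      also have "\<dots> = ?r (?p (z i)) - ?r (?p (z j))"
        unfolding pz[OF ij(1)] pz[OF ij(2)] by (simp add: endo_res_diff endo_res_uminus algebra_simps)
      finally have "?p (y' i j) = ?p (u' i j)" using 1 2 by (metis diff_add_cancel)
      then have "?p (y' i j - u' i j) = 0" by (simp add: pr_diff)
      moreover have "2 * ?q + 2 = 2 * Suc ?q" by simp
      ultimately show ?thesis using Fil_step_iff[OF F] by (metis dvd_triv_left)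
    qed
    then have "trunc_eq (Suc ?q) y' u'" unfolding trunc_eq_def by blast
    then show ?case using cohomologous_trans[OF y(1) y'(1)] by blast
  qed
  \<comment> \<open>Agreement below degree \<open>2 * Suc (rank B)\<close>, a degree exceeding the
    rank, is equality.\<close>
  then obtain y where y: "cohomologous u y" "trunc_eq (Suc (rank B)) y u'" by blast
  have "y = u'"
  proof (rule C1_eqI[OF cohomologous_tilde(2)[OF y(1)] u(2)])
    fix i j assume "i \<in> I" "j \<in> I"
    have "y i j - u' i j = 0" by (rule Fil_large[OF trunc_eqD[OF y(2) \<open>i \<in> I\<close> \<open>j \<in> I\<close>]]) simp
    then show "y i j = u' i j" by simp
  qed
  then show ?thesis using y(1) by simp
qed

text \<open>The truncation is empty and the product of exponentials is the identity, which has no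
  component of degree 2. Hence the degree 2 part of a cocycle needs no correction to be
  closed.\<close>

lemma R_map_1: assumes "u \<in> tilde" shows "R_map X B I U 1 u = 0"
proof (rule ext, rule ext, rule ext)
  fix i j k
  show "R_map X B I U 1 u i j k = 0 i j k"
  proof (cases "i \<in> I \<and> j \<in> I \<and> k \<in> I")
    case True
    then have ijk: "i \<in> I" "j \<in> I" "k \<in> I" by blast+
    have "pr_upto X B (1 - 1) u l m = 0" for l m unfolding pr_upto_apply by simp
    then show ?thesis
      unfolding R_map_def mult_exp[OF ijk] Let_def
      by (simp add: exp_zero comp_Id pr_Id zero_fun_apply)
  next
    case False
    show ?thesis unfolding R_map_def mult_d1_def if_not_P[OF False] by (simp add: zero_fun_apply)
  qed
qed

text \<open>The additive coboundary of \<open>u\<close> is, degree by degree, minus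
  \<open>R_map\<close>, and the corrections contribute \<open>R_map\<close> in each degree from 4
  on; in degree 2 there is nothing to cancel.\<close>

lemma corrected_cocycle: assumes u: "u \<in> tilde" shows "corrected B correction u \<in> Z1_Der2 X B I U"
proof -
  have "u = (\<Sum>q=1..rank B. pr_cochain X B (2 * q) u)"
  proof (rule ext, rule ext)
    fix i j
    have e: "(\<Sum>q=1..rank B. pr_cochain X B (2 * q) u) i j = (\<Sum>q=1..rank B. prj (2 * q) (u i j))"
      by (simp only: sum_fun_apply pr_cochain_def)
    show "u i j = (\<Sum>q=1..rank B. pr_cochain X B (2 * q) u) i j"
      unfolding e
    proof (cases "i \<in> I \<and> j \<in> I")
      case True
      then show "u i j = (\<Sum>q=1..rank B. prj (2 * q) (u i j))"
        using Der2_decomp[OF tilde_D(1)[OF u]] by blast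
    next
      case False
      show "u i j = (\<Sum>q=1..rank B. prj (2 * q) (u i j))" unfolding tilde_D(3)[OF u False] by simp
    qed
  qed
  then have "d1 I U u = (\<Sum>q=1..rank B. d1 I U (pr_cochain X B (2 * q) u))"
    using d1_sum[of "\<lambda>q. pr_cochain X B (2 * q) u" "{1..rank B}"] by simp
  also have "\<dots> = (\<Sum>q=1..rank B. - R_map X B I U q u)"
    using R_map_eq[OF u] by (intro sum.cong refl) simp
  also have "\<dots> = (\<Sum>q=2..rank B. - R_map X B I U q u)"
    using R_map_1[OF u] by (intro sum.mono_neutral_right) (auto simp: not_le less_2_cases_iff)
  finally have d1u: "d1 I U u = - (\<Sum>q=2..rank B. R_map X B I U q u)" by (simp only: sum_negf)
  have "(\<Sum>q=2..rank B. d1 I U (correction q u)) = (\<Sum>q=2..rank B. R_map X B I U q u)"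
    by (intro sum.cong refl d1_correction[OF u]) simp
  then have "d1 I U (corrected B correction u) = 0"
    unfolding corrected_def d1_add d1_sum d1u by simp
  moreover have "corrected B correction u \<in> C1 I U D2"
  proof (rule C1_I)
    fix i j assume ij: "i \<in> I" "j \<in> I"
    show "corrected B correction u i j \<in> D2 (U i \<inter> U j)"
      unfolding corrected_apply[OF u ij]
    proof (rule Der2_sum)
      fix q assume "q \<in> {1..rank B}"
      then have q: "1 \<le> q" by simp
      show "corrected_part q u i j \<in> D2 (U i \<inter> U j)" by (rule Der_deg_Der2[OF corrected_part_Der_deg[OF u ij q] q])
    qed
    have "corrected_part q u j i = - corrected_part q u i j" for q
      using tilde_D(2)[OF u ij] tilde_D(2)[OF sel_tilde[OF u] ij, of q] unfolding corrected_part_def by (simp only: pr_uminus) simp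
    then show "corrected B correction u j i = - corrected B correction u i j"
      by (simp only: corrected_apply[OF u ij] corrected_apply[OF u ij(2,1)] sum_negf)
  qed (rule corrected_outside[OF u])
  ultimately show ?thesis unfolding Z1_Der2_def by blast
qed

section \<open>The map on cohomology sets\<close>

lemma H1_G_representative:
  assumes "c \<in> H1_G X B I U"
  obtains u where "u \<in> tilde" "c = G_class X B I U (exp_cochain X B I U u)"
proof -
  obtain g where g: "g \<in> Z1_G X B I U" "c = G_class X B I U g" using assms unfolding H1_G_def by blast
  then obtain u where "u \<in> C1 I U D2" "g = exp_cochain X B I U u" unfolding Z1_G_def by blast
  then show ?thesis using g that[of u] unfolding C1_tilde_def by blast
qed

lemma classifying_map:
  "\<exists>D'. admissible_family X B I U D' \<and>
    (\<exists>\<sigma> \<in> H1_G X B I U \<rightarrow> H1_Der2 X B I U.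
      (\<forall>u \<in> C1_tilde X B I U.
         \<sigma> (G_class X B I U (exp_cochain X B I U u)) = Der2_class X B I U (corrected B D' u)) \<and>
      inj_on \<sigma> (H1_G X B I U))"
proof -
  let ?G = "\<lambda>u. G_class X B I U (exp_cochain X B I U u)"
  \<comment> \<open>The map is defined by an arbitrary representative of each orbit; that
    cohomologous cocycles have the same corrected class makes the formula hold for every
    representative.\<close>
  define rep where "rep c = (SOME u. u \<in> tilde \<and> ?G u = c)" for c
  define \<sigma> where "\<sigma> c = Der2_class X B I U (corrected B correction (rep c))" for c
  have rep: "rep (?G u) \<in> tilde \<and> ?G (rep (?G u)) = ?G u" if "u \<in> tilde" for u
    unfolding rep_def by (rule someI[where x = u]) (use that in blast)
  have \<sigma>: "\<sigma> (?G u) = Der2_class X B I U (corrected B correction u)" if u: "u \<in> tilde" for u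
    unfolding \<sigma>_def using rep[OF u] G_class_eq_iff u by (intro cohomologous_corrected) blast
  have "\<sigma> \<in> H1_G X B I U \<rightarrow> H1_Der2 X B I U"
  proof (rule Pi_I)
    fix c assume "c \<in> H1_G X B I U"
    then obtain u where u: "u \<in> tilde" "c = ?G u" by (rule H1_G_representative)
    show "\<sigma> c \<in> H1_Der2 X B I U"
      unfolding u(2) \<sigma>[OF u(1)] H1_Der2_def by (rule imageI[OF corrected_cocycle[OF u(1)]])
  qed
  moreover have "inj_on \<sigma> (H1_G X B I U)"
  proof (rule inj_onI)
    fix c c' assume "c \<in> H1_G X B I U" "c' \<in> H1_G X B I U" and eq: "\<sigma> c = \<sigma> c'"
    then obtain u u' where u: "u \<in> tilde" "c = ?G u" "u' \<in> tilde" "c' = ?G u'"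
      using H1_G_representative by metis
    have "cohomologous u u'" using eq unfolding u \<sigma>[OF u(1)] \<sigma>[OF u(3)] by (rule corrected_cohomologous[OF u(1,3)])
    then show "c = c'" unfolding u using G_class_eq_iff[OF u(1,3)] by blast
  qed
  ultimately show ?thesis using correction_admissible \<sigma> by blast
qed

end

theorem corollary1p2:
  fixes X :: "'m cmanifold" and B :: "('m, 'e) vbundle"
    and I :: "'i set" and U :: "'i \<Rightarrow> 'm set"
  assumes "complex_manifold X"
    and "holomorphic_vector_bundle X B"
    and "leray_cover X I U"
    and "H0_Der2 X B = {0}"
  shows "\<exists>D'. admissible_family X B I U D' \<and>
    (\<exists>\<sigma> \<in> H1_G X B I U \<rightarrow> H1_Der2 X B I U.
      (\<forall>u \<in> C1_tilde X B I U.
         \<sigma> (G_class X B I U (exp_cochain X B I U u)) = Der2_class X B I U (corrected B D' u)) \<and>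
      inj_on \<sigma> (H1_G X B I U))"
proof -
  have "\<forall>i\<in>I. openin (mtop X) (U i)" "(\<Union>i\<in>I. U i) = topspace (mtop X)"
    using assms(3) unfolding leray_cover_def by blast+
  then interpret covered_bundle X B I U
    using assms by unfold_locales blast+
  show ?thesis by (rule classifying_map)
qed

end
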